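(* Let $H$ be a fixed non-matching graph with $e(H)\ge 3$, and let $\ell$ be a fixed integer satisfying $e(H)\le \ell<(e(H)-1)^{e(H)/(e(H)-2)}$. For every $\varepsilon>0$ there are constants $A=A(H,\ell,\varepsilon)>0$ and $\gamma=\gamma(H,\ell,\varepsilon)>0$ such that, if $p=p(n)\in[0,1]$ satisfies $p\ge A n^{-1/m_2(H)}$, then with high probability $$\bigl|\{\chi\in\mathcal R_{H,\ell}(G(n,p)): d_{e(H)-1}(\chi)\ge \varepsilon\, e(G(n,p))\}\bigr|\le (e(H)-1)^{(1-\gamma)e(G(n,p))}.$$ Consequently, the number of such colourings is $o(R_{H,\ell}(G(n,p)))$.
   Context: All graphs are finite and simple; $v(G)$, $e(G)$ denote numbers of vertices and edges. $H$ has no isolated vertices (isolated vertices play no role and are deleted). $H$ is non-matching if it contains two adjacent edges. $[s]=\{1,\dots,s\}$. $G(n,p)$ is the binomial random graph on $[n]$, each edge present independently with probability $p$. "With high probability" means with probability tending to $1$ as $n\to\infty$. A copy of $H$ (as a not necessarily induced subgraph) in an edge-coloured graph is rainbow if its edges receive pairwise distinct colours. $\mathcal R_{H,\ell}(G)$ is the set of maps $\chi:E(G)\to[\ell]$ such that $G$ coloured by $\chi$ contains no rainbow copy of $H$, and $R_{H,\ell}(G)=|\mathcal R_{H,\ell}(G)|$. For $\chi:E(G)\to[\ell]$, $d_{e(H)-1}(\chi)=\min_{B}|\{e\in E(G):\chi(e)\notin B\}|$, the minimum being over all $B\subseteq[\ell]$ with $|B|=e(H)-1$. The maximum 2-density is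 $m_2(H)=\max\{\frac{e(F)-1}{v(F)-2}: F\subseteq H,\ v(F)\ge 3\}$. *)

theory Defs
  imports "HOL-Probability.Probability"
begin

datatype 'a sgraph = SGraph (verts: "'a set") (edges: "'a set set")

definition simple_graph :: "'a sgraph \<Rightarrow> bool" where
  "simple_graph G \<longleftrightarrow> finite (verts G) \<and> (\<forall>e\<in>edges G. e \<subseteq> verts G \<and> card e = 2)"

definition num_verts :: "'a sgraph \<Rightarrow> nat" where
  "num_verts G = card (verts G)"

definition num_edges :: "'a sgraph \<Rightarrow> nat" where
  "num_edges G = card (edges G)"

definition no_isolated_vertices :: "'a sgraph \<Rightarrow> bool" where
  "no_isolated_vertices G \<longleftrightarrow> (\<forall>v\<in>verts G. \<exists>e\<in>edges G. v \<in> e)"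

definition non_matching :: "'a sgraph \<Rightarrow> bool" where
  "non_matching G \<longleftrightarrow> (\<exists>e\<in>edges G. \<exists>f\<in>edges G. e \<noteq> f \<and> e \<inter> f \<noteq> {})"

definition subgraph :: "'a sgraph \<Rightarrow> 'a sgraph \<Rightarrow> bool" where
  "subgraph F G \<longleftrightarrow> simple_graph F \<and> verts F \<subseteq> verts G \<and> edges F \<subseteq> edges G"

definition isomorphic :: "'a sgraph \<Rightarrow> 'b sgraph \<Rightarrow> bool" where
  "isomorphic H F \<longleftrightarrow>
     (\<exists>f. bij_betw f (verts H) (verts F) \<and> edges F = (\<lambda>e. f ` e) ` edges H)"

text \<open>The maximum is over a nonempty finite set when \<open>H\<close> is finite with at least three vertices,
  in particular when \<open>H\<close> is non-matching.\<close>

definition m2 :: "'a sgraph \<Rightarrow> real" where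
  "m2 H = Max {(real (num_edges F) - 1) / (real (num_verts F) - 2) | F.
                 subgraph F H \<and> num_verts F \<ge> 3}"

definition rainbow_copy :: "'a sgraph \<Rightarrow> 'b sgraph \<Rightarrow> ('b set \<Rightarrow> nat) \<Rightarrow> 'b sgraph \<Rightarrow> bool" where
  "rainbow_copy H G c F \<longleftrightarrow> subgraph F G \<and> isomorphic H F \<and> inj_on c (edges F)"

text \<open>Colourings are extensional functions (undefined off the edge set), so that cardinalities
  of sets of them count the maps from the edge set to the palette.\<close>

definition rainbow_free_colourings :: "'a sgraph \<Rightarrow> nat \<Rightarrow> 'b sgraph \<Rightarrow> ('b set \<Rightarrow> nat) set" where
  "rainbow_free_colourings H l G =
     {c \<in> edges G \<rightarrow>\<^sub>E {1..l}. \<not> (\<exists>F. rainbow_copy H G c F)}"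

definition num_rainbow_free :: "'a sgraph \<Rightarrow> nat \<Rightarrow> 'b sgraph \<Rightarrow> nat" where
  "num_rainbow_free H l G = card (rainbow_free_colourings H l G)"

text \<open>The minimum ranges over a nonempty set only for \<open>k \<le> l\<close>.\<close>

definition colour_dist :: "nat \<Rightarrow> nat \<Rightarrow> 'b sgraph \<Rightarrow> ('b set \<Rightarrow> nat) \<Rightarrow> nat" where
  "colour_dist k l G c =
     Min {card {e \<in> edges G. c e \<notin> B} | B. B \<subseteq> {1..l} \<and> card B = k}"

definition far_colourings :: "'a sgraph \<Rightarrow> nat \<Rightarrow> real \<Rightarrow> 'b sgraph \<Rightarrow> ('b set \<Rightarrow> nat) set" where
  "far_colourings H l \<epsilon> G =
     {c \<in> rainbow_free_colourings H l G.
        real (colour_dist (num_edges H - 1) l G c) \<ge> \<epsilon> * real (num_edges G)}"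

definition pairs :: "nat \<Rightarrow> nat set set" where
  "pairs n = {e. e \<subseteq> {1..n} \<and> card e = 2}"

definition Gnp :: "nat \<Rightarrow> real \<Rightarrow> nat sgraph pmf" where
  "Gnp n p = map_pmf (\<lambda>X. SGraph {1..n} {e \<in> pairs n. X e})
               (Pi_pmf (pairs n) False (\<lambda>_. bernoulli_pmf p))"

definition whp :: "(nat \<Rightarrow> 'b pmf) \<Rightarrow> ('b \<Rightarrow> bool) \<Rightarrow> bool" where
  "whp D P \<longleftrightarrow> (\<lambda>n. measure_pmf.prob (D n) {x. P x}) \<longlonglongrightarrow> 1"

end

theory Submission
  imports Defs "HOL-Real_Asymp.Real_Asymp"
begin

text \<open>
  A colouring of a graph on \<open>{1..n}\<close> is a set of (pair, colour) couples, and it is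
  rainbow-\<open>H\<close>-free iff this set is independent in the hypergraph of rainbow copies of \<open>H\<close>.
  The container method encloses it in one of few sets \<open>C\<close> with few rainbow copies, determined by a small
  fingerprint inside the colouring. A container assigns a palette to each pair. Almost every copy of \<open>H\<close>
  has no rainbow choice from its palettes, so \<open>j\<close> of its \<open>k\<close> edges have palettes of size
  below \<open>j\<close>, and the upper bound on \<open>l\<close> makes the product of its palette sizes smaller than
  \<open>(k - 1)\<^sup>k\<close> by a constant factor unless all palettes are one common \<open>(k - 1)\<close>-set.
  Averaging over all copies, either the palette sizes have geometric mean smaller than \<open>k - 1\<close> by a
  constant factor, or almost all pairs carry the same palette \<open>B\<close>. Exponential moments and a union bound
  over fingerprints transfer this to the random graph: containers of the first kind hold few colourings, and those of
  the second kind hold only colourings close to \<open>B\<close>.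

  The container lemma scans the vertices once and keeps a vertex of the independent set if its link still has large
  weight after discarding all sets that contain a saturated subset. The kept links form a hypergraph of uniformity one
  less with the same type of degree bounds. If its weight is small, then the vertices with small remaining links form
  a container. Otherwise one recurses into it.
\<close>

subsection \<open>Hypergraph containers\<close>

text \<open>Up to constants, a fingerprint has as many elements as the random graph has edges at the
  threshold density, so the bare number of fingerprints is too large by a logarithm in the exponent.
  What saves the union bound is that a fingerprint lies inside the colouring: all its pairs must be
  edges of the random graph, which costs a factor of order p per element. With these weights the sum
  over fingerprints is only \<open>exp\<close> of a small multiple of the expected number of edges
  once \<open>A\<close> is large. For this reason the tail estimate is stated jointly with the event
  that a prescribed set of pairs is present. Products of palette sizes are handled through
  logarithms: sums over pairs can be averaged over copies and then concentrate on random edge sets.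
  An empty palette would give the logarithm of 0. Its score is set to -k ln l instead, low enough to
  outweigh the other k - 1 edges of a copy and still bounded, as exponential moments
  require.\<close>

definition wtot :: "('v set \<Rightarrow> real) \<Rightarrow> 'v set \<Rightarrow> real" where
  "wtot w V = (\<Sum>A\<in>Pow V. w A)"

definition wdeg :: "('v set \<Rightarrow> real) \<Rightarrow> 'v set \<Rightarrow> 'v set \<Rightarrow> real" where
  "wdeg w V T = (\<Sum>A\<in>{A\<in>Pow V. T \<subseteq> A}. w A)"

text \<open>The codegree condition of the container method, scaled so that a single vertex has
  degree at most \<open>K\<close> and each further vertex costs a factor \<open>\<tau>\<close>.
  Weights replace edge sets because links are accumulated with multiplicity and rescaled. Only edges
  inside \<open>V\<close> are summed, so passing to a smaller vertex set leaves \<open>w\<close>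
  itself unchanged.\<close>

definition spread_weight :: "nat \<Rightarrow> real \<Rightarrow> real \<Rightarrow> 'v set \<Rightarrow> ('v set \<Rightarrow> real) \<Rightarrow> bool" where
  "spread_weight k K \<tau> V w \<longleftrightarrow>
     finite V \<and> (\<forall>A. 0 \<le> w A) \<and> (\<forall>A. w A \<noteq> 0 \<longrightarrow> card A = k) \<and>
     (\<forall>T. T \<subseteq> V \<longrightarrow> T \<noteq> {} \<longrightarrow> wdeg w V T \<le> K * \<tau> ^ (card T - 1))"

definition independent_set :: "('v set \<Rightarrow> real) \<Rightarrow> 'v set \<Rightarrow> bool" where
  "independent_set w I \<longleftrightarrow> (\<forall>A. A \<subseteq> I \<longrightarrow> w A = 0)"

lemma independent_set_mono: "independent_set w I \<Longrightarrow> J \<subseteq> I \<Longrightarrow> independent_set w J"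
  unfolding independent_set_def by blast

lemma wdeg_nonneg: "(\<And>A. 0 \<le> w A) \<Longrightarrow> 0 \<le> wdeg w V T"
  unfolding wdeg_def by (rule sum_nonneg) simp

lemma wdeg_mono_verts:
  assumes "finite V" "C \<subseteq> V" "\<And>A. 0 \<le> w A"
  shows "wdeg w C T \<le> wdeg w V T"
  unfolding wdeg_def using assms by (intro sum_mono2) auto

lemma spread_weight_subset:
  assumes "spread_weight k K \<tau> V w" "C \<subseteq> V"
  shows "spread_weight k K \<tau> C w"
  using assms wdeg_mono_verts[of V C w] finite_subset[of C V]
  unfolding spread_weight_def by (meson order_trans)

text \<open>Double counting: an edge of size k contains 2^k sets T. This will bound the weight
  sitting on saturated sets by the total weight of the accumulated links.\<close>

lemma sum_wdeg_all:
  assumes "finite V" "\<And>A. w A \<noteq> 0 \<Longrightarrow> card A = k"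
  shows "(\<Sum>T\<in>Pow V. wdeg w V T) = 2 ^ k * wtot w V"
proof -
  have "(\<Sum>T\<in>Pow V. wdeg w V T) = (\<Sum>T\<in>Pow V. \<Sum>A\<in>Pow V. if T \<subseteq> A then w A else 0)"
    unfolding wdeg_def using assms(1) by (subst sum.inter_filter) auto
  also have "\<dots> = (\<Sum>A\<in>Pow V. \<Sum>T\<in>Pow V. if T \<subseteq> A then w A else 0)"
    by (rule sum.swap)
  also have "\<dots> = (\<Sum>A\<in>Pow V. 2 ^ k * w A)"
  proof (rule sum.cong)
    fix A assume A: "A \<in> Pow V"
    then have fA: "finite A" using assms(1) finite_subset by auto
    have "(\<Sum>T\<in>Pow V. if T \<subseteq> A then w A else 0) = (\<Sum>T\<in>{T\<in>Pow V. T \<subseteq> A}. w A)"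
      using assms(1) by (intro sum.inter_filter[symmetric]) simp
    also have "{T\<in>Pow V. T \<subseteq> A} = Pow A" using A by auto
    finally show "(\<Sum>T\<in>Pow V. if T \<subseteq> A then w A else 0) = 2 ^ k * w A"
      using assms(2)[of A] fA by (cases "w A = 0") (auto simp: card_Pow)
  qed simp
  finally show ?thesis by (simp add: wtot_def sum_distrib_left)
qed

lemma sum_UNION_le:
  fixes w :: "'b \<Rightarrow> real"
  assumes "finite I" "\<And>i. i \<in> I \<Longrightarrow> finite (F i)" "\<And>x. 0 \<le> w x"
  shows "(\<Sum>x\<in>(\<Union>i\<in>I. F i). w x) \<le> (\<Sum>i\<in>I. \<Sum>x\<in>F i. w x)"
  using assms(1,2)
proof (induction I)
  case (insert i I)
  have "(\<Sum>x\<in>F i \<union> (\<Union>i\<in>I. F i). w x) \<le> (\<Sum>x\<in>F i. w x) + (\<Sum>x\<in>(\<Union>i\<in>I. F i). w x)"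
    using insert.prems insert.hyps assms(3) by (subst sum_Un) (auto intro: sum_nonneg)
  then show ?case using insert by fastforce
qed simp

text \<open>An edge lost on passing to \<open>C\<close> meets \<open>V - C\<close>, and singletons
  have degree at most \<open>K\<close>. Read backwards, a subset of much smaller weight must omit a
  positive proportion of the vertices; this is how containers are shown to shrink.\<close>

lemma wtot_diff_le:
  assumes sp: "spread_weight k K \<tau> V w" and C: "C \<subseteq> V"
  shows "wtot w V \<le> wtot w C + K * real (card (V - C))"
proof -
  from sp have fin: "finite V" and nn: "\<And>A. 0 \<le> w A"
    and dg: "\<And>v. v \<in> V \<Longrightarrow> wdeg w V {v} \<le> K"
    unfolding spread_weight_def by (auto dest: spec[of _ "{_}"])
  have "wtot w V = wtot w C + (\<Sum>A\<in>Pow V - Pow C. w A)"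
    unfolding wtot_def using fin C by (subst sum.subset_diff[of "Pow C" "Pow V"]) auto
  also have "(\<Sum>A\<in>Pow V - Pow C. w A) \<le> (\<Sum>A\<in>(\<Union>v\<in>V-C. {A\<in>Pow V. {v} \<subseteq> A}). w A)"
    using fin nn by (intro sum_mono2) auto
  also have "\<dots> \<le> (\<Sum>v\<in>V-C. \<Sum>A\<in>{A\<in>Pow V. {v} \<subseteq> A}. w A)"
    using fin nn by (intro sum_UNION_le) auto
  also have "\<dots> \<le> (\<Sum>v\<in>V-C. K)"
    using dg unfolding wdeg_def by (intro sum_mono) auto
  finally show ?thesis by (simp add: mult.commute)
qed

lemma wtot_le:
  assumes sp: "spread_weight k K \<tau> V w" and "k > 0"
  shows "wtot w V \<le> K * real (card V)"
proof -
  have "w {} = 0" using assms unfolding spread_weight_def by fastforce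
  then show ?thesis using wtot_diff_le[OF sp, of "{}"] by (simp add: wtot_def)
qed

section \<open>Greedy scans of a vertex list\<close>

fun scan :: "('s \<Rightarrow> 'v \<Rightarrow> bool) \<Rightarrow> ('s \<Rightarrow> 'v \<Rightarrow> 's) \<Rightarrow> 'v set \<Rightarrow> 'v list \<Rightarrow> 's \<Rightarrow> 's" where
  "scan ok upd I [] s = s"
| "scan ok upd I (v # vs) s = scan ok upd I vs (if v \<in> I \<and> ok s v then upd s v else s)"

fun picks :: "('s \<Rightarrow> 'v \<Rightarrow> bool) \<Rightarrow> ('s \<Rightarrow> 'v \<Rightarrow> 's) \<Rightarrow> 'v set \<Rightarrow> 'v list \<Rightarrow> 's \<Rightarrow> 'v set" where
  "picks ok upd I [] s = {}"
| "picks ok upd I (v # vs) s =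
     (if v \<in> I \<and> ok s v then insert v (picks ok upd I vs (upd s v)) else picks ok upd I vs s)"

lemma picks_subset: "picks ok upd I vs s \<subseteq> I \<inter> set vs"
  by (induction vs arbitrary: s) auto

text \<open>A fingerprint may be enlarged inside \<open>I\<close> without changing the run; this lets the
  fingerprints of successive runs be merged into one set.\<close>

lemma scan_picks_cong:
  assumes "picks ok upd I vs s \<subseteq> J" "J \<subseteq> I"
  shows "scan ok upd J vs s = scan ok upd I vs s \<and> picks ok upd J vs s = picks ok upd I vs s"
  using assms by (induction vs arbitrary: s) (auto split: if_splits)

lemma scan_invariant:
  assumes "P s" "\<And>s v. P s \<Longrightarrow> v \<in> I \<Longrightarrow> v \<in> set vs \<Longrightarrow> ok s v \<Longrightarrow> P (upd s v)"
  shows "P (scan ok upd I vs s)"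
  using assms by (induction vs arbitrary: s) auto

lemma scan_ok_antimono:
  assumes "\<And>s v u. P s \<Longrightarrow> ok (upd s v) u \<Longrightarrow> ok s u" "P s"
    "\<And>s v. P s \<Longrightarrow> v \<in> I \<Longrightarrow> v \<in> set vs \<Longrightarrow> ok s v \<Longrightarrow> P (upd s v)"
    "ok (scan ok upd I vs s) u"
  shows "ok s u"
  using assms(2-) by (induction vs arbitrary: s) (auto split: if_splits intro: assms(1))

text \<open>A vertex of \<open>I\<close> that was not kept failed the test when it was reached, and
  a failed test stays failed under later updates. Hence the final state alone describes a set that
  covers all of \<open>I\<close> except the kept vertices.\<close>

lemma scan_not_picked:
  assumes anti: "\<And>s v u. P s \<Longrightarrow> ok (upd s v) u \<Longrightarrow> ok s u" and "P s"
    and "\<And>s v. P s \<Longrightarrow> v \<in> I \<Longrightarrow> v \<in> set vs \<Longrightarrow> ok s v \<Longrightarrow> P (upd s v)"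
    and "u \<in> I" "u \<in> set vs" "u \<notin> picks ok upd I vs s"
  shows "\<not> ok (scan ok upd I vs s) u"
  using assms(2-)
proof (induction vs arbitrary: s)
  case (Cons v vs)
  let ?s = "if v \<in> I \<and> ok s v then upd s v else s"
  have P: "P ?s" using Cons.prems(1,2) by auto
  have st: "\<And>s v. P s \<Longrightarrow> v \<in> I \<Longrightarrow> v \<in> set vs \<Longrightarrow> ok s v \<Longrightarrow> P (upd s v)"
    using Cons.prems(2) by simp
  show ?case
  proof (cases "u \<in> set vs")
    case True
    then show ?thesis using Cons.IH[OF P st Cons.prems(3)] Cons.prems(5) by (auto split: if_splits)
  next
    case False
    then have "u = v" using Cons.prems(4) by simp
    with Cons.prems(3,5) have "\<not> ok s u" by auto
    then have "\<not> ok ?s u" using \<open>u = v\<close> by simp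
    then show ?thesis using scan_ok_antimono[where P=P and ok=ok and upd=upd, OF anti P st]
      by auto
  qed
qed simp

text \<open>A potential argument: every kept vertex raises \<open>\<mu>\<close> by at least
  \<open>c\<close>, so an upper bound on the final potential bounds the fingerprint.\<close>

lemma card_picks_le:
  fixes \<mu> :: "'s \<Rightarrow> real"
  assumes "P s" "\<And>s v. P s \<Longrightarrow> v \<in> I \<Longrightarrow> v \<in> set vs \<Longrightarrow> ok s v \<Longrightarrow> P (upd s v)"
    "\<And>s v. P s \<Longrightarrow> ok s v \<Longrightarrow> \<mu> s + c \<le> \<mu> (upd s v)" "c \<ge> 0"
  shows "\<mu> s + c * real (card (picks ok upd I vs s)) \<le> \<mu> (scan ok upd I vs s)"
  using assms
proof (induction vs arbitrary: s)
  case (Cons v vs)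
  show ?case
  proof (cases "v \<in> I \<and> ok s v")
    case True
    have IH: "\<mu> (upd s v) + c * real (card (picks ok upd I vs (upd s v)))
              \<le> \<mu> (scan ok upd I vs (upd s v))"
      using Cons.prems True by (intro Cons.IH) auto
    have "finite (picks ok upd I vs (upd s v))"
      using picks_subset[of ok upd I vs] finite_subset by fastforce
    then have "card (insert v (picks ok upd I vs (upd s v)))
                 \<le> Suc (card (picks ok upd I vs (upd s v)))"
      by (simp add: card_insert_if)
    then have "c * real (card (insert v (picks ok upd I vs (upd s v))))
                 \<le> c * (1 + real (card (picks ok upd I vs (upd s v))))"
      using Cons.prems(4) by (intro mult_left_mono) auto
    then show ?thesis using True IH Cons.prems(3)[OF Cons.prems(1), of v]
      by (simp add: algebra_simps)
  next
    case False
    then show ?thesis using Cons.IH[of s] Cons.prems by auto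
  qed
qed simp


text \<open>New link edges avoid saturated sets, so the degrees of the accumulated link hypergraph exceed the
  threshold \<open>K \<tau>\<^sup>t\<^sup>-\<^sup>1\<close> by at most one increment, which has the same size.\<close>

definition saturated :: "real \<Rightarrow> real \<Rightarrow> 'v set \<Rightarrow> ('v set \<Rightarrow> real) \<Rightarrow> 'v set set" where
  "saturated K \<tau> V g = {T. T \<noteq> {} \<and> T \<subseteq> V \<and> K * \<tau> ^ (card T - 1) \<le> wdeg g V T}"

text \<open>Division by \<open>\<tau>\<close> cancels the factor that the extra vertex
  \<open>v\<close> contributes to codegrees, so links obey the same bounds with uniformity lowered
  by one. Sets \<open>A\<close> containing \<open>v\<close> are excluded because
  \<open>insert v A = A\<close> would count an edge of full size.\<close>

definition link_weight ::
    "real \<Rightarrow> real \<Rightarrow> 'v set \<Rightarrow> ('v set \<Rightarrow> real) \<Rightarrow> ('v set \<Rightarrow> real) \<Rightarrow> 'v \<Rightarrow> 'v set \<Rightarrow> real" where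
  "link_weight K \<tau> V w g v A =
     (if v \<notin> A \<and> A \<subseteq> V \<and> \<not> (\<exists>T\<in>saturated K \<tau> V g. T \<subseteq> A) then w (insert v A) / \<tau> else 0)"

lemma wdeg_add: "wdeg (\<lambda>A. g A + h A) V T = wdeg g V T + wdeg h V T"
  by (simp add: wdeg_def sum.distrib)

lemma wtot_add: "wtot (\<lambda>A. g A + h A) V = wtot g V + wtot h V"
  by (simp add: wtot_def sum.distrib)

section \<open>One scan of a hypergraph\<close>

context
  fixes k :: nat and K \<tau> \<theta> :: real and V :: "'v set" and w :: "'v set \<Rightarrow> real"
  assumes sp: "spread_weight (Suc k) K \<tau> V w" and \<tau>: "\<tau> > 0" and K: "K > 0" and \<theta>: "\<theta> > 0"
begin

private abbreviation (input) "lw \<equiv> link_weight K \<tau> V w"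
private abbreviation (input) "sat \<equiv> saturated K \<tau> V"
private abbreviation (input) "add_link \<equiv> \<lambda>g v A. g A + lw g v A"
private abbreviation (input) "heavy \<equiv> \<lambda>g v. \<theta> / \<tau> \<le> wtot (lw g v) V"

private lemma fin: "finite V" and w_nonneg: "0 \<le> w A"
  and w_supp: "w A \<noteq> 0 \<Longrightarrow> card A = Suc k"
  and w_deg: "T \<subseteq> V \<Longrightarrow> T \<noteq> {} \<Longrightarrow> wdeg w V T \<le> K * \<tau> ^ (card T - 1)"
  using sp unfolding spread_weight_def by auto

private lemma lw_nonneg: "0 \<le> lw g v A"
  using w_nonneg \<tau> by (simp add: link_weight_def)

private lemma lw_supp: "A \<subseteq> V \<Longrightarrow> lw g v A \<noteq> 0 \<Longrightarrow> card A = k"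
  using w_supp[of "insert v A"] finite_subset[OF _ fin, of A]
  by (auto simp: link_weight_def split: if_splits)

private lemma lw_outside: "\<not> A \<subseteq> V \<Longrightarrow> lw g v A = 0"
  by (simp add: link_weight_def)

private lemma wdeg_lw_le:
  assumes T: "T \<subseteq> V" "T \<noteq> {}" and v: "v \<in> V"
  shows "wdeg (lw g v) V T \<le> K * \<tau> ^ (card T - 1)"
proof (cases "v \<in> T")
  case True
  then have "wdeg (lw g v) V T = 0"
    unfolding wdeg_def by (intro sum.neutral) (auto simp: link_weight_def)
  then show ?thesis using K \<tau> by simp
next
  case False
  have fT: "finite T" using T fin finite_subset by auto
  have cT: "card T > 0" using fT T by (simp add: card_gt_0_iff)
  have "wdeg (lw g v) V T \<le> (\<Sum>A\<in>{A\<in>Pow V. T \<subseteq> A \<and> v \<notin> A}. w (insert v A) / \<tau>)"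
  proof -
    have "wdeg (lw g v) V T = (\<Sum>A\<in>{A\<in>Pow V. T \<subseteq> A \<and> v \<notin> A}. lw g v A)"
      unfolding wdeg_def using fin by (intro sum.mono_neutral_right) (auto simp: link_weight_def)
    also have "\<dots> \<le> (\<Sum>A\<in>{A\<in>Pow V. T \<subseteq> A \<and> v \<notin> A}. w (insert v A) / \<tau>)"
      using w_nonneg \<tau> by (intro sum_mono) (auto simp: link_weight_def)
    finally show ?thesis .
  qed
  also have "\<dots> = (\<Sum>B\<in>insert v ` {A\<in>Pow V. T \<subseteq> A \<and> v \<notin> A}. w B) / \<tau>"
    by (subst sum.reindex) (auto simp: inj_on_def sum_divide_distrib)
  also have "\<dots> \<le> wdeg w V (insert v T) / \<tau>"
    unfolding wdeg_def using \<tau> v fin w_nonneg by (intro divide_right_mono sum_mono2) auto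
  also have "\<dots> \<le> K * \<tau> ^ (card (insert v T) - 1) / \<tau>"
    using w_deg[of "insert v T"] T v \<tau> by (intro divide_right_mono) auto
  also have "\<dots> = K * \<tau> ^ (card T - 1)"
    using False fT cT \<tau> by (cases "card T") (auto simp: card_insert_if)
  finally show ?thesis .
qed

text \<open>\<open>I\<close> stays independent in the accumulated links: for \<open>v\<close> in
  \<open>I\<close> and \<open>A\<close> inside \<open>I\<close> the set \<open>insert v A\<close>
  lies in \<open>I\<close>, so \<open>w\<close> vanishes on it. This allows recursion on the same
  \<open>I\<close> in lower uniformity.\<close>

private definition link_inv :: "'v set \<Rightarrow> ('v set \<Rightarrow> real) \<Rightarrow> bool" where
  "link_inv I g \<longleftrightarrow> spread_weight k (2 * K) \<tau> V g \<and> independent_set g I"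

private lemma link_inv_zero: "link_inv I (\<lambda>_. 0)"
  using fin K \<tau> by (simp add: link_inv_def spread_weight_def independent_set_def wdeg_def)

private lemma link_inv_add:
  assumes inv: "link_inv I g" and v: "v \<in> I" and I: "I \<subseteq> V" "independent_set w I"
  shows "link_inv I (add_link g v)"
proof -
  from inv have g: "\<And>A. 0 \<le> g A" "\<And>A. g A \<noteq> 0 \<Longrightarrow> card A = k"
    "\<And>T. T \<subseteq> V \<Longrightarrow> T \<noteq> {} \<Longrightarrow> wdeg g V T \<le> 2 * K * \<tau> ^ (card T - 1)"
    and gi: "\<And>A. A \<subseteq> I \<Longrightarrow> g A = 0"
    unfolding link_inv_def spread_weight_def independent_set_def by auto
  have vV: "v \<in> V" using v I by auto
  have "wdeg (add_link g v) V T \<le> 2 * K * \<tau> ^ (card T - 1)" if T: "T \<subseteq> V" "T \<noteq> {}" for T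
  proof (cases "T \<in> sat g")
    case True
    then have "wdeg (lw g v) V T = 0"
      unfolding wdeg_def by (intro sum.neutral) (auto simp: link_weight_def)
    then show ?thesis using g(3)[OF T] by (simp add: wdeg_add)
  next
    case False
    then have "wdeg g V T \<le> K * \<tau> ^ (card T - 1)" using T by (auto simp: saturated_def)
    then show ?thesis using wdeg_lw_le[OF T vV, of g] by (simp add: wdeg_add)
  qed
  moreover have "card A = k" if "g A + lw g v A \<noteq> 0" for A
    using that g(2)[of A] lw_supp[of A g v] lw_outside[of A g v] by (cases "g A = 0") auto
  moreover have "lw g v A = 0" if "A \<subseteq> I" for A
    using that v I(2) by (auto simp: link_weight_def independent_set_def)
  ultimately show ?thesis
    unfolding link_inv_def spread_weight_def independent_set_def
    using fin g(1) lw_nonneg gi by (auto intro: add_nonneg_nonneg)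
qed

private lemma saturated_add: "sat g \<subseteq> sat (add_link g v)"
proof
  fix T assume "T \<in> sat g"
  moreover have "0 \<le> wdeg (lw g v) V T" by (intro wdeg_nonneg lw_nonneg)
  ultimately show "T \<in> sat (add_link g v)" by (simp add: saturated_def wdeg_add)
qed

text \<open>A larger \<open>g\<close> saturates more sets, so later links can only lose
  edges.\<close>

private lemma heavy_antimono:
  assumes "heavy (add_link g v) u"
  shows "heavy g u"
proof -
  have "lw (add_link g v) u A \<le> lw g u A" for A
    using saturated_add[of g v] w_nonneg \<tau> by (auto simp: link_weight_def)
  then have "wtot (lw (add_link g v) u) V \<le> wtot (lw g u) V"
    unfolding wtot_def by (intro sum_mono)
  with assms show ?thesis by linarith
qed

text \<open>\<open>S\<close> is independent, so an edge of positive weight in the container uses a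
  vertex whose remaining link is light. If the edge avoids all saturated sets, it is counted in that
  link, which contributes at most \<open>\<theta>\<close> per vertex. Otherwise it contains a
  saturated \<open>T\<close>, whose degree in \<open>w\<close> is at most the threshold already
  reached by its degree in \<open>g\<close>; summing the latter over all \<open>T\<close> gives
  \<open>2 ^ k * wtot g V\<close>.\<close>

private lemma container_weight:
  assumes inv: "link_inv I g" and S: "independent_set w S" "S \<subseteq> V"
  shows "wtot w (S \<union> {v\<in>V. \<not> heavy g v}) \<le> \<theta> * real (card V) + 2 ^ k * wtot g V"
proof -
  let ?C = "S \<union> {v\<in>V. \<not> heavy g v}"
  let ?R = "{v\<in>V. \<not> heavy g v}"
  let ?U = "\<lambda>T. {A\<in>Pow V. T \<subseteq> A}"
  let ?W = "\<lambda>v. {A\<in>Pow V. v \<in> A \<and> \<not> (\<exists>T\<in>sat g. T \<subseteq> A)}"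
  have gnn: "\<And>A. 0 \<le> g A" and gs: "\<And>A. g A \<noteq> 0 \<Longrightarrow> card A = k"
    using inv by (auto simp: link_inv_def spread_weight_def)
  have fsat: "finite (sat g)" using fin by (auto simp: saturated_def intro: finite_subset[of _ "Pow V"])
  have "wtot w ?C \<le> (\<Sum>A\<in>(\<Union>T\<in>sat g. ?U T) \<union> (\<Union>v\<in>?R. ?W v). w A)"
  proof -
    have "wtot w ?C = (\<Sum>A\<in>Pow ?C - Pow S. w A)"
      unfolding wtot_def using fin S finite_subset[OF S(2) fin]
      by (intro sum.mono_neutral_right) (auto simp: independent_set_def)
    also have "\<dots> \<le> (\<Sum>A\<in>(\<Union>T\<in>sat g. ?U T) \<union> (\<Union>v\<in>?R. ?W v). w A)"
    proof (rule sum_mono2)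
      show "finite ((\<Union>T\<in>sat g. ?U T) \<union> (\<Union>v\<in>?R. ?W v))" using fin fsat by auto
      show "Pow ?C - Pow S \<subseteq> (\<Union>T\<in>sat g. ?U T) \<union> (\<Union>v\<in>?R. ?W v)"
      proof
        fix A assume A: "A \<in> Pow ?C - Pow S"
        then obtain v where "v \<in> A" "v \<in> ?R" by blast
        moreover have "A \<subseteq> V" using A S(2) by blast
        ultimately show "A \<in> (\<Union>T\<in>sat g. ?U T) \<union> (\<Union>v\<in>?R. ?W v)"
          by blast
      qed
    qed (rule w_nonneg)
    finally show ?thesis .
  qed
  also have "\<dots> \<le> (\<Sum>A\<in>(\<Union>T\<in>sat g. ?U T). w A) + (\<Sum>A\<in>(\<Union>v\<in>?R. ?W v). w A)"
    using fin fsat w_nonneg by (subst sum_Un) (auto intro!: sum_nonneg)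
  finally have split: "wtot w ?C \<le> (\<Sum>A\<in>(\<Union>T\<in>sat g. ?U T). w A) + (\<Sum>A\<in>(\<Union>v\<in>?R. ?W v). w A)" .
  have "(\<Sum>A\<in>(\<Union>T\<in>sat g. ?U T). w A) \<le> (\<Sum>T\<in>sat g. wdeg w V T)"
    unfolding wdeg_def using fin fsat w_nonneg by (intro sum_UNION_le) auto
  also have "\<dots> \<le> (\<Sum>T\<in>sat g. wdeg g V T)"
  proof (rule sum_mono)
    fix T assume T: "T \<in> sat g"
    then show "wdeg w V T \<le> wdeg g V T" using w_deg[of T] by (simp add: saturated_def)
  qed
  also have "\<dots> \<le> (\<Sum>T\<in>Pow V. wdeg g V T)"
  proof (rule sum_mono2)
    show "sat g \<subseteq> Pow V" by (auto simp: saturated_def)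
  qed (use fin wdeg_nonneg[of g V] gnn in auto)
  also have "\<dots> = 2 ^ k * wtot g V" by (rule sum_wdeg_all[OF fin gs])
  finally have U: "(\<Sum>A\<in>(\<Union>T\<in>sat g. ?U T). w A) \<le> 2 ^ k * wtot g V" .
  have "(\<Sum>A\<in>(\<Union>v\<in>?R. ?W v). w A) \<le> (\<Sum>v\<in>?R. \<Sum>A\<in>?W v. w A)"
    using fin w_nonneg by (intro sum_UNION_le) auto
  also have "\<dots> \<le> (\<Sum>v\<in>?R. \<theta>)"
  proof (rule sum_mono)
    fix v assume v: "v \<in> ?R"
    \<comment> \<open>Deleting \<open>v\<close> is injective on the edges through \<open>v\<close>,
      and an edge without saturated subsets keeps this property after the deletion.\<close>
    have "(\<Sum>A\<in>?W v. w A) / \<tau> = (\<Sum>A\<in>?W v. lw g v (A - {v}))"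
      unfolding sum_divide_distrib
    proof (rule sum.cong[OF refl])
      fix A assume A: "A \<in> ?W v"
      then have "\<not> (\<exists>T\<in>sat g. T \<subseteq> A - {v})" "A - {v} \<subseteq> V" "insert v (A - {v}) = A" by blast+
      then show "w A / \<tau> = lw g v (A - {v})" by (simp add: link_weight_def)
    qed
    also have "\<dots> = (\<Sum>B\<in>(\<lambda>A. A - {v}) ` ?W v. lw g v B)"
      by (rule sum.reindex_cong[symmetric]) (auto simp: inj_on_def)
    also have "\<dots> \<le> wtot (lw g v) V"
      unfolding wtot_def using fin lw_nonneg by (intro sum_mono2) auto
    also have "\<dots> < \<theta> / \<tau>" using v by auto
    finally show "(\<Sum>A\<in>?W v. w A) \<le> \<theta>" using \<tau> by (simp add: divide_less_cancel)
  qed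
  also have "\<dots> \<le> \<theta> * real (card V)"
    using \<theta> fin card_mono[of V ?R] by simp
  finally show ?thesis using split U by linarith
qed

text \<open>The potential for the fingerprint size is the total weight of the accumulated links: a
  kept vertex adds at least \<open>\<theta> / \<tau>\<close>, while the degree bound
  \<open>2 * K\<close> caps the total by \<open>2 * K * card V\<close>. This cap needs links of
  positive uniformity.\<close>

lemma container_scan:
  assumes "k > 0"
  obtains S g where
    "\<And>I. I \<subseteq> V \<Longrightarrow> independent_set w I \<Longrightarrow> S I \<subseteq> I"
    "\<And>I. I \<subseteq> V \<Longrightarrow> independent_set w I \<Longrightarrow> real (card (S I)) \<le> 2 * K / \<theta> * \<tau> * real (card V)"
    "\<And>I J. S I \<subseteq> J \<Longrightarrow> J \<subseteq> I \<Longrightarrow> S J = S I \<and> g J = g I"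
    "\<And>I. I \<subseteq> V \<Longrightarrow> independent_set w I \<Longrightarrow> spread_weight k (2 * K) \<tau> V (g I)"
    "\<And>I. I \<subseteq> V \<Longrightarrow> independent_set w I \<Longrightarrow> independent_set (g I) I"
    "\<And>I. I \<subseteq> V \<Longrightarrow> independent_set w I \<Longrightarrow> I \<subseteq> S I \<union> {v\<in>V. \<not> heavy (g I) v}"
    "\<And>I. I \<subseteq> V \<Longrightarrow> independent_set w I \<Longrightarrow>
       wtot w (S I \<union> {v\<in>V. \<not> heavy (g I) v}) \<le> \<theta> * real (card V) + 2 ^ k * wtot (g I) V"
proof -
  obtain vs where vs: "set vs = V" using fin finite_list by auto
  define S where "S I = picks heavy add_link I vs (\<lambda>_. 0)" for I
  define g where "g I = scan heavy add_link I vs (\<lambda>_. 0)" for I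
  have sub: "S I \<subseteq> I" for I using picks_subset[of heavy add_link I vs] by (simp add: S_def)
  have inv: "link_inv I (g I)" if "I \<subseteq> V" "independent_set w I" for I
    unfolding g_def
  proof (rule scan_invariant[where P = "link_inv I"])
    show "link_inv I (\<lambda>_. 0)" by (rule link_inv_zero)
  qed (rule link_inv_add[OF _ _ that])
  show thesis
  proof (rule that[of S g])
    show "S I \<subseteq> I" for I by (rule sub)
    show "S J = S I \<and> g J = g I" if "S I \<subseteq> J" "J \<subseteq> I" for I J
      using scan_picks_cong[of heavy add_link I vs "\<lambda>_. 0" J] that by (simp add: S_def g_def)
    fix I assume I: "I \<subseteq> V" "independent_set w I"
    note inv = inv[OF I]
    show sg: "spread_weight k (2 * K) \<tau> V (g I)" and "independent_set (g I) I"
      using inv by (auto simp: link_inv_def)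
    have "wtot (\<lambda>_. 0) V + \<theta> / \<tau> * real (card (S I)) \<le> wtot (g I) V"
      unfolding S_def g_def
    proof (rule card_picks_le[where P = "link_inv I"])
      show "link_inv I (\<lambda>_. 0)" by (rule link_inv_zero)
      show "link_inv I (add_link h v)" if "link_inv I h" "v \<in> I" for h v
        by (rule link_inv_add[OF that I])
      show "wtot h V + \<theta> / \<tau> \<le> wtot (add_link h v) V" if "heavy h v" for h v
        using that by (simp add: wtot_add)
      show "0 \<le> \<theta> / \<tau>" using \<theta> \<tau> by simp
    qed
    also have "\<dots> \<le> 2 * K * real (card V)" by (rule wtot_le[OF sg assms])
    finally show "real (card (S I)) \<le> 2 * K / \<theta> * \<tau> * real (card V)"
      using \<theta> \<tau> by (simp add: wtot_def field_simps)
    show "I \<subseteq> S I \<union> {v\<in>V. \<not> heavy (g I) v}"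
    proof
      fix u assume u: "u \<in> I"
      show "u \<in> S I \<union> {v\<in>V. \<not> heavy (g I) v}"
      proof (cases "u \<in> S I")
        case False
        have "\<not> heavy (g I) u"
          unfolding g_def
        proof (rule scan_not_picked[where P = "link_inv I" and ok = heavy and upd = add_link
              and vs = vs and I = I and s = "\<lambda>_. 0"])
          show "link_inv I (\<lambda>_. 0)" by (rule link_inv_zero)
          show "heavy h x" if "link_inv I h" "heavy (add_link h v) x" for h v x
            using that(2) by (rule heavy_antimono)
          show "link_inv I (add_link h v)" if "link_inv I h" "v \<in> I" "v \<in> set vs" "heavy h v" for h v
            using that(1,2) I by (rule link_inv_add)
          show "u \<in> I" "u \<in> set vs" using u I vs by auto
          show "u \<notin> picks heavy add_link I vs (\<lambda>_. 0)" using False by (simp add: S_def)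
        qed
        then show ?thesis using u I by auto
      qed auto
    qed
    show "wtot w (S I \<union> {v\<in>V. \<not> heavy (g I) v}) \<le> \<theta> * real (card V) + 2 ^ k * wtot (g I) V"
    proof (rule container_weight[OF inv])
      show "independent_set w (S I)" by (rule independent_set_mono[OF I(2) sub])
      show "S I \<subseteq> V" using sub I by blast
    qed
  qed
qed

end

section \<open>Fingerprints, containers and their iteration\<close>

definition container_map ::
    "('v set \<Rightarrow> real) \<Rightarrow> 'v set \<Rightarrow> real \<Rightarrow> ('v set \<Rightarrow> bool) \<Rightarrow> ('v set \<Rightarrow> 'v set) \<Rightarrow> ('v set \<Rightarrow> 'v set) \<Rightarrow> bool"
  where "container_map w V b P f g \<longleftrightarrow>
     (\<forall>I. I \<subseteq> V \<longrightarrow> independent_set w I \<longrightarrow>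
        f I \<subseteq> I \<and> real (card (f I)) \<le> b \<and> I \<subseteq> g I \<and> g I \<subseteq> V \<and> P (g I) \<and>
        (\<forall>J. f I \<subseteq> J \<longrightarrow> J \<subseteq> I \<longrightarrow> g J = g I))"

text \<open>The case \<open>J = f I\<close> of the last clause says that the container can be
  computed from the fingerprint alone, so there are at most as many containers as fingerprints. The
  intermediate sets \<open>J\<close> are what composition of two container maps requires.\<close>

lemma container_mapI:
  assumes "\<And>I. I \<subseteq> V \<Longrightarrow> independent_set w I \<Longrightarrow>
        f I \<subseteq> I \<and> real (card (f I)) \<le> b \<and> I \<subseteq> g I \<and> g I \<subseteq> V \<and> P (g I) \<and>
        (\<forall>J. f I \<subseteq> J \<longrightarrow> J \<subseteq> I \<longrightarrow> g J = g I)"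
  shows "container_map w V b P f g"
  using assms unfolding container_map_def by blast

lemma container_mapD:
  assumes "container_map w V b P f g" "I \<subseteq> V" "independent_set w I"
  shows "f I \<subseteq> I" "real (card (f I)) \<le> b" "I \<subseteq> g I" "g I \<subseteq> V" "P (g I)"
    "f I \<subseteq> J \<Longrightarrow> J \<subseteq> I \<Longrightarrow> g J = g I"
  using assms unfolding container_map_def by blast+

lemma container_map_const:
  assumes "0 \<le> b" "C \<subseteq> V" "P C" "\<And>I. I \<subseteq> V \<Longrightarrow> independent_set w I \<Longrightarrow> I \<subseteq> C"
  shows "container_map w V b P (\<lambda>_. {}) (\<lambda>_. C)"
  using assms by (simp add: container_map_def)

text \<open>Induction on the uniformity. For singleton edges the container consists of the vertices
  of weight 0. In higher uniformity one scan either yields a container of at most half the minimal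
  total weight, which must therefore omit many vertices, or link weights dense enough for the
  induction hypothesis, whose container also contains \<open>I\<close>. The constants depend only on
  \<open>k\<close>, \<open>K\<close> and \<open>\<alpha>\<close>.\<close>

lemma container_step:
  fixes K \<alpha> :: real
  assumes "K > 0" "\<alpha> > 0"
  shows "\<exists>\<delta>>0. \<exists>M\<ge>0. \<delta> \<le> 1 \<and> (\<forall>\<tau>>0. \<forall>V (w :: 'v set \<Rightarrow> real).
     spread_weight (Suc k) K \<tau> V w \<longrightarrow> \<alpha> * real (card V) \<le> wtot w V \<longrightarrow>
     (\<exists>f g. container_map w V (M * \<tau> * real (card V)) (\<lambda>C. real (card C) \<le> (1 - \<delta>) * real (card V)) f g))"
  using assms
proof (induction k arbitrary: K \<alpha>)
  case 0
  define \<delta> where "\<delta> = min 1 (\<alpha> / K)"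
  show ?case
  proof (intro exI conjI allI impI)
    show "\<delta> > 0" "\<delta> \<le> 1" using 0 by (auto simp: \<delta>_def)
    show "(0::real) \<le> 0" by simp
    fix \<tau> :: real and V :: "'v set" and w :: "'v set \<Rightarrow> real"
    assume sp: "spread_weight (Suc 0) K \<tau> V w" and tot: "\<alpha> * real (card V) \<le> wtot w V"
    let ?C = "{v\<in>V. w {v} = 0}"
    have fin: "finite V" using sp by (simp add: spread_weight_def)
    have "wtot w ?C = 0"
      unfolding wtot_def
    proof (rule sum.neutral, rule ballI)
      fix A assume A: "A \<in> Pow ?C"
      show "w A = 0"
      proof (rule ccontr)
        assume nz: "w A \<noteq> 0"
        then have "card A = 1" using sp by (auto simp: spread_weight_def)
        then obtain v where "A = {v}" by (auto simp: card_1_singleton_iff)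
        with A nz show False by auto
      qed
    qed
    then have "\<alpha> * real (card V) \<le> K * real (card (V - ?C))"
      using wtot_diff_le[OF sp, of ?C] tot by simp
    also have "real (card (V - ?C)) = real (card V) - real (card ?C)"
      using fin card_mono[of V ?C] by (simp add: card_Diff_subset of_nat_diff)
    finally have "\<alpha> / K * real (card V) \<le> real (card V) - real (card ?C)"
      using 0 by (simp add: divide_le_eq mult.commute)
    moreover have "\<delta> * real (card V) \<le> \<alpha> / K * real (card V)"
      by (intro mult_right_mono) (auto simp: \<delta>_def)
    ultimately have card_C: "real (card ?C) \<le> (1 - \<delta>) * real (card V)" by (simp add: algebra_simps)
    show "container_map w V (0 * \<tau> * real (card V)) (\<lambda>C. real (card C) \<le> (1 - \<delta>) * real (card V))
            (\<lambda>_. {}) (\<lambda>_. ?C)"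
    proof (rule container_map_const)
      show "real (card ?C) \<le> (1 - \<delta>) * real (card V)" by (rule card_C)
      fix I assume "I \<subseteq> V" "independent_set w I"
      then show "I \<subseteq> ?C" by (auto simp: independent_set_def)
    qed auto
  qed
next
  case (Suc k)
  \<comment> \<open>Both terms of the container weight then amount to at most a quarter of
    \<open>\<alpha> * card V\<close>, so a sparse link hypergraph forces a loss of weight
    \<open>\<alpha> / 2 * card V\<close>, that is, of at least
    \<open>\<alpha> / (2 * K) * card V\<close> vertices.\<close>
  define \<theta> where "\<theta> = \<alpha> / 4"
  define \<alpha>' where "\<alpha>' = \<alpha> / (4 * 2 ^ Suc k)"
  have pos: "\<theta> > 0" "\<alpha>' > 0" "2 * K > 0" using Suc.prems by (auto simp: \<theta>_def \<alpha>'_def)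
  obtain \<delta>' M' where \<delta>': "\<delta>' > 0" "\<delta>' \<le> 1" and M': "M' \<ge> 0" and
    IH: "\<And>\<tau> V (w :: 'v set \<Rightarrow> real). \<tau> > 0 \<Longrightarrow> spread_weight (Suc k) (2 * K) \<tau> V w \<Longrightarrow>
      \<alpha>' * real (card V) \<le> wtot w V \<Longrightarrow>
     \<exists>f g. container_map w V (M' * \<tau> * real (card V)) (\<lambda>C. real (card C) \<le> (1 - \<delta>') * real (card V)) f g"
    using Suc.IH[OF pos(3,2)] by blast
  define \<delta> where "\<delta> = min \<delta>' (\<alpha> / (2 * K))"
  define M where "M = 2 * K / \<theta> + M'"
  have "\<exists>f g. container_map w V (M * \<tau> * real (card V)) (\<lambda>C. real (card C) \<le> (1 - \<delta>) * real (card V)) f g"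
    if \<tau>: "\<tau> > 0" and sp: "spread_weight (Suc (Suc k)) K \<tau> V w"
      and tot: "\<alpha> * real (card V) \<le> wtot w V"
    for \<tau> :: real and V :: "'v set" and w :: "'v set \<Rightarrow> real"
  proof -
    have fin: "finite V" using sp by (simp add: spread_weight_def)
    obtain S g where
      S_sub: "\<And>I. I \<subseteq> V \<Longrightarrow> independent_set w I \<Longrightarrow> S I \<subseteq> I"
      and S_card: "\<And>I. I \<subseteq> V \<Longrightarrow> independent_set w I \<Longrightarrow>
             real (card (S I)) \<le> 2 * K / \<theta> * \<tau> * real (card V)"
      and S_cong: "\<And>I J. S I \<subseteq> J \<Longrightarrow> J \<subseteq> I \<Longrightarrow> S J = S I \<and> g J = g I"
      and g_sp: "\<And>I. I \<subseteq> V \<Longrightarrow> independent_set w I \<Longrightarrow> spread_weight (Suc k) (2 * K) \<tau> V (g I)"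
      and g_ind: "\<And>I. I \<subseteq> V \<Longrightarrow> independent_set w I \<Longrightarrow> independent_set (g I) I"
      and cover: "\<And>I. I \<subseteq> V \<Longrightarrow> independent_set w I \<Longrightarrow>
             I \<subseteq> S I \<union> {v\<in>V. \<not> \<theta> / \<tau> \<le> wtot (link_weight K \<tau> V w (g I) v) V}"
      and weight: "\<And>I. I \<subseteq> V \<Longrightarrow> independent_set w I \<Longrightarrow>
             wtot w (S I \<union> {v\<in>V. \<not> \<theta> / \<tau> \<le> wtot (link_weight K \<tau> V w (g I) v) V})
               \<le> \<theta> * real (card V) + 2 ^ Suc k * wtot (g I) V"
      by (rule container_scan[OF sp \<tau> \<open>K > 0\<close> pos(1) zero_less_Suc]) (rule that; assumption)
    define dense where "dense h \<longleftrightarrow> \<alpha>' * real (card V) \<le> wtot h V" for h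
    define Q where "Q h p \<longleftrightarrow> container_map h V (M' * \<tau> * real (card V))
          (\<lambda>C. real (card C) \<le> (1 - \<delta>') * real (card V)) (fst p) (snd p)" for h p
    \<comment> \<open>The choice is made per link weight \<open>h\<close> and not per
      \<open>I\<close>: two sets with the same scan outcome must be handed the same container map,
      or the container would no longer be determined by the fingerprint.\<close>
    define fc where "fc h = (SOME p. Q h p)" for h
    have fc: "Q h (fc h)" if "spread_weight (Suc k) (2 * K) \<tau> V h" "dense h" for h
    proof -
      from IH[OF \<tau> that(1)] that(2) obtain f c where "Q h (f, c)" by (auto simp: Q_def dense_def)
      then show ?thesis unfolding fc_def by (rule someI)
    qed
    define F where "F I = S I \<union> (if dense (g I) then fst (fc (g I)) I else {})" for I
    define G where "G I = (if dense (g I) then snd (fc (g I)) I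
        else S I \<union> {v\<in>V. \<not> \<theta> / \<tau> \<le> wtot (link_weight K \<tau> V w (g I) v) V})" for I
    have "container_map w V (M * \<tau> * real (card V)) (\<lambda>C. real (card C) \<le> (1 - \<delta>) * real (card V)) F G"
    proof (rule container_mapI)
      fix I assume I: "I \<subseteq> V" "independent_set w I"
      show "F I \<subseteq> I \<and> real (card (F I)) \<le> M * \<tau> * real (card V) \<and> I \<subseteq> G I \<and> G I \<subseteq> V \<and>
        real (card (G I)) \<le> (1 - \<delta>) * real (card V) \<and> (\<forall>J. F I \<subseteq> J \<longrightarrow> J \<subseteq> I \<longrightarrow> G J = G I)"
      proof (cases "dense (g I)")
        case True
        let ?f = "fst (fc (g I)) I" and ?c = "snd (fc (g I))"
        note D = container_mapD[OF fc[OF g_sp[OF I] True, unfolded Q_def] I(1) g_ind[OF I]]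
        have FG: "F I = S I \<union> ?f" "G I = ?c I" using True by (simp_all add: F_def G_def)
        have "real (card (F I)) \<le> real (card (S I)) + real (card ?f)"
          using card_Un_le[of "S I" ?f] unfolding FG by linarith
        also have "\<dots> \<le> M * \<tau> * real (card V)"
          using S_card[OF I] D(2) by (simp add: M_def algebra_simps)
        finally have 1: "real (card (F I)) \<le> M * \<tau> * real (card V)" .
        have "(1 - \<delta>') * real (card V) \<le> (1 - \<delta>) * real (card V)"
          by (intro mult_right_mono) (auto simp: \<delta>_def)
        then have 2: "real (card (G I)) \<le> (1 - \<delta>) * real (card V)"
          using D(5) unfolding FG by linarith
        have "G J = G I" if "F I \<subseteq> J" "J \<subseteq> I" for J
        proof -
          have sub: "S I \<subseteq> J" "?f \<subseteq> J" using that by (auto simp: FG)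
          have "g J = g I" using S_cong[OF sub(1) that(2)] by simp
          then have "G J = ?c J" using True by (simp add: G_def)
          with D(6)[OF sub(2) that(2)] show ?thesis by (simp add: FG)
        qed
        moreover have "F I \<subseteq> I" "I \<subseteq> G I" "G I \<subseteq> V" using D(1,3,4) S_sub[OF I] by (auto simp: FG)
        ultimately show ?thesis using 1 2 by blast
      next
        case False
        have FG: "F I = S I"
          "G I = S I \<union> {v\<in>V. \<not> \<theta> / \<tau> \<le> wtot (link_weight K \<tau> V w (g I) v) V}"
          using False by (simp_all add: F_def G_def)
        have GV: "G I \<subseteq> V" using S_sub[OF I] I by (auto simp: FG)
        have "2 ^ Suc k * wtot (g I) V \<le> 2 ^ Suc k * (\<alpha>' * real (card V))"
          using False by (intro mult_left_mono) (auto simp: dense_def)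
        also have "\<dots> = \<alpha> / 4 * real (card V)" by (simp add: \<alpha>'_def)
        finally have "wtot w (G I) \<le> \<alpha> / 2 * real (card V)"
          using weight[OF I] unfolding FG \<theta>_def by linarith
        then have "\<alpha> * real (card V) \<le> \<alpha> / 2 * real (card V) + K * real (card (V - G I))"
          using wtot_diff_le[OF sp GV] tot by linarith
        also have "real (card (V - G I)) = real (card V) - real (card (G I))"
          using fin GV card_mono[OF fin GV] finite_subset[OF GV fin]
          by (simp add: card_Diff_subset of_nat_diff)
        finally have "\<alpha> / 2 * real (card V) \<le> K * (real (card V) - real (card (G I)))"
          by linarith
        then have "\<alpha> / (2 * K) * real (card V) \<le> real (card V) - real (card (G I))"
          using Suc.prems(1) by (simp add: divide_le_eq mult.commute)
        moreover have "\<delta> * real (card V) \<le> \<alpha> / (2 * K) * real (card V)"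
          by (intro mult_right_mono) (auto simp: \<delta>_def)
        ultimately have 2: "real (card (G I)) \<le> (1 - \<delta>) * real (card V)" by (simp add: algebra_simps)
        have "2 * K / \<theta> * \<tau> * real (card V) \<le> M * \<tau> * real (card V)"
          using M' \<tau> by (intro mult_right_mono) (auto simp: M_def)
        then have 1: "real (card (F I)) \<le> M * \<tau> * real (card V)"
          using S_card[OF I] unfolding FG by linarith
        have "G J = G I" if "F I \<subseteq> J" "J \<subseteq> I" for J
        proof -
          have "S J = S I" "g J = g I" using S_cong[of I J] that by (auto simp: FG)
          then show ?thesis by (simp add: G_def False)
        qed
        moreover have "I \<subseteq> G I" using cover[OF I] unfolding FG .
        ultimately show ?thesis using 1 2 GV S_sub[OF I] unfolding FG(1) by blast
      qed
    qed
    then show ?thesis by (intro exI)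
  qed
  moreover have "\<delta> > 0" "\<delta> \<le> 1" "M \<ge> 0"
    using \<delta>' M' Suc.prems pos by (auto simp: \<delta>_def M_def)
  ultimately show ?case by (intro exI[of _ \<delta>] exI[of _ M] conjI allI impI)
qed

text \<open>The inequality on \<open>C\<close> says that \<open>t\<close> further shrinkings by the
  factor \<open>1 - \<delta>\<close> leave so few vertices that the trivial weight bound already
  suffices. A round is needed only while the weight exceeds \<open>\<alpha> * card V\<close>, and
  this is at least the density that \<open>step\<close> asks for inside \<open>C\<close>.\<close>

lemma container_iterate:
  fixes w :: "'v set \<Rightarrow> real"
  assumes sp: "spread_weight k K \<tau> V w" and "k > 0" and \<tau>: "\<tau> > 0"
    and K: "K > 0" and \<alpha>: "\<alpha> > 0" and M: "M \<ge> 0" and \<delta>: "\<delta> > 0" "\<delta> \<le> 1"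
    and step: "\<And>C. C \<subseteq> V \<Longrightarrow> \<alpha> * real (card C) \<le> wtot w C \<Longrightarrow>
      \<exists>f g. container_map w C (M * \<tau> * real (card C)) (\<lambda>D. real (card D) \<le> (1 - \<delta>) * real (card C)) f g"
    and "C \<subseteq> V" "K * real (card C) * (1 - \<delta>) ^ t \<le> \<alpha> * real (card V)"
  shows "\<exists>f g. container_map w C (real t * M * \<tau> * real (card V))
           (\<lambda>D. wtot w D \<le> \<alpha> * real (card V)) f g"
  using assms(10,11)
proof (induction t arbitrary: C)
  case 0
  then have "wtot w C \<le> \<alpha> * real (card V)"
    using wtot_le[OF spread_weight_subset[OF sp] \<open>k > 0\<close>, of C] by simp
  then have "container_map w C (real 0 * M * \<tau> * real (card V))
      (\<lambda>D. wtot w D \<le> \<alpha> * real (card V)) (\<lambda>_. {}) (\<lambda>_. C)"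
    by (intro container_map_const) auto
  then show ?case by blast
next
  case (Suc t)
  have fin: "finite V" using sp by (simp add: spread_weight_def)
  show ?case
  proof (cases "wtot w C \<le> \<alpha> * real (card V)")
    case True
    then have "container_map w C (real (Suc t) * M * \<tau> * real (card V))
        (\<lambda>D. wtot w D \<le> \<alpha> * real (card V)) (\<lambda>_. {}) (\<lambda>_. C)"
      using M \<tau> by (intro container_map_const) auto
    then show ?thesis by blast
  next
    case False
    have CV: "card C \<le> card V" using card_mono[OF fin Suc.prems(1)] .
    then have "\<alpha> * real (card C) \<le> \<alpha> * real (card V)" using \<alpha> by (intro mult_left_mono) auto
    then have "\<alpha> * real (card C) \<le> wtot w C" using False by linarith
    from step[OF Suc.prems(1) this] obtain f1 g1 where fg1:
      "container_map w C (M * \<tau> * real (card C)) (\<lambda>D. real (card D) \<le> (1 - \<delta>) * real (card C)) f1 g1"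
      by blast
    define Q where "Q D p \<longleftrightarrow> container_map w D (real t * M * \<tau> * real (card V))
        (\<lambda>D. wtot w D \<le> \<alpha> * real (card V)) (fst p) (snd p)" for D p
    define fc where "fc D = (SOME p. Q D p)" for D
    have fc: "Q D (fc D)" if "D \<subseteq> V" "K * real (card D) * (1 - \<delta>) ^ t \<le> \<alpha> * real (card V)" for D
    proof -
      from Suc.IH[OF that] obtain f c where "Q D (f, c)" by (auto simp: Q_def)
      then show ?thesis unfolding fc_def by (rule someI)
    qed
    define F where "F I = f1 I \<union> fst (fc (g1 I)) I" for I
    define G where "G I = snd (fc (g1 I)) I" for I
    have "container_map w C (real (Suc t) * M * \<tau> * real (card V))
           (\<lambda>D. wtot w D \<le> \<alpha> * real (card V)) F G"
    proof (rule container_mapI)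
      fix I assume I: "I \<subseteq> C" "independent_set w I"
      note D1 = container_mapD[OF fg1 I]
      have "K * real (card (g1 I)) * (1 - \<delta>) ^ t \<le> K * ((1 - \<delta>) * real (card C)) * (1 - \<delta>) ^ t"
        using D1(5) K \<delta> by (intro mult_right_mono mult_left_mono) auto
      also have "\<dots> = K * real (card C) * (1 - \<delta>) ^ Suc t" by simp
      also have "\<dots> \<le> \<alpha> * real (card V)" by (rule Suc.prems(2))
      finally have small: "K * real (card (g1 I)) * (1 - \<delta>) ^ t \<le> \<alpha> * real (card V)" .
      have g1V: "g1 I \<subseteq> V" using D1(4) Suc.prems(1) by auto
      note D2 = container_mapD[OF fc[OF g1V small, unfolded Q_def] D1(3) I(2)]
      have "real (card (F I)) \<le> real (card (f1 I)) + real (card (fst (fc (g1 I)) I))"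
        using card_Un_le[of "f1 I" "fst (fc (g1 I)) I"] unfolding F_def by linarith
      also have "\<dots> \<le> M * \<tau> * real (card V) + real t * M * \<tau> * real (card V)"
      proof (rule add_mono)
        have "M * \<tau> * real (card C) \<le> M * \<tau> * real (card V)"
          using M \<tau> CV by (intro mult_left_mono) auto
        then show "real (card (f1 I)) \<le> M * \<tau> * real (card V)" using D1(2) by linarith
      qed (rule D2(2))
      finally have "real (card (F I)) \<le> real (Suc t) * M * \<tau> * real (card V)"
        by (simp add: algebra_simps)
      moreover have "G J = G I" if J: "F I \<subseteq> J" "J \<subseteq> I" for J
      proof -
        have "g1 J = g1 I" using J by (intro D1(6)) (auto simp: F_def)
        moreover have "snd (fc (g1 I)) J = snd (fc (g1 I)) I"
          using J by (intro D2(6)) (auto simp: F_def)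
        ultimately show ?thesis by (simp add: G_def)
      qed
      moreover have "F I \<subseteq> I" "I \<subseteq> G I" "G I \<subseteq> C" "wtot w (G I) \<le> \<alpha> * real (card V)"
        using D1(1,4) D2(1,3,4,5) by (auto simp: F_def G_def)
      ultimately show "F I \<subseteq> I \<and> real (card (F I)) \<le> real (Suc t) * M * \<tau> * real (card V) \<and>
          I \<subseteq> G I \<and> G I \<subseteq> C \<and> wtot w (G I) \<le> \<alpha> * real (card V) \<and>
          (\<forall>J. F I \<subseteq> J \<longrightarrow> J \<subseteq> I \<longrightarrow> G J = G I)"
        by blast
    qed
    then show ?thesis by blast
  qed
qed

text \<open>The number of rounds, hence \<open>M\<close>, is fixed by \<open>k\<close>,
  \<open>K\<close> and \<open>\<alpha>\<close> alone. Its independence of \<open>\<tau>\<close> and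
  \<open>V\<close> later makes the density constant \<open>A\<close> independent of n.\<close>

theorem hypergraph_containers:
  fixes K \<alpha> :: real
  assumes K: "K > 0" and \<alpha>: "\<alpha> > 0" and "k > 0"
  shows "\<exists>M\<ge>0. \<forall>\<tau>>0. \<forall>V (w :: 'v set \<Rightarrow> real). spread_weight k K \<tau> V w \<longrightarrow>
     (\<exists>f g. container_map w V (M * \<tau> * real (card V)) (\<lambda>C. wtot w C \<le> \<alpha> * real (card V)) f g)"
proof -
  obtain k' where k': "k = Suc k'" using \<open>k > 0\<close> by (cases k) auto
  obtain \<delta> M where \<delta>: "\<delta> > 0" "\<delta> \<le> 1" and M: "M \<ge> 0" and
    step: "\<And>\<tau> V (w :: 'v set \<Rightarrow> real). \<tau> > 0 \<Longrightarrow> spread_weight k K \<tau> V w \<Longrightarrow>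
      \<alpha> * real (card V) \<le> wtot w V \<Longrightarrow>
      \<exists>f g. container_map w V (M * \<tau> * real (card V)) (\<lambda>C. real (card C) \<le> (1 - \<delta>) * real (card V)) f g"
    using container_step[OF K \<alpha>, of k'] unfolding k' by blast
  have "(\<lambda>t. K * (1 - \<delta>) ^ t) \<longlonglongrightarrow> K * 0"
    using \<delta> by (intro tendsto_intros LIMSEQ_power_zero) auto
  then have "\<forall>\<^sub>F t in sequentially. K * (1 - \<delta>) ^ t < \<alpha>"
    using \<alpha> by (intro order_tendstoD) auto
  then obtain t where t: "K * (1 - \<delta>) ^ t \<le> \<alpha>"
    by (meson eventually_sequentially less_imp_le order_refl)
  show ?thesis
  proof (intro exI[of _ "real t * M"] conjI allI impI)
    show "0 \<le> real t * M" using M by simp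
    fix \<tau> :: real and V and w :: "'v set \<Rightarrow> real"
    assume \<tau>: "0 < \<tau>" and sp: "spread_weight k K \<tau> V w"
    have "K * real (card V) * (1 - \<delta>) ^ t \<le> \<alpha> * real (card V)"
      using mult_right_mono[OF t, of "real (card V)"] by (simp add: mult.commute mult.left_commute)
    then show "\<exists>f g. container_map w V (real t * M * \<tau> * real (card V)) (\<lambda>C. wtot w C \<le> \<alpha> * real (card V)) f g"
    proof (rule container_iterate[OF sp \<open>k > 0\<close> \<tau> K \<alpha> M \<delta> _ order_refl, rotated])
      fix C assume "C \<subseteq> V" "\<alpha> * real (card C) \<le> wtot w C"
      then show "\<exists>f g. container_map w C (M * \<tau> * real (card C)) (\<lambda>D. real (card D) \<le> (1 - \<delta>) * real (card C)) f g"
        by (intro step[OF \<tau> spread_weight_subset[OF sp]])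
    qed
  qed
qed

subsection \<open>Palettes without a transversal\<close>

text \<open>A system of distinct representatives. For the edges of a copy it is a rainbow choice of
  colours from their palettes.\<close>

definition transversal :: "('e \<Rightarrow> 'c set) \<Rightarrow> 'e set \<Rightarrow> ('e \<Rightarrow> 'c) \<Rightarrow> bool" where
  "transversal P E \<psi> \<longleftrightarrow> inj_on \<psi> E \<and> (\<forall>e\<in>E. \<psi> e \<in> P e)"

lemma transversal_insert:
  assumes "transversal P E \<psi>" "c \<in> P e" "c \<notin> \<psi> ` E" "e \<notin> E"
  shows "transversal P (insert e E) (\<psi>(e := c))"
  using assms by (auto simp: transversal_def inj_on_def)

text \<open>A weak form of Hall's theorem that bounds individual sizes instead of the union. Remove
  the edge with the largest palette: if the rest has a transversal, that palette is too small to
  extend it, and then so is every other one.\<close>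

lemma no_transversal_deficient:
  assumes "finite E" "\<And>e. e \<in> E \<Longrightarrow> finite (P e)" "\<nexists>\<psi>. transversal P E \<psi>"
  shows "\<exists>J\<subseteq>E. J \<noteq> {} \<and> (\<forall>e\<in>J. card (P e) < card J)"
  using assms
proof (induction "card E" arbitrary: E)
  case 0
  then have "transversal P E (\<lambda>_. undefined)" by (simp add: transversal_def)
  with 0 show ?case by blast
next
  case (Suc n)
  have ne: "E \<noteq> {}" using Suc.hyps(2) by auto
  obtain e where e: "e \<in> E" "\<And>f. f \<in> E \<Longrightarrow> card (P f) \<le> card (P e)"
    using Max_in[of "(\<lambda>e. card (P e)) ` E"] Max_ge[of "(\<lambda>e. card (P e)) ` E"] Suc.prems(1) ne
    by (smt (verit) finite_imageI imageE image_eqI image_is_empty)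
  have n: "n = card (E - {e})" using Suc.hyps(2) e(1) Suc.prems(1) by simp
  show ?case
  proof (cases "\<exists>\<psi>. transversal P (E - {e}) \<psi>")
    case True
    then obtain \<psi> where \<psi>: "transversal P (E - {e}) \<psi>" by blast
    have "card (P e) < card E"
    proof (rule ccontr)
      assume "\<not> card (P e) < card E"
      then have "card (\<psi> ` (E - {e})) < card (P e)"
        using card_image_le[of "E - {e}" \<psi>] Suc.prems(1) n Suc.hyps(2) by simp
      then have "\<not> P e \<subseteq> \<psi> ` (E - {e})"
        using card_mono[of "\<psi> ` (E - {e})" "P e"] Suc.prems(1) by auto
      then obtain c where "c \<in> P e" "c \<notin> \<psi> ` (E - {e})" by blast
      from transversal_insert[OF \<psi> this] have "transversal P E (\<psi>(e := c))"
        using e(1) by (simp add: insert_absorb)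
      with Suc.prems(3) show False by blast
    qed
    then have "\<forall>f\<in>E. card (P f) < card E" using e(2) by (meson le_less_trans)
    then show ?thesis using ne by blast
  next
    case False
    then have "\<exists>J\<subseteq>E - {e}. J \<noteq> {} \<and> (\<forall>f\<in>J. card (P f) < card J)"
      using Suc.prems by (intro Suc.hyps(1)[OF n]) auto
    then show ?thesis by blast
  qed
qed

text \<open>If c lies in \<open>P e\<close> but not in \<open>P f\<close>, give c to e and delete it
  from the other palettes. A deficient set J of the remaining edges cannot contain f, whose palette
  still has k - 1 colours; but without e and f it has at most k - 2 members, while every palette
  keeps at least k - 2 colours.\<close>

lemma no_transversal_uniform_eq:
  assumes fin: "finite E" "\<And>e. e \<in> E \<Longrightarrow> finite (P e)" and no: "\<nexists>\<psi>. transversal P E \<psi>"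
    and card: "\<And>e. e \<in> E \<Longrightarrow> card (P e) = card E - 1" and ef: "e \<in> E" "f \<in> E"
  shows "P e = P f"
proof (rule ccontr)
  assume neq: "P e \<noteq> P f"
  then have "\<not> P e \<subseteq> P f" using card[OF ef(1)] card[OF ef(2)] fin(2)[OF ef(2)]
    by (metis card_subset_eq)
  then obtain c where c: "c \<in> P e" "c \<notin> P f" by blast
  let ?E = "E - {e}" and ?P = "\<lambda>x. P x - {c}"
  have "\<nexists>\<psi>. transversal ?P ?E \<psi>"
  proof
    assume "\<exists>\<psi>. transversal ?P ?E \<psi>"
    then obtain \<psi> where \<psi>: "transversal ?P ?E \<psi>" by blast
    then have "transversal P ?E \<psi>" "c \<notin> \<psi> ` ?E" by (auto simp: transversal_def)
    from transversal_insert[OF this(1) c(1) this(2)] have "transversal P E (\<psi>(e := c))"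
      using ef by (simp add: insert_absorb)
    with no show False by blast
  qed
  then obtain J where J: "J \<subseteq> ?E" "J \<noteq> {}" "\<And>x. x \<in> J \<Longrightarrow> card (?P x) < card J"
    using no_transversal_deficient[of ?E ?P] fin by blast
  have "f \<noteq> e" using neq by auto
  have cJ: "card J \<le> card E - 1" using card_mono[of ?E J] J(1) fin(1) ef(1) by simp
  show False
  proof (cases "f \<in> J")
    case True
    then have "card (P f) < card J" using J(3)[of f] c(2) by simp
    then show False using cJ card[OF ef(2)] by simp
  next
    case False
    then have "J \<subseteq> E - {e, f}" using J(1) by auto
    then have "card J \<le> card E - 2"
      using card_mono[of "E - {e, f}" J] fin(1) ef \<open>f \<noteq> e\<close> by (simp add: card_Diff_subset)
    moreover obtain x where x: "x \<in> J" using J(2) by blast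
    moreover have "card (P x) \<le> Suc (card (?P x))"
      using fin(2)[of x] x J(1) by (auto simp: card_Diff_singleton_if)
    ultimately show False using J(3)[OF x] card[of x] J(1) by auto
  qed
qed

section \<open>Logarithmic scores of palettes\<close>

definition score :: "real \<Rightarrow> 'c set \<Rightarrow> real" where
  "score L Q = (if Q = {} then - L else ln (real (card Q)))"

lemma score_le:
  assumes "finite Q" "card Q \<le> m" "m > 0" "L \<ge> 0"
  shows "score L Q \<le> ln (real m)"
proof (cases "Q = {}")
  case False
  then have "card Q > 0" using assms(1) by (simp add: card_gt_0_iff)
  then show ?thesis using assms(2) False by (simp add: score_def)
next
  case True
  have "0 \<le> ln (real m)" using assms(3) by (intro ln_ge_zero) simp
  then show ?thesis using assms(4) True by (simp add: score_def)
qed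

text \<open>The right-hand side is the chord of the convex function x ln (x - 1) over [2, k]; its
  value at 2 is 0.\<close>

lemma mult_ln_chord:
  fixes x k :: real
  assumes "2 \<le> x" "x \<le> k" "2 < k"
  shows "x * ln (x - 1) \<le> (x - 2) / (k - 2) * (k * ln (k - 1))"
proof -
  have "convex_on {2..k} (\<lambda>x::real. x * ln (x - 1))"
  proof (rule f''_ge0_imp_convex)
    show "((\<lambda>x::real. x * ln (x - 1)) has_real_derivative (ln (x - 1) + x / (x - 1))) (at x)"
      if "x \<in> {2..k}" for x
      using that by (auto intro!: derivative_eq_intros simp: field_simps)
    show "((\<lambda>x::real. ln (x - 1) + x / (x - 1)) has_real_derivative
             (1 / (x - 1) - 1 / (x - 1)\<^sup>2)) (at x)" if "x \<in> {2..k}" for x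
    proof -
      have "x - 1 \<noteq> 0" using that by auto
      then show ?thesis using that
        by (auto intro!: derivative_eq_intros simp: field_simps power2_eq_square)
    qed
    show "0 \<le> 1 / (x - 1) - 1 / (x - 1)\<^sup>2" if "x \<in> {2..k}" for x
    proof -
      have "1 \<le> x - 1" using that by simp
      then have "x - 1 \<le> (x - 1)\<^sup>2" using self_le_power[of "x - 1" 2] by simp
      then show ?thesis using \<open>1 \<le> x - 1\<close> by (simp add: frac_le)
    qed
  qed auto
  moreover define t where "t = (x - 2) / (k - 2)"
  moreover have "0 \<le> t" "t \<le> 1" using assms by (auto simp: t_def field_simps)
  moreover have x: "x = (1 - t) * 2 + t * k"
  proof -
    have "t * (k - 2) = x - 2" using assms by (simp add: t_def)
    then show ?thesis by (simp add: algebra_simps)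
  qed
  ultimately have "x * ln (x - 1) \<le> (1 - t) * (2 * ln (2 - 1)) + t * (k * ln (k - 1))"
    using convex_onD[of "{2..k}" "\<lambda>x::real. x * ln (x - 1)" t 2 k] assms by simp
  then show ?thesis by (simp add: t_def)
qed

text \<open>A deficient set of \<open>j\<close> edges bounds the product of the palette sizes by
  \<open>(j - 1)\<^sup>j l\<^sup>k\<^sup>-\<^sup>j\<close>. By convexity of \<open>x ln (x - 1)\<close> the worst case is \<open>j = 2\<close> or \<open>j = k\<close>,
  and \<open>j = 2\<close> is exactly where the upper bound on \<open>l\<close> enters.\<close>

lemma sum_score_less:
  assumes fin: "finite E" and k: "card E = k" "k \<ge> 3" and kl: "k \<le> l"
    and l: "(real k - 2) * ln (real l) < real k * ln (real k - 1)"
    and P: "\<And>e. e \<in> E \<Longrightarrow> P e \<subseteq> {1..l}"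
    and no: "\<nexists>\<psi>. transversal P E \<psi>"
    and nconst: "\<nexists>B. card B = k - 1 \<and> (\<forall>e\<in>E. P e = B)"
  shows "(\<Sum>e\<in>E. score (real k * ln (real l)) (P e)) < real k * ln (real k - 1)"
proof -
  define L where "L = real k * ln (real l)"
  have lnl: "ln (real l) > 0" and L: "L \<ge> 0" using k kl by (auto simp: L_def)
  have finP: "finite (P e)" if "e \<in> E" for e using P[OF that] finite_subset by blast
  have le_l: "score L (P e) \<le> ln (real l)" if "e \<in> E" for e
    using card_mono[OF _ P[OF that]] finP[OF that] k kl L by (intro score_le) auto
  obtain J where J: "J \<subseteq> E" "J \<noteq> {}" "\<And>e. e \<in> J \<Longrightarrow> card (P e) < card J"
    using no_transversal_deficient[OF fin finP no] by blast
  have finJ: "finite J" using J(1) fin finite_subset by auto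
  define j where "j = card J"
  have j: "1 \<le> j" "j \<le> k"
    using J(2) finJ card_mono[OF fin J(1)] k by (auto simp: j_def Suc_le_eq card_gt_0_iff)
  have split: "(\<Sum>e\<in>E. score L (P e)) \<le> (\<Sum>e\<in>J. score L (P e)) + (real k - real j) * ln (real l)"
  proof -
    have "(\<Sum>e\<in>E. score L (P e)) = (\<Sum>e\<in>E - J. score L (P e)) + (\<Sum>e\<in>J. score L (P e))"
      by (rule sum.subset_diff[OF J(1) fin])
    moreover have "(\<Sum>e\<in>E - J. score L (P e)) \<le> (\<Sum>e\<in>E - J. ln (real l))"
      using le_l by (intro sum_mono) auto
    moreover have "real (card (E - J)) = real k - real j"
      using fin finJ J(1) j k by (simp add: card_Diff_subset j_def of_nat_diff)
    ultimately show ?thesis by simp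
  qed
  have pos: "0 < real k * ln (real k - 1)" using k by simp
  consider "j = 1" | "2 \<le> j" "j < k" | "j = k" using j by linarith
  then have "(\<Sum>e\<in>E. score L (P e)) < real k * ln (real k - 1)"
  proof cases
    case 1
    \<comment> \<open>The only deficient edge has an empty palette. Its score -k ln l leaves at most
      -ln l after the other k - 1 edges have taken ln l each.\<close>
    then obtain e where "J = {e}" by (auto simp: j_def card_1_singleton_iff)
    with J(3)[of e] finP[of e] J(1) have "(\<Sum>e\<in>J. score L (P e)) = - L"
      by (auto simp: score_def)
    then have "(\<Sum>e\<in>E. score L (P e)) \<le> - ln (real l)"
      using split 1 by (simp add: L_def algebra_simps)
    then show ?thesis using lnl pos by linarith
  next
    case 2
    have "(\<Sum>e\<in>J. score L (P e)) \<le> (\<Sum>e\<in>J. ln (real (j - 1)))"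
    proof (rule sum_mono)
      fix e assume e: "e \<in> J"
      then show "score L (P e) \<le> ln (real (j - 1))"
        using J(3)[OF e] finP[of e] J(1) 2 L by (intro score_le) (auto simp: j_def)
    qed
    also have "\<dots> = real j * ln (real j - 1)" using 2 by (simp add: j_def of_nat_diff)
    also have "\<dots> \<le> (real j - 2) / (real k - 2) * (real k * ln (real k - 1))"
      using 2 k by (intro mult_ln_chord) auto
    finally have "(\<Sum>e\<in>E. score L (P e)) \<le>
        (real j - 2) / (real k - 2) * (real k * ln (real k - 1)) + (real k - real j) * ln (real l)"
      using split by linarith
    \<comment> \<open>The bound on l in the form ln l < k ln (k - 1) / (k - 2) makes both terms
      multiples of the same quantity, with coefficients j - 2 and k - j that add up to k -
      2.\<close>
    also have "(real k - real j) * ln (real l) <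
        (real k - real j) * (real k * ln (real k - 1) / (real k - 2))"
      using 2 k l by (intro mult_strict_left_mono) (auto simp: field_simps)
    also have "(real j - 2) / (real k - 2) * (real k * ln (real k - 1)) +
        (real k - real j) * (real k * ln (real k - 1) / (real k - 2)) =
        ((real j - 2) + (real k - real j)) / (real k - 2) * (real k * ln (real k - 1))"
    proof -
      have "a / d * c + b * (c / d) = (a + b) / d * c" for a b c d :: real
        by (simp add: add_divide_distrib distrib_right)
      then show ?thesis .
    qed
    also have "\<dots> = real k * ln (real k - 1)" using k by simp
    finally show ?thesis by simp
  next
    case 3
    then have JE: "J = E" using card_subset_eq[OF fin J(1)] k by (simp add: j_def)
    have le: "card (P e) \<le> k - 1" if "e \<in> E" for e using J(3)[of e] that JE k by simp
    \<comment> \<open>Strictness: if all palettes had exactly k - 1 colours, the absence of a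
      transversal would make them equal, the excluded case.\<close>
    have "\<exists>e\<in>E. card (P e) \<noteq> k - 1"
    proof (rule ccontr)
      assume "\<not> (\<exists>e\<in>E. card (P e) \<noteq> k - 1)"
      then have eq: "\<And>e. e \<in> E \<Longrightarrow> card (P e) = card E - 1" using k by auto
      obtain e0 where e0: "e0 \<in> E" using J(1,2) by auto
      then have "\<forall>e\<in>E. P e = P e0"
        using no_transversal_uniform_eq[OF fin finP no eq] by blast
      then show False using nconst eq[OF e0] k by blast
    qed
    then obtain e0 where e0: "e0 \<in> E" "card (P e0) \<noteq> k - 1" by blast
    have "(\<Sum>e\<in>E. score L (P e)) < (\<Sum>e\<in>E. ln (real (k - 1)))"
    proof (rule sum_strict_mono_ex1[OF fin])
      show "\<forall>e\<in>E. score L (P e) \<le> ln (real (k - 1))"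
      proof
        fix e assume "e \<in> E"
        then show "score L (P e) \<le> ln (real (k - 1))"
          by (intro score_le finP le) (use k L in auto)
      qed
      have "card (P e0) \<le> k - 2" using le[OF e0(1)] e0(2) k by linarith
      then have "score L (P e0) \<le> ln (real (k - 2))"
        using finP[OF e0(1)] k L by (intro score_le) auto
      also have "\<dots> < ln (real (k - 1))" using k by simp
      finally show "\<exists>e\<in>E. score L (P e) < ln (real (k - 1))" using e0(1) by blast
    qed
    then show ?thesis using k by (simp add: of_nat_diff)
  qed
  then show ?thesis by (simp add: L_def)
qed

text \<open>Up to restriction to \<open>E\<close> there are finitely many assignments of palettes in
  {1..l}, so the strict inequality has a uniform gap. The extra element 1 keeps the minimum defined
  and positive when no assignment qualifies.\<close>

lemma sum_score_gap:
  assumes fin: "finite E" and k: "card E = k" "k \<ge> 3" and kl: "k \<le> l"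
    and l: "(real k - 2) * ln (real l) < real k * ln (real k - 1)"
  shows "\<exists>\<kappa>>0. \<forall>P. (\<forall>e\<in>E. P e \<subseteq> {1..l}) \<longrightarrow> (\<nexists>\<psi>. transversal P E \<psi>) \<longrightarrow>
     (\<nexists>B. card B = k - 1 \<and> (\<forall>e\<in>E. P e = B)) \<longrightarrow>
     (\<Sum>e\<in>E. score (real k * ln (real l)) (P e)) \<le> real k * ln (real k - 1) - \<kappa>"
proof -
  let ?X = "E \<rightarrow>\<^sub>E Pow {1..l}"
  let ?s = "\<lambda>P. real k * ln (real k - 1) - (\<Sum>e\<in>E. score (real k * ln (real l)) (P e))"
  let ?Y = "insert 1 {?s P | P. P \<in> ?X \<and> ?s P > 0}"
  have "finite ?X" using fin by (intro finite_PiE) auto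
  then have finY: "finite ?Y" by simp
  have pos: "Min ?Y > 0" using finY by (subst Min_gr_iff) auto
  show ?thesis
  proof (intro exI[of _ "Min ?Y"] conjI allI impI pos)
    fix P :: "'a \<Rightarrow> nat set"
    assume P: "\<forall>e\<in>E. P e \<subseteq> {1..l}" "\<nexists>\<psi>. transversal P E \<psi>"
      "\<nexists>B. card B = k - 1 \<and> (\<forall>e\<in>E. P e = B)"
    have eq: "?s (restrict P E) = ?s P" by simp
    have "?s P > 0" using sum_score_less[OF fin k kl l _ P(2,3)] P(1) by simp
    then have "?s (restrict P E) > 0" using eq by simp
    moreover have "restrict P E \<in> ?X" using P(1) by (auto simp: PiE_iff)
    ultimately have "?s (restrict P E) \<in> ?Y" by blast
    then have "Min ?Y \<le> ?s (restrict P E)" using finY by (rule Min_le[rotated])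
    then show "(\<Sum>e\<in>E. score (real k * ln (real l)) (P e)) \<le> real k * ln (real k - 1) - Min ?Y"
      using eq by linarith
  qed
qed

subsection \<open>Random edge sets\<close>

lemma exp_le_quadratic:
  fixes x :: real
  assumes "\<bar>x\<bar> \<le> 1"
  shows "exp x \<le> 1 + x + x\<^sup>2"
proof (cases "x \<ge> 0")
  case True
  then show ?thesis using exp_bound[of x] assms by simp
next
  case False
  have "x ^ 3 \<le> 0" using False by (simp add: power_le_zero_eq)
  then have "1 \<le> 1 - x ^ 3" by simp
  also have "\<dots> = (1 + x + x\<^sup>2) * (1 - x)" by (simp add: algebra_simps power2_eq_square power3_eq_cube)
  also have "\<dots> \<le> (1 + x + x\<^sup>2) * exp (- x)"
  proof (rule mult_left_mono)
    show "1 - x \<le> exp (- x)" using exp_ge_add_one_self[of "- x"] by simp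
    show "0 \<le> 1 + x + x\<^sup>2" using assms by (auto simp: abs_le_iff)
  qed
  finally show ?thesis by (simp add: exp_minus field_simps)
qed

text \<open>Chernoff's method with the presence of \<open>R\<close> built into the moment: the joint
  event costs a factor p for each element of \<open>R\<close>, and the factor \<open>exp 2\<close>
  per element pays for letting the sums in the exponent still run over all of
  \<open>D\<close>.\<close>

lemma bernoulli_subset_tail:
  fixes z :: "'e \<Rightarrow> real"
  assumes D: "finite D" "R \<subseteq> D" and p: "0 \<le> p" "p \<le> 1"
    and z: "\<And>e. e \<in> D \<Longrightarrow> \<bar>z e\<bar> \<le> Z" and \<mu>: "0 \<le> \<mu>" "\<mu> * Z \<le> 1"
  shows "measure_pmf.prob (Pi_pmf D False (\<lambda>_. bernoulli_pmf p))
           {X. (\<forall>e\<in>R. X e) \<and> a \<le> (\<Sum>e\<in>{e\<in>D. X e}. z e)}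
         \<le> (p * exp 2) ^ card R *
            exp (p * (\<mu> * (\<Sum>e\<in>D. z e) + (\<mu> * Z)\<^sup>2 * real (card D)) - \<mu> * a)"
proof -
  let ?M = "Pi_pmf D False (\<lambda>_. bernoulli_pmf p)"
  let ?A = "{X. (\<forall>e\<in>R. X e) \<and> a \<le> (\<Sum>e\<in>{e\<in>D. X e}. z e)}"
  \<comment> \<open>The value 0 on absent elements of \<open>R\<close> turns the product into the
    exponential moment times the indicator that \<open>R\<close> is present, while keeping
    independent factors.\<close>
  define f where "f e b = (if b then exp (\<mu> * z e) else if e \<in> R then 0 else 1)" for e b
  have fnn: "0 \<le> f e b" for e b by (simp add: f_def)
  define F where "F X = (\<Prod>e\<in>D. f e (X e))" for X
  have Fnn: "0 \<le> F X" for X unfolding F_def by (intro prod_nonneg) (simp add: fnn)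
  have int: "integrable (measure_pmf (bernoulli_pmf p)) (f e)" for e
    by (rule integrable_measure_pmf_finite) (auto intro: finite_subset[of _ UNIV])
  have intF: "integrable (measure_pmf ?M) F"
    unfolding F_def by (rule integrable_prod_Pi_pmf[OF D(1) int])
  have F_ge: "exp (\<mu> * a) * indicator ?A X \<le> F X" for X
  proof (cases "X \<in> ?A")
    case True
    then have R: "\<And>e. e \<in> R \<Longrightarrow> X e" and s: "a \<le> (\<Sum>e\<in>{e\<in>D. X e}. z e)" by auto
    have "F X = (\<Prod>e\<in>D. if X e then exp (\<mu> * z e) else 1)"
      unfolding F_def using R by (intro prod.cong) (auto simp: f_def)
    also have "\<dots> = (\<Prod>e\<in>{e\<in>D. X e}. exp (\<mu> * z e))"
      by (rule prod.inter_filter[OF D(1), symmetric])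
    also have "\<dots> = exp (\<mu> * (\<Sum>e\<in>{e\<in>D. X e}. z e))"
      using D(1) by (simp add: exp_sum sum_distrib_left)
    also have "\<dots> \<ge> exp (\<mu> * a)" using \<mu>(1) s by (simp add: mult_left_mono)
    finally show ?thesis using True by simp
  qed (simp add: Fnn)
  define b where "b e = \<mu> * z e + (\<mu> * Z)\<^sup>2" for e
  have factor: "measure_pmf.expectation (bernoulli_pmf p) (f e)
      \<le> (if e \<in> R then p * exp 2 else 1) * exp (p * b e)" if e: "e \<in> D" for e
  proof -
    have "\<bar>\<mu> * z e\<bar> = \<mu> * \<bar>z e\<bar>" using \<mu>(1) by (simp add: abs_mult)
    also have "\<dots> \<le> \<mu> * Z" using z[OF e] \<mu>(1) by (rule mult_left_mono)
    finally have lz: "\<bar>\<mu> * z e\<bar> \<le> \<mu> * Z" .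
    then have lz1: "\<bar>\<mu> * z e\<bar> \<le> 1" using \<mu>(2) by linarith
    have E: "measure_pmf.expectation (bernoulli_pmf p) (f e) =
        exp (\<mu> * z e) * p + (if e \<in> R then 0 else 1) * (1 - p)"
      using p by (simp add: f_def)
    show ?thesis
    proof (cases "e \<in> R")
      case False
      have "exp (\<mu> * z e) * p + (1 - p) = 1 + p * (exp (\<mu> * z e) - 1)" by (simp add: algebra_simps)
      also have "\<dots> \<le> 1 + p * b e"
      proof -
        have "exp (\<mu> * z e) \<le> 1 + \<mu> * z e + (\<mu> * z e)\<^sup>2" by (rule exp_le_quadratic[OF lz1])
        also have "(\<mu> * z e)\<^sup>2 \<le> (\<mu> * Z)\<^sup>2" using lz by (meson abs_le_square_iff abs_ge_self order_trans)
        finally have "exp (\<mu> * z e) - 1 \<le> b e" by (simp add: b_def)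
        then show ?thesis using p(1) by (simp add: mult_left_mono)
      qed
      also have "\<dots> \<le> exp (p * b e)" by (rule exp_ge_add_one_self)
      finally show ?thesis using E False by simp
    next
      case True
      \<comment> \<open>One unit of the exponent 2 covers \<open>\<mu> * z e \<le> 1\<close>, the
        other this lower bound.\<close>
      have "- 1 \<le> p * b e"
      proof -
        have "-1 \<le> b e" unfolding b_def using lz1 by (smt (verit) zero_le_power2)
        then have "p * (-1) \<le> p * b e" using p(1) by (rule mult_left_mono)
        then show ?thesis using p(2) by linarith
      qed
      then have "\<mu> * z e \<le> 2 + p * b e" using lz1 by linarith
      then have "exp (\<mu> * z e) * p \<le> exp (2 + p * b e) * p"
        using p(1) by (intro mult_right_mono) auto
      then show ?thesis using E True by (simp add: exp_add mult_ac)
    qed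
  qed
  have "exp (\<mu> * a) * measure_pmf.prob ?M ?A = measure_pmf.expectation ?M (\<lambda>X. exp (\<mu> * a) * indicator ?A X)"
    by simp
  also have "\<dots> \<le> measure_pmf.expectation ?M F"
    by (intro integral_mono intF F_ge)
      (simp add: integrable_indicator_iff less_top[symmetric] measure_pmf.emeasure_finite)
  also have "\<dots> = (\<Prod>e\<in>D. measure_pmf.expectation (bernoulli_pmf p) (f e))"
    unfolding F_def by (rule expectation_prod_Pi_pmf[OF D(1) int fnn])
  also have "\<dots> \<le> (\<Prod>e\<in>D. (if e \<in> R then p * exp 2 else 1) * exp (p * b e))"
    using factor fnn by (intro prod_mono conjI Bochner_Integration.integral_nonneg) auto
  also have "\<dots> = (\<Prod>e\<in>D. if e \<in> R then p * exp 2 else 1) * exp (p * (\<Sum>e\<in>D. b e))"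
    using D(1) by (simp add: prod.distrib exp_sum sum_distrib_left)
  also have "(\<Prod>e\<in>D. if e \<in> R then p * exp 2 else 1) = (p * exp 2) ^ card R"
    using D by (simp add: prod.If_cases Int_absorb1)
  also have "(\<Sum>e\<in>D. b e) = \<mu> * (\<Sum>e\<in>D. z e) + (\<mu> * Z)\<^sup>2 * real (card D)"
    by (simp add: b_def sum.distrib sum_distrib_left mult.commute)
  finally show ?thesis by (simp add: exp_diff field_simps)
qed

lemma sum_Pow_power_card:
  fixes x :: real
  assumes "finite W"
  shows "(\<Sum>S\<in>Pow W. x ^ card S) = (1 + x) ^ card W"
  using prod_add[OF assms, of "\<lambda>_. x" "\<lambda>_. 1"] by (simp add: add.commute)

text \<open>Each term is at most \<open>(1 / q) powr s * (q * x) ^ card S\<close>, and the sum over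
  all subsets of \<open>W\<close> is then a binomial expansion. The free parameter q replaces
  estimates of binomial coefficients. The lemma serves twice: x of order p weights fingerprints by
  their probability, x = 1 counts them.\<close>

lemma sum_small_sets_le:
  fixes x q s :: real
  assumes W: "finite W" and q: "0 < q" "q \<le> 1" and x: "0 \<le> x"
    and S: "\<S> \<subseteq> {S. S \<subseteq> W \<and> real (card S) \<le> s}"
  shows "(\<Sum>S\<in>\<S>. x ^ card S) \<le> exp (s * ln (1 / q) + q * x * real (card W))"
proof -
  have "(\<Sum>S\<in>\<S>. x ^ card S) \<le> (\<Sum>S\<in>\<S>. exp (s * ln (1 / q)) * (q * x) ^ card S)"
  proof (rule sum_mono)
    fix S assume "S \<in> \<S>"
    then have "real (card S) * ln (1 / q) \<le> s * ln (1 / q)"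
      using S q by (intro mult_right_mono) auto
    then have "exp (real (card S) * ln (1 / q)) \<le> exp (s * ln (1 / q))" by simp
    moreover have "exp (real (card S) * ln (1 / q)) = (1 / q) ^ card S"
      using q by (simp add: exp_of_nat_mult)
    ultimately have "(1 / q) ^ card S * (q * x) ^ card S \<le> exp (s * ln (1 / q)) * (q * x) ^ card S"
      using q x by (intro mult_right_mono) auto
    moreover have "(1 / q) ^ card S * (q * x) ^ card S = x ^ card S"
      using q by (simp flip: power_mult_distrib)
    ultimately show "x ^ card S \<le> exp (s * ln (1 / q)) * (q * x) ^ card S" by simp
  qed
  also have "\<dots> \<le> (\<Sum>S\<in>Pow W. exp (s * ln (1 / q)) * (q * x) ^ card S)"
    using W S q x by (intro sum_mono2) auto
  also have "\<dots> = exp (s * ln (1 / q)) * (1 + q * x) ^ card W"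
    using W by (simp add: sum_Pow_power_card flip: sum_distrib_left)
  also have "(1 + q * x) ^ card W \<le> exp (q * x) ^ card W"
    using q x by (intro power_mono exp_ge_add_one_self) auto
  also have "\<dots> = exp (q * x * real (card W))" by (simp flip: exp_of_nat2_mult)
  finally show ?thesis by (simp add: exp_add)
qed

text \<open>As \<open>fst\<close> is injective on a fingerprint, it prescribes exactly
  \<open>card S\<close> pairs, so its weight is a full power of p. Both the fingerprint cost and the
  deviation gain then become comparable with the expected number of edges
  \<open>p * card D\<close>.\<close>

lemma fingerprint_union_bound:
  fixes z :: "('e \<times> 'c) set \<Rightarrow> 'e \<Rightarrow> real"
  assumes D: "finite D" and L: "finite L" and p: "0 \<le> p" "p \<le> 1" and q: "0 < q" "q \<le> 1"
    and S: "\<And>S. S \<in> \<S> \<Longrightarrow> S \<subseteq> D \<times> L \<and> inj_on fst S \<and> real (card S) \<le> s"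
    and z: "\<And>S e. S \<in> \<S> \<Longrightarrow> e \<in> D \<Longrightarrow> \<bar>z S e\<bar> \<le> Z"
    and sum_z: "\<And>S. S \<in> \<S> \<Longrightarrow> (\<Sum>e\<in>D. z S e) \<le> - \<eta> * real (card D)"
    and \<mu>: "0 < \<mu>" "\<mu> * Z \<le> 1" "\<mu> * Z\<^sup>2 \<le> \<eta> / 2"
  shows "measure_pmf.prob (Pi_pmf D False (\<lambda>_. bernoulli_pmf p))
           {X. \<exists>S\<in>\<S>. (\<forall>e\<in>fst ` S. X e) \<and> 0 \<le> (\<Sum>e\<in>{e\<in>D. X e}. z S e)}
         \<le> exp (s * ln (1 / q) + q * exp 2 * real (card L) * (p * real (card D))
                - \<mu> * \<eta> / 2 * (p * real (card D)))"
proof -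
  let ?M = "Pi_pmf D False (\<lambda>_. bernoulli_pmf p)"
  let ?A = "\<lambda>S. {X. (\<forall>e\<in>fst ` S. X e) \<and> 0 \<le> (\<Sum>e\<in>{e\<in>D. X e}. z S e)}"
  let ?b = "exp (- (\<mu> * \<eta> / 2 * (p * real (card D))))"
  have finS: "finite \<S>" using S D L by (intro finite_subset[of \<S> "Pow (D \<times> L)"]) auto
  have single: "measure_pmf.prob ?M (?A S) \<le> (p * exp 2) ^ card S * ?b" if "S \<in> \<S>" for S
  proof -
    have sub: "fst ` S \<subseteq> D" using S[OF that] by auto
    have "measure_pmf.prob ?M (?A S) \<le> (p * exp 2) ^ card (fst ` S) *
        exp (p * (\<mu> * (\<Sum>e\<in>D. z S e) + (\<mu> * Z)\<^sup>2 * real (card D)) - \<mu> * 0)"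
      using that \<mu> by (intro bernoulli_subset_tail[OF D sub p z]) auto
    also have "\<dots> \<le> (p * exp 2) ^ card S * ?b"
    proof -
      \<comment> \<open>The condition on \<open>\<mu>\<close> makes the quadratic error at most half
        of the linear gain \<open>\<mu> * \<eta>\<close>.\<close>
      have "\<mu> * (\<mu> * Z\<^sup>2) \<le> \<mu> * (\<eta> / 2)" using \<mu> by (intro mult_left_mono) auto
      then have "(\<mu> * Z)\<^sup>2 * real (card D) \<le> \<mu> * \<eta> / 2 * real (card D)"
        by (intro mult_right_mono) (auto simp: power2_eq_square mult_ac)
      moreover have "\<mu> * (\<Sum>e\<in>D. z S e) \<le> \<mu> * (- \<eta> * real (card D))"
        using sum_z[OF that] \<mu> by (intro mult_left_mono) auto
      ultimately have "\<mu> * (\<Sum>e\<in>D. z S e) + (\<mu> * Z)\<^sup>2 * real (card D) \<le> - (\<mu> * \<eta> / 2 * real (card D))"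
        by simp
      then have "p * (\<mu> * (\<Sum>e\<in>D. z S e) + (\<mu> * Z)\<^sup>2 * real (card D)) \<le> p * - (\<mu> * \<eta> / 2 * real (card D))"
        using p(1) by (rule mult_left_mono)
      then show ?thesis
        using p S[OF that] by (intro mult_mono) (auto simp: card_image mult_ac)
    qed
    finally show ?thesis .
  qed
  have "{X. \<exists>S\<in>\<S>. (\<forall>e\<in>fst ` S. X e) \<and> 0 \<le> (\<Sum>e\<in>{e\<in>D. X e}. z S e)} = (\<Union>S\<in>\<S>. ?A S)" by auto
  then have "measure_pmf.prob ?M {X. \<exists>S\<in>\<S>. (\<forall>e\<in>fst ` S. X e) \<and> 0 \<le> (\<Sum>e\<in>{e\<in>D. X e}. z S e)}
      \<le> (\<Sum>S\<in>\<S>. measure_pmf.prob ?M (?A S))"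
    using measure_pmf.finite_measure_subadditive_finite[OF finS, of ?A ?M] by simp
  also have "\<dots> \<le> (\<Sum>S\<in>\<S>. (p * exp 2) ^ card S * ?b)" by (intro sum_mono single)
  also have "\<dots> = (\<Sum>S\<in>\<S>. (p * exp 2) ^ card S) * ?b" by (simp add: sum_distrib_right)
  also have "\<dots> \<le> exp (s * ln (1 / q) + q * (p * exp 2) * real (card (D \<times> L))) * ?b"
    using S D L q p by (intro mult_right_mono sum_small_sets_le) auto
  finally show ?thesis by (simp add: card_cartesian_product mult_ac flip: exp_add)
qed

text \<open>The lower tail is an upper tail for z = -1. With \<open>\<mu> = 1 / 4\<close> the
  exponent is -1/4 + 1/16 + 1/8 = -1/16 times \<open>p * card D\<close>.\<close>

lemma bernoulli_few_edges:
  assumes D: "finite D" and p: "0 \<le> p" "p \<le> 1"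
  shows "measure_pmf.prob (Pi_pmf D False (\<lambda>_. bernoulli_pmf p))
           {X. real (card {e\<in>D. X e}) \<le> p * real (card D) / 2} \<le> exp (- (p * real (card D) / 16))"
  using bernoulli_subset_tail[OF D empty_subsetI p, of "\<lambda>_. - 1" 1 "1 / 4" "- (p * real (card D) / 2)"]
  by (simp add: power2_eq_square algebra_simps)

subsection \<open>Rainbow embeddings\<close>

lemma finite_edges: "simple_graph G \<Longrightarrow> finite (edges G)"
  unfolding simple_graph_def by (rule finite_subset[of _ "Pow (verts G)"]) auto

lemma finite_subgraph_densities:
  assumes "simple_graph H"
  shows "finite {(real (num_edges F) - 1) / (real (num_verts F) - 2) | F. subgraph F H \<and> num_verts F \<ge> 3}"
proof (rule finite_subset)
  show "finite ((\<lambda>(V, E). (real (card E) - 1) / (real (card V) - 2)) ` (Pow (verts H) \<times> Pow (edges H)))"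
    using assms finite_edges[OF assms] by (intro finite_imageI finite_cartesian_product)
      (auto simp: simple_graph_def)
  show "{(real (num_edges F) - 1) / (real (num_verts F) - 2) | F. subgraph F H \<and> num_verts F \<ge> 3}
      \<subseteq> (\<lambda>(V, E). (real (card E) - 1) / (real (card V) - 2)) ` (Pow (verts H) \<times> Pow (edges H))"
  proof
    fix d assume "d \<in> {(real (num_edges F) - 1) / (real (num_verts F) - 2) | F. subgraph F H \<and> num_verts F \<ge> 3}"
    then obtain F where F: "d = (real (num_edges F) - 1) / (real (num_verts F) - 2)" "subgraph F H"
      by blast
    show "d \<in> (\<lambda>(V, E). (real (card E) - 1) / (real (card V) - 2)) ` (Pow (verts H) \<times> Pow (edges H))"
      using F by (intro image_eqI[of _ _ "(verts F, edges F)"])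
        (auto simp: num_edges_def num_verts_def subgraph_def)
  qed
qed

lemma density_le_m2:
  assumes "simple_graph H" "subgraph F H" "num_verts F \<ge> 3"
  shows "(real (num_edges F) - 1) / (real (num_verts F) - 2) \<le> m2 H"
  unfolding m2_def using assms by (intro Max_ge finite_subgraph_densities) auto

lemma adjacent_edges:
  assumes "simple_graph H" "non_matching H"
  obtains u v w where "{u, v} \<in> edges H" "{u, w} \<in> edges H" "u \<noteq> v" "u \<noteq> w" "v \<noteq> w"
proof -
  from assms(2) obtain e f u where ef: "e \<in> edges H" "f \<in> edges H" "e \<noteq> f" "u \<in> e" "u \<in> f"
    unfolding non_matching_def by blast
  have "card e = 2" "card f = 2" using ef assms(1) by (auto simp: simple_graph_def)
  then obtain v w where "e = {u, v}" "f = {u, w}" "u \<noteq> v" "u \<noteq> w"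
    using ef(4,5) by (metis card_2_iff doubleton_eq_iff insertE singletonD)
  with ef show thesis by (intro that[of u v w]) auto
qed

text \<open>Two adjacent edges span a path on three vertices, of 2-density 1.\<close>

lemma m2_ge_1:
  assumes "simple_graph H" "non_matching H"
  shows "m2 H \<ge> 1"
proof -
  obtain u v w where e: "{u, v} \<in> edges H" "{u, w} \<in> edges H" "u \<noteq> v" "u \<noteq> w" "v \<noteq> w"
    using adjacent_edges[OF assms] by blast
  let ?F = "SGraph {u, v, w} {{u, v}, {u, w}}"
  have "{u, v} \<noteq> {u, w}" using e by (auto simp: doubleton_eq_iff)
  then have c: "num_edges ?F = 2" "num_verts ?F = 3" using e by (auto simp: num_edges_def num_verts_def)
  have "subgraph ?F H"
    using e assms(1) by (auto simp: subgraph_def simple_graph_def)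
  from density_le_m2[OF assms(1) this] c show ?thesis by simp
qed

lemma num_verts_ge_3:
  assumes "simple_graph H" "non_matching H"
  shows "num_verts H \<ge> 3"
proof -
  obtain u v w where e: "{u, v} \<in> edges H" "{u, w} \<in> edges H" "u \<noteq> v" "u \<noteq> w" "v \<noteq> w"
    using adjacent_edges[OF assms] by blast
  have "{u, v, w} \<subseteq> verts H" "finite (verts H)" using e assms(1) by (auto simp: simple_graph_def)
  from card_mono[OF this(2,1)] e show ?thesis by (simp add: num_verts_def)
qed

section \<open>Coloured embeddings as a weighted hypergraph\<close>

definition rainbow_embeddings :: "'a sgraph \<Rightarrow> nat \<Rightarrow> nat \<Rightarrow> (('a \<Rightarrow> nat) \<times> ('a set \<Rightarrow> nat)) set" where
  "rainbow_embeddings H l n =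
     {\<phi> \<in> verts H \<rightarrow>\<^sub>E {1..n}. inj_on \<phi> (verts H)} \<times> {\<psi> \<in> edges H \<rightarrow>\<^sub>E {1..l}. inj_on \<psi> (edges H)}"

definition coloured_image :: "'a sgraph \<Rightarrow> ('a \<Rightarrow> 'b) \<times> ('a set \<Rightarrow> 'c) \<Rightarrow> ('b set \<times> 'c) set" where
  "coloured_image H x = (\<lambda>e. (fst x ` e, snd x e)) ` edges H"

text \<open>Dividing by \<open>n\<^sup>v\<^sup>-\<^sup>2\<close> makes the typical degree of a coloured pair of order 1.\<close>

definition rainbow_weight :: "'a sgraph \<Rightarrow> nat \<Rightarrow> nat \<Rightarrow> (nat set \<times> nat) set \<Rightarrow> real" where
  "rainbow_weight H l n A =
     real (card {x \<in> rainbow_embeddings H l n. coloured_image H x = A}) / real n ^ (num_verts H - 2)"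

lemma finite_rainbow_embeddings:
  assumes "simple_graph H"
  shows "finite (rainbow_embeddings H l n)"
proof -
  have "finite (verts H \<rightarrow>\<^sub>E {1..n})" "finite (edges H \<rightarrow>\<^sub>E {1..l})"
    using assms finite_edges[OF assms] by (auto intro!: finite_PiE simp: simple_graph_def)
  then show ?thesis unfolding rainbow_embeddings_def by simp
qed

lemma finite_pairs: "finite (pairs n)"
  unfolding pairs_def by (rule finite_subset[of _ "Pow {1..n}"]) auto

lemma wdeg_rainbow_weight:
  assumes H: "simple_graph H" and V: "finite V"
  shows "wdeg (rainbow_weight H l n) V T =
    real (card {x \<in> rainbow_embeddings H l n. T \<subseteq> coloured_image H x \<and> coloured_image H x \<subseteq> V})
      / real n ^ (num_verts H - 2)"
proof -
  let ?X = "rainbow_embeddings H l n" and ?F = "{A \<in> Pow V. T \<subseteq> A}"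
  have fin: "finite ?X" by (rule finite_rainbow_embeddings[OF H])
  have "{x \<in> ?X. T \<subseteq> coloured_image H x \<and> coloured_image H x \<subseteq> V}
      = (\<Union>A\<in>?F. {x \<in> ?X. coloured_image H x = A})" by auto
  then have "card {x \<in> ?X. T \<subseteq> coloured_image H x \<and> coloured_image H x \<subseteq> V}
      = (\<Sum>A\<in>?F. card {x \<in> ?X. coloured_image H x = A})"
    using V fin by (simp only:) (rule card_UN_disjoint, auto)
  then show ?thesis
    by (simp add: wdeg_def rainbow_weight_def sum_divide_distrib)
qed

lemma card_PiE_image_le:
  assumes "finite V" "U \<subseteq> V" "finite W"
  shows "card {\<phi> \<in> V \<rightarrow>\<^sub>E {1..n::nat}. \<phi> ` U \<subseteq> W} \<le> card W ^ card U * n ^ (card V - card U)"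
proof -
  let ?B = "\<lambda>i. if i \<in> U then W else {1..n}"
  have "{\<phi> \<in> V \<rightarrow>\<^sub>E {1..n}. \<phi> ` U \<subseteq> W} \<subseteq> PiE V ?B"
    by (auto simp: PiE_iff extensional_def image_subset_iff)
  then have "card {\<phi> \<in> V \<rightarrow>\<^sub>E {1..n}. \<phi> ` U \<subseteq> W} \<le> card (PiE V ?B)"
    using assms by (intro card_mono finite_PiE) auto
  also have "\<dots> = (\<Prod>i\<in>V. card (?B i))" by (rule card_PiE[OF assms(1)])
  also have "\<dots> = (\<Prod>i\<in>V. if i \<in> U then card W else n)" by (intro prod.cong) auto
  also have "\<dots> = card W ^ card U * n ^ (card V - card U)"
  proof -
    have "V \<inter> {x. x \<in> U} = U" "V \<inter> - {x. x \<in> U} = V - U" using assms(2) by auto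
    then show ?thesis
      using assms finite_subset[OF assms(2,1)] by (simp add: prod.If_cases card_Diff_subset)
  qed
  finally show ?thesis .
qed

text \<open>The definition of \<open>m2\<close>, rearranged for the subgraph formed by
  \<open>E'\<close>. If it spans only two vertices, then \<open>E'\<close> is a single edge and both
  sides are 0.\<close>

lemma edge_span_bound:
  assumes H: "simple_graph H" "non_matching H" and E': "E' \<subseteq> edges H" "E' \<noteq> {}"
  shows "2 \<le> card (\<Union>E')" "(real (card E') - 1) / m2 H \<le> real (card (\<Union>E')) - 2"
proof -
  have fin: "finite (\<Union>E')" "\<Union>E' \<subseteq> verts H"
    using H(1) E'(1) finite_subset[of "\<Union>E'" "verts H"] by (auto simp: simple_graph_def)
  have c: "card e = 2" if "e \<in> E'" for e using that E'(1) H(1) by (auto simp: simple_graph_def)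
  obtain e where e: "e \<in> E'" using E'(2) by blast
  have "card e \<le> card (\<Union>E')" using e fin(1) by (intro card_mono) auto
  then show ge2: "2 \<le> card (\<Union>E')" using c[OF e] by simp
  have m: "m2 H \<ge> 1" by (rule m2_ge_1[OF H])
  show "(real (card E') - 1) / m2 H \<le> real (card (\<Union>E')) - 2"
  proof (cases "card (\<Union>E') = 2")
    case True
    have "f = \<Union>E'" if "f \<in> E'" for f
      using that c[OF that] True fin(1) by (intro card_subset_eq) auto
    then have "E' = {\<Union>E'}" using e by blast
    then have "card E' = 1" by (metis card_1_singleton_iff One_nat_def)
    then show ?thesis using True by simp
  next
    case False
    let ?F = "SGraph (\<Union>E') E'"
    have "subgraph ?F H" using fin c E'(1) by (auto simp: subgraph_def simple_graph_def)
    then have "(real (card E') - 1) / (real (card (\<Union>E')) - 2) \<le> m2 H"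
      using density_le_m2[OF H(1), of ?F] ge2 False by (simp add: num_edges_def num_verts_def)
    then show ?thesis using m ge2 False by (simp add: divide_le_eq mult.commute)
  qed
qed

text \<open>At most 2^m sets \<open>E'\<close> of edges of \<open>H\<close> can be those mapped onto
  \<open>T\<close>. If \<open>E'\<close> spans u vertices, these go to the boundedly many vertices
  covered by \<open>T\<close> and the others are free, which leaves O(n^(v - u)) embeddings. After
  normalisation this is O(n^(-(u - 2))), and u - 2 is at least (|T| - 1) /
  \<open>m2 H\<close>.\<close>

lemma card_rainbow_embeddings_containing:
  assumes H: "simple_graph H" "non_matching H" and n: "n > 0" and T: "T \<noteq> {}"
  shows "real (card {x \<in> rainbow_embeddings H l n. T \<subseteq> coloured_image H x}) / real n ^ (num_verts H - 2)
    \<le> 2 ^ num_edges H * real l ^ num_edges H * real (num_verts H) ^ num_verts H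
        * (real n powr (- 1 / m2 H)) ^ (card T - 1)"
proof (cases "{x \<in> rainbow_embeddings H l n. T \<subseteq> coloured_image H x} = {}")
  case True
  then show ?thesis by (simp only: card.empty) simp
next
  case False
  let ?X = "{x \<in> rainbow_embeddings H l n. T \<subseteq> coloured_image H x}"
  let ?v = "num_verts H" and ?m = "num_edges H" and ?\<tau> = "real n powr (- 1 / m2 H)"
  define W where "W = \<Union>(fst ` T)"
  define \<E> where "\<E> = {E'. E' \<subseteq> edges H \<and> card E' = card T \<and> E' \<noteq> {}}"
  define Y where "Y E' = {\<phi> \<in> verts H \<rightarrow>\<^sub>E {1..n}. \<phi> ` \<Union>E' \<subseteq> W} \<times> (edges H \<rightarrow>\<^sub>E {1..l})" for E'
  have finV: "finite (verts H)" and finE: "finite (edges H)"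
    using H finite_edges by (auto simp: simple_graph_def)
  have v2: "?v \<ge> 3" by (rule num_verts_ge_3[OF H])
  have fin\<E>: "finite \<E>" unfolding \<E>_def using finE by simp
  have finY: "finite (Y E')" for E'
  proof -
    have "finite (verts H \<rightarrow>\<^sub>E {1..n})" "finite (edges H \<rightarrow>\<^sub>E {1..l})"
      using finV finE by (auto intro: finite_PiE)
    then show ?thesis unfolding Y_def by simp
  qed
  have span: "\<exists>E'\<in>\<E>. x \<in> Y E' \<and> W \<subseteq> fst x ` verts H" if x: "x \<in> ?X" for x
  proof -
    have xr: "fst x \<in> verts H \<rightarrow>\<^sub>E {1..n}" "snd x \<in> edges H \<rightarrow>\<^sub>E {1..l}" "inj_on (snd x) (edges H)"
      using x by (auto simp: rainbow_embeddings_def)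
    define E' where "E' = {e \<in> edges H. (fst x ` e, snd x e) \<in> T}"
    have TE: "T = (\<lambda>e. (fst x ` e, snd x e)) ` E'"
      using x by (auto simp: E'_def coloured_image_def)
    \<comment> \<open>Distinct colours separate the coloured pairs, so \<open>E'\<close> has exactly
      as many elements as \<open>T\<close>.\<close>
    have "inj_on (\<lambda>e. (fst x ` e, snd x e)) E'"
      using xr(3) by (auto simp: E'_def inj_on_def)
    then have "card T = card E'" using TE by (simp add: card_image)
    moreover have "E' \<noteq> {}" using TE T by auto
    ultimately have "E' \<in> \<E>" by (auto simp: \<E>_def E'_def)
    moreover have W: "W = fst x ` \<Union>E'" unfolding W_def TE by auto
    moreover have "x \<in> Y E'" using xr W by (auto simp: Y_def mem_Times_iff)
    moreover have "\<Union>E' \<subseteq> verts H" using H(1) by (auto simp: E'_def simple_graph_def)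
    ultimately show ?thesis by blast
  qed
  \<comment> \<open>One embedding that covers \<open>T\<close> suffices to see that \<open>T\<close>
    touches at most v vertices.\<close>
  obtain x0 where "x0 \<in> ?X" using False by blast
  from span[OF this] have "W \<subseteq> fst x0 ` verts H" by blast
  then have finW: "finite W" and cW: "card W \<le> ?v"
    using finV finite_subset[of W "fst x0 ` verts H"] card_mono[of "fst x0 ` verts H" W]
      card_image_le[OF finV, of "fst x0"] by (auto simp: num_verts_def)
  have Y_le: "real (card (Y E')) / real n ^ (?v - 2) \<le> real l ^ ?m * real ?v ^ ?v * ?\<tau> ^ (card T - 1)"
    if E': "E' \<in> \<E>" for E'
  proof -
    let ?u = "card (\<Union>E')"
    have E: "E' \<subseteq> edges H" "E' \<noteq> {}" "card E' = card T" using E' by (auto simp: \<E>_def)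
    have cT: "card T > 0" using E finE finite_subset[OF E(1) finE] by (metis card_gt_0_iff)
    have UV: "\<Union>E' \<subseteq> verts H" using E(1) H(1) by (auto simp: simple_graph_def)
    have uv: "2 \<le> ?u" "?u \<le> ?v" using edge_span_bound[OF H E(1,2)] card_mono[OF finV UV]
      by (auto simp: num_verts_def)
    have "card {\<phi> \<in> verts H \<rightarrow>\<^sub>E {1..n}. \<phi> ` \<Union>E' \<subseteq> W} \<le> card W ^ ?u * n ^ (?v - ?u)"
      unfolding num_verts_def by (rule card_PiE_image_le[OF finV UV finW])
    also have "\<dots> \<le> ?v ^ ?v * n ^ (?v - ?u)"
    proof (rule mult_right_mono)
      have "card W ^ ?u \<le> ?v ^ ?u" using cW by (intro power_mono) auto
      also have "\<dots> \<le> ?v ^ ?v" using uv by (intro power_increasing) auto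
      finally show "card W ^ ?u \<le> ?v ^ ?v" .
    qed simp
    finally have "card (Y E') \<le> ?v ^ ?v * n ^ (?v - ?u) * l ^ ?m"
      unfolding Y_def using finE
      by (simp add: card_cartesian_product card_PiE num_edges_def)
    then have "real (card (Y E')) \<le> real (?v ^ ?v * n ^ (?v - ?u) * l ^ ?m)" by (rule of_nat_mono)
    then have "real (card (Y E')) / real n ^ (?v - 2)
        \<le> real l ^ ?m * real ?v ^ ?v * (real n ^ (?v - ?u) / real n ^ (?v - 2))"
      using n by (simp add: divide_right_mono mult_ac)
    also have "real n ^ (?v - ?u) / real n ^ (?v - 2) = real n powr (- (real ?u - 2))"
      using n uv by (simp add: powr_realpow[symmetric] powr_diff[symmetric] of_nat_diff)
    also have "\<dots> \<le> real n powr (- ((real (card E') - 1) / m2 H))"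
      using n edge_span_bound(2)[OF H E(1,2)] by (intro powr_mono) auto
    also have "\<dots> = ?\<tau> ^ (card T - 1)"
      using n cT E(3) by (simp add: powr_realpow[symmetric] powr_powr of_nat_diff)
    finally show ?thesis by (simp add: mult_left_mono)
  qed
  have "?X \<subseteq> (\<Union>E'\<in>\<E>. Y E')" using span by blast
  then have "card ?X \<le> card (\<Union>E'\<in>\<E>. Y E')" using fin\<E> finY by (intro card_mono) auto
  also have "\<dots> \<le> (\<Sum>E'\<in>\<E>. card (Y E'))" by (rule card_UN_le[OF fin\<E>])
  finally have "real (card ?X) \<le> real (\<Sum>E'\<in>\<E>. card (Y E'))" by (rule of_nat_mono)
  then have "real (card ?X) / real n ^ (?v - 2) \<le> (\<Sum>E'\<in>\<E>. real (card (Y E')) / real n ^ (?v - 2))"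
    by (simp add: divide_right_mono flip: sum_divide_distrib)
  also have "\<dots> \<le> (\<Sum>E'\<in>\<E>. real l ^ ?m * real ?v ^ ?v * ?\<tau> ^ (card T - 1))"
    by (intro sum_mono Y_le)
  also have "\<dots> = real (card \<E>) * (real l ^ ?m * real ?v ^ ?v * ?\<tau> ^ (card T - 1))" by simp
  also have "\<dots> \<le> 2 ^ ?m * (real l ^ ?m * real ?v ^ ?v * ?\<tau> ^ (card T - 1))"
  proof (rule mult_right_mono)
    have "card \<E> \<le> card (Pow (edges H))" using finE by (intro card_mono) (auto simp: \<E>_def)
    then have "card \<E> \<le> 2 ^ ?m" using finE by (simp add: card_Pow num_edges_def)
    then show "real (card \<E>) \<le> 2 ^ ?m" by (simp add: of_nat_le_iff[symmetric] del: of_nat_le_iff)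
  qed simp
  finally show ?thesis by (simp add: mult_ac)
qed

lemma spread_rainbow_weight:
  assumes H: "simple_graph H" "non_matching H" and n: "n > 0"
  shows "spread_weight (num_edges H)
    (2 ^ num_edges H * real l ^ num_edges H * real (num_verts H) ^ num_verts H)
    (real n powr (- 1 / m2 H)) (pairs n \<times> {1..l}) (rainbow_weight H l n)"
  unfolding spread_weight_def
proof (intro conjI allI impI)
  show fin: "finite (pairs n \<times> {1..l})" by (simp add: finite_pairs)
  show "0 \<le> rainbow_weight H l n A" for A by (simp add: rainbow_weight_def)
  show "card A = num_edges H" if A: "rainbow_weight H l n A \<noteq> 0" for A
  proof -
    have "{x \<in> rainbow_embeddings H l n. coloured_image H x = A} \<noteq> {}"
    proof
      assume "{x \<in> rainbow_embeddings H l n. coloured_image H x = A} = {}"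
      then have "rainbow_weight H l n A = 0" by (simp add: rainbow_weight_def del: Collect_empty_eq)
      with A show False by simp
    qed
    then obtain x where x: "x \<in> rainbow_embeddings H l n" "coloured_image H x = A" by blast
    have "inj_on (\<lambda>e. (fst x ` e, snd x e)) (edges H)"
      using x(1) by (auto simp: rainbow_embeddings_def inj_on_def)
    then show ?thesis using x(2) by (auto simp: coloured_image_def card_image num_edges_def)
  qed
  fix T :: "(nat set \<times> nat) set" assume T: "T \<noteq> {}"
  have "card {x \<in> rainbow_embeddings H l n. T \<subseteq> coloured_image H x \<and> coloured_image H x \<subseteq> pairs n \<times> {1..l}}
      \<le> card {x \<in> rainbow_embeddings H l n. T \<subseteq> coloured_image H x}"
    using finite_rainbow_embeddings[OF H(1)] by (intro card_mono) auto
  then have "wdeg (rainbow_weight H l n) (pairs n \<times> {1..l}) T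
      \<le> real (card {x \<in> rainbow_embeddings H l n. T \<subseteq> coloured_image H x}) / real n ^ (num_verts H - 2)"
    unfolding wdeg_rainbow_weight[OF H(1) fin] by (intro divide_right_mono) auto
  also note card_rainbow_embeddings_containing[OF H n T]
  finally show "wdeg (rainbow_weight H l n) (pairs n \<times> {1..l}) T
     \<le> 2 ^ num_edges H * real l ^ num_edges H * real (num_verts H) ^ num_verts H
        * (real n powr (- 1 / m2 H)) ^ (card T - 1)" .
qed

definition colouring_graph :: "'b sgraph \<Rightarrow> ('b set \<Rightarrow> nat) \<Rightarrow> ('b set \<times> nat) set" where
  "colouring_graph G c = (\<lambda>e. (e, c e)) ` edges G"

lemma independent_colouring_graph:
  assumes H: "simple_graph H" and G: "verts G = {1..n}"
    and c: "c \<in> rainbow_free_colourings H l G"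
  shows "independent_set (rainbow_weight H l n) (colouring_graph G c)"
  unfolding independent_set_def
proof (intro allI impI)
  fix A assume A: "A \<subseteq> colouring_graph G c"
  have "{x \<in> rainbow_embeddings H l n. coloured_image H x = A} = {}"
  proof (rule ccontr)
    assume "{x \<in> rainbow_embeddings H l n. coloured_image H x = A} \<noteq> {}"
    then obtain x where x: "x \<in> rainbow_embeddings H l n" and xA: "coloured_image H x = A" by blast
    define \<phi> where "\<phi> = fst x"
    define \<psi> where "\<psi> = snd x"
    have xr: "\<phi> \<in> verts H \<rightarrow>\<^sub>E {1..n}" "inj_on \<phi> (verts H)" "inj_on \<psi> (edges H)"
      using x by (auto simp: rainbow_embeddings_def \<phi>_def \<psi>_def)
    have ed: "\<phi> ` e \<in> edges G \<and> c (\<phi> ` e) = \<psi> e" if "e \<in> edges H" for e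
      using A xA that unfolding coloured_image_def colouring_graph_def \<phi>_def \<psi>_def by auto
    let ?F = "SGraph (\<phi> ` verts H) ((\<lambda>e. \<phi> ` e) ` edges H)"
    have "subgraph ?F G"
    proof -
      have "card (\<phi> ` e) = 2" if "e \<in> edges H" for e
        using that H inj_on_subset[OF xr(2), of e] by (simp add: simple_graph_def card_image)
      then have "simple_graph ?F" using H by (auto simp: simple_graph_def)
      then show ?thesis using xr(1) ed G by (auto simp: subgraph_def)
    qed
    moreover have "isomorphic H ?F"
      using xr(2) by (auto simp: isomorphic_def bij_betw_def)
    moreover have "inj_on c (edges ?F)"
      using xr(3) ed by (auto simp: inj_on_def)
    ultimately have "rainbow_copy H G c ?F" by (simp add: rainbow_copy_def)
    then show False using c by (auto simp: rainbow_free_colourings_def)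
  qed
  then show "rainbow_weight H l n A = 0" by (simp add: rainbow_weight_def del: Collect_empty_eq)
qed

subsection \<open>Stability of palettes\<close>

lemma sum_const_fibres:
  fixes F :: "'b \<Rightarrow> real"
  assumes "finite S" "finite T" "g ` S \<subseteq> T" "\<And>t. t \<in> T \<Longrightarrow> card {x\<in>S. g x = t} = N"
  shows "(\<Sum>x\<in>S. F (g x)) = real N * (\<Sum>t\<in>T. F t)"
proof -
  have "(\<Sum>x\<in>S. F (g x)) = (\<Sum>t\<in>T. \<Sum>x\<in>{x\<in>S. g x = t}. F (g x))"
    by (rule sum.group[OF assms(1-3), symmetric])
  also have "\<dots> = (\<Sum>t\<in>T. real N * F t)"
    using assms(4) by (intro sum.cong) auto
  finally show ?thesis by (simp add: sum_distrib_left)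
qed

lemma card_PiE_fixed:
  assumes "finite V" "U \<subseteq> V" "\<And>i. i \<in> U \<Longrightarrow> h i \<in> {1..n::nat}"
  shows "card {\<phi> \<in> V \<rightarrow>\<^sub>E {1..n}. \<forall>i\<in>U. \<phi> i = h i} = n ^ (card V - card U)"
proof -
  have "{\<phi> \<in> V \<rightarrow>\<^sub>E {1..n}. \<forall>i\<in>U. \<phi> i = h i} = PiE V (\<lambda>i. if i \<in> U then {h i} else {1..n})"
  proof (intro equalityI subsetI)
    fix \<phi> assume "\<phi> \<in> PiE V (\<lambda>i. if i \<in> U then {h i} else {1..n})"
    then have \<phi>: "\<phi> \<in> extensional V" "\<And>i. i \<in> V \<Longrightarrow> \<phi> i \<in> (if i \<in> U then {h i} else {1..n})"
      unfolding PiE_iff by blast+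
    have "\<phi> i = h i" if "i \<in> U" for i using \<phi>(2)[of i] that assms(2) by auto
    moreover from this have "\<phi> i \<in> {1..n}" if "i \<in> V" for i
      using \<phi>(2)[OF that] assms(3)[of i] by (cases "i \<in> U") simp_all
    ultimately show "\<phi> \<in> {\<phi> \<in> V \<rightarrow>\<^sub>E {1..n}. \<forall>i\<in>U. \<phi> i = h i}"
      using \<phi>(1) unfolding PiE_iff by blast
  qed (auto simp: PiE_iff)
  then have "card {\<phi> \<in> V \<rightarrow>\<^sub>E {1..n}. \<forall>i\<in>U. \<phi> i = h i} = (\<Prod>i\<in>V. card (if i \<in> U then {h i} else {1..n}))"
    using assms(1) by (simp add: card_PiE)
  also have "\<dots> = (\<Prod>i\<in>V. if i \<in> U then 1 else n)" by (intro prod.cong) auto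
  also have "\<dots> = n ^ (card V - card U)"
  proof -
    have "V \<inter> - {x. x \<in> U} = V - U" by auto
    then show ?thesis
      using assms finite_subset[OF assms(2,1)] by (simp add: prod.If_cases card_Diff_subset)
  qed
  finally show ?thesis .
qed

text \<open>Averages run over all maps, injective or not, so that the images of fixed vertices are
  exactly uniform and independent. Non-injective maps form only an O(1/n) proportion and are
  discarded later.\<close>

lemma sum_PiE_two:
  fixes F :: "nat \<Rightarrow> nat \<Rightarrow> real"
  assumes V: "finite V" "u \<in> V" "w \<in> V" "u \<noteq> w"
  shows "(\<Sum>\<phi>\<in>V \<rightarrow>\<^sub>E {1..n}. F (\<phi> u) (\<phi> w)) =
    real n ^ (card V - 2) * (\<Sum>(x, y)\<in>{1..n} \<times> {1..n}. F x y)"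
proof -
  have "(\<Sum>\<phi>\<in>V \<rightarrow>\<^sub>E {1..n}. (\<lambda>(x, y). F x y) (\<phi> u, \<phi> w)) =
      real (n ^ (card V - 2)) * (\<Sum>p\<in>{1..n} \<times> {1..n}. (\<lambda>(x, y). F x y) p)"
  proof (rule sum_const_fibres[where g = "\<lambda>\<phi>. (\<phi> u, \<phi> w)" and F = "\<lambda>(x, y). F x y"])
    show "finite (V \<rightarrow>\<^sub>E {1..n})" using V by (intro finite_PiE) auto
    show "(\<lambda>\<phi>. (\<phi> u, \<phi> w)) ` (V \<rightarrow>\<^sub>E {1..n}) \<subseteq> {1..n} \<times> {1..n}" using V by auto
    fix t assume t: "t \<in> {1..n} \<times> {1..n}"
    define h where "h i = (if i = u then fst t else snd t)" for i
    have h: "h i \<in> {1..n}" for i using t by (auto simp: h_def)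
    have "{\<phi> \<in> V \<rightarrow>\<^sub>E {1..n}. (\<phi> u, \<phi> w) = t} = {\<phi> \<in> V \<rightarrow>\<^sub>E {1..n}. \<forall>i\<in>{u, w}. \<phi> i = h i}"
      using V by (auto simp: h_def)
    then show "card {\<phi> \<in> V \<rightarrow>\<^sub>E {1..n}. (\<phi> u, \<phi> w) = t} = n ^ (card V - 2)"
      using card_PiE_fixed[of V "{u, w}" h n] V t h by (simp add: eval_nat_numeral)
  qed simp
  then show ?thesis by simp
qed

lemma sum_PiE_three:
  fixes F :: "nat \<Rightarrow> nat \<Rightarrow> nat \<Rightarrow> real"
  assumes V: "finite V" "u \<in> V" "v \<in> V" "w \<in> V" "u \<noteq> v" "u \<noteq> w" "v \<noteq> w"
  shows "(\<Sum>\<phi>\<in>V \<rightarrow>\<^sub>E {1..n}. F (\<phi> u) (\<phi> v) (\<phi> w)) =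
    real n ^ (card V - 3) * (\<Sum>(x, y, z)\<in>{1..n} \<times> {1..n} \<times> {1..n}. F x y z)"
proof -
  have "(\<Sum>\<phi>\<in>V \<rightarrow>\<^sub>E {1..n}. (\<lambda>(x, y, z). F x y z) (\<phi> u, \<phi> v, \<phi> w)) =
      real (n ^ (card V - 3)) * (\<Sum>p\<in>{1..n} \<times> {1..n} \<times> {1..n}. (\<lambda>(x, y, z). F x y z) p)"
  proof (rule sum_const_fibres[where g = "\<lambda>\<phi>. (\<phi> u, \<phi> v, \<phi> w)" and F = "\<lambda>(x, y, z). F x y z"])
    show "finite (V \<rightarrow>\<^sub>E {1..n})" using V by (intro finite_PiE) auto
    show "(\<lambda>\<phi>. (\<phi> u, \<phi> v, \<phi> w)) ` (V \<rightarrow>\<^sub>E {1..n}) \<subseteq> {1..n} \<times> {1..n} \<times> {1..n}" using V by auto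
    fix t assume t: "t \<in> {1..n} \<times> {1..n} \<times> {1..n}"
    define h where "h i = (if i = u then fst t else if i = v then fst (snd t) else snd (snd t))" for i
    have h: "h i \<in> {1..n}" for i using t by (auto simp: h_def)
    have "{\<phi> \<in> V \<rightarrow>\<^sub>E {1..n}. (\<phi> u, \<phi> v, \<phi> w) = t} = {\<phi> \<in> V \<rightarrow>\<^sub>E {1..n}. \<forall>i\<in>{u, v, w}. \<phi> i = h i}"
      using V by (auto simp: h_def)
    then show "card {\<phi> \<in> V \<rightarrow>\<^sub>E {1..n}. (\<phi> u, \<phi> v, \<phi> w) = t} = n ^ (card V - 3)"
      using card_PiE_fixed[of V "{u, v, w}" h n] V t h by (simp add: eval_nat_numeral)
  qed simp
  then show ?thesis by simp
qed

lemma pairsE: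
  assumes "f \<in> pairs n"
  obtains x y where "f = {x, y}" "x \<noteq> y" "x \<in> {1..n}" "y \<in> {1..n}"
  using assms unfolding pairs_def card_2_iff by auto

lemma doubleton_in_pairs: "{x, y} \<in> pairs n \<longleftrightarrow> x \<noteq> y \<and> x \<in> {1..n} \<and> y \<in> {1..n}"
  by (auto simp: pairs_def card_insert_if)

lemma sum_ordered_pairs:
  fixes G :: "nat set \<Rightarrow> real"
  shows "(\<Sum>(x, y)\<in>{1..n} \<times> {1..n}. if x \<noteq> y then G {x, y} else 0) = 2 * (\<Sum>f\<in>pairs n. G f)"
proof -
  let ?S = "{p \<in> {1..n} \<times> {1..n}. fst p \<noteq> snd p}"
  have "(\<Sum>(x, y)\<in>{1..n} \<times> {1..n}. if x \<noteq> y then G {x, y} else 0)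
      = (\<Sum>p\<in>{1..n} \<times> {1..n}. if fst p \<noteq> snd p then G {fst p, snd p} else 0)"
    by (intro sum.cong) auto
  also have "\<dots> = (\<Sum>p\<in>?S. G {fst p, snd p})" by (rule sum.inter_filter[symmetric]) simp
  also have "\<dots> = real 2 * (\<Sum>f\<in>pairs n. G f)"
  proof (rule sum_const_fibres[where g = "\<lambda>p. {fst p, snd p}" and F = G])
    show "finite ?S" by simp
    show "finite (pairs n)" by (rule finite_pairs)
    show "(\<lambda>p. {fst p, snd p}) ` ?S \<subseteq> pairs n" by (auto simp: doubleton_in_pairs)
    fix f assume "f \<in> pairs n"
    then obtain x y where f: "f = {x, y}" "x \<noteq> y" "x \<in> {1..n}" "y \<in> {1..n}" by (rule pairsE)
    then have "{p \<in> ?S. {fst p, snd p} = f} = {(x, y), (y, x)}"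
      by (auto simp: doubleton_eq_iff)
    then show "card {p \<in> ?S. {fst p, snd p} = f} = 2" using f by simp
  qed
  finally show ?thesis by simp
qed

lemma card_pairs: "real (card (pairs n)) = real n * (real n - 1) / 2"
proof -
  have "card (pairs n) = n choose 2" unfolding pairs_def using n_subsets[of "{1..n}" 2] by simp
  then show ?thesis by (cases n) (simp_all add: choose_two of_nat_diff real_of_nat_div algebra_simps)
qed

definition palette :: "('e \<times> 'c) set \<Rightarrow> 'e \<Rightarrow> 'c set" where
  "palette C f = {c. (f, c) \<in> C}"

lemma exists_below_average:
  fixes s :: "nat \<Rightarrow> nat \<Rightarrow> real"
  assumes "n > 0" "(\<Sum>x\<in>{1..n}. \<Sum>y\<in>{1..n}. s x y) \<le> b * real n ^ 2"
  shows "\<exists>x\<in>{1..n}. \<exists>y\<in>{1..n}. s x y \<le> b"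
proof (rule ccontr)
  assume "\<not> ?thesis"
  then have gt: "\<And>x y. x \<in> {1..n} \<Longrightarrow> y \<in> {1..n} \<Longrightarrow> b < s x y" by force
  have "(\<Sum>x\<in>{1..n}. \<Sum>y\<in>{1..n}. b) < (\<Sum>x\<in>{1..n}. \<Sum>y\<in>{1..n}. s x y)"
    using assms(1) gt by (intro sum_strict_mono) auto
  with assms(2) show False by (simp add: power2_eq_square mult_ac)
qed

text \<open>If almost all cherries \<open>x y, x z\<close> have equal palettes, then almost all pairs \<open>z w\<close> can be
  reached from a fixed pair \<open>x y\<close> through the path \<open>y x z w\<close>, so they all share the palette of
  \<open>x y\<close>.\<close>

lemma common_palette:
  fixes Q :: "nat set \<Rightarrow> 'c set"
  assumes n: "n \<ge> 2" and \<beta>: "2 * \<beta> < 1"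
    and cherries: "(\<Sum>x\<in>{1..n}. \<Sum>y\<in>{1..n}. \<Sum>z\<in>{1..n}.
       if Q {x, y} = Q {x, z} \<and> card (Q {x, z}) = k then 0 else 1) \<le> \<beta> * real n ^ 3"
  shows "\<exists>B\<in>range Q. card B = k \<and> real (card {f \<in> pairs n. Q f \<noteq> B}) \<le> 4 * \<beta> * real (card (pairs n))"
proof -
  let ?R = "\<lambda>x y z. if Q {x, y} = Q {x, z} \<and> card (Q {x, z}) = k then 0 else 1 :: real"
  let ?a = "\<lambda>x y. \<Sum>z\<in>{1..n}. ?R x y z"
  \<comment> \<open>This counts, for the path y x z w with x and y fixed, the choices of (z, w)
    whose first cherry fails plus those whose second cherry fails. Its sum over x and y is 2n times
    the number of failing cherries, so some x, y do no worse than average.\<close>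
  define s where "s x y = real n * ?a x y + (\<Sum>z\<in>{1..n}. ?a z x)" for x y
  have "(\<Sum>x\<in>{1..n}. \<Sum>y\<in>{1..n}. s x y) =
      real n * (\<Sum>x\<in>{1..n}. \<Sum>y\<in>{1..n}. ?a x y) + real n * (\<Sum>x\<in>{1..n}. \<Sum>z\<in>{1..n}. ?a z x)"
    unfolding s_def sum.distrib by (simp add: sum_distrib_left)
  also have "(\<Sum>x\<in>{1..n}. \<Sum>z\<in>{1..n}. ?a z x) = (\<Sum>x\<in>{1..n}. \<Sum>y\<in>{1..n}. ?a x y)"
    by (rule sum.swap)
  also have "real n * (\<Sum>x\<in>{1..n}. \<Sum>y\<in>{1..n}. ?a x y) + real n * (\<Sum>x\<in>{1..n}. \<Sum>y\<in>{1..n}. ?a x y)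
      \<le> real n * (\<beta> * real n ^ 3) + real n * (\<beta> * real n ^ 3)"
    using cherries by (intro add_mono mult_left_mono) auto
  also have "\<dots> = (2 * \<beta> * real n ^ 2) * real n ^ 2"
    by (simp add: power2_eq_square power3_eq_cube)
  finally obtain x y where xy: "x \<in> {1..n}" "y \<in> {1..n}" "s x y \<le> 2 * \<beta> * real n ^ 2"
    using exists_below_average[of n s "2 * \<beta> * real n ^ 2"] n by auto
  let ?B = "Q {x, y}"
  let ?good = "\<lambda>z w. card ?B = k \<and> Q {z, w} = ?B"
  have good: "(if ?good z w then 0 else 1) \<le> ?R x y z + ?R z x w" for z w
    by (auto simp: insert_commute)
  have "(\<Sum>z\<in>{1..n}. \<Sum>w\<in>{1..n}. if ?good z w then 0 else 1 :: real)
      \<le> (\<Sum>z\<in>{1..n}. \<Sum>w\<in>{1..n}. ?R x y z + ?R z x w)"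
    by (intro sum_mono good)
  also have "\<dots> = s x y" unfolding s_def sum.distrib by (simp add: sum_distrib_left)
  finally have bad: "(\<Sum>z\<in>{1..n}. \<Sum>w\<in>{1..n}. if ?good z w then 0 else 1 :: real) \<le> 2 * \<beta> * real n ^ 2"
    using xy(3) by linarith
  \<comment> \<open>With the wrong size every ordered pair (z, w) would be bad, more than the bound
    with 2\<beta> < 1 permits.\<close>
  have k: "card ?B = k"
  proof (rule ccontr)
    assume "card ?B \<noteq> k"
    then have "real n ^ 2 \<le> 2 * \<beta> * real n ^ 2" using bad by (simp add: power2_eq_square)
    then show False using \<beta> n by simp
  qed
  have "2 * real (card {f \<in> pairs n. Q f \<noteq> ?B}) = 2 * (\<Sum>f\<in>pairs n. if Q f \<noteq> ?B then 1 else 0)"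
    using finite_pairs by (simp flip: sum.inter_filter)
  also have "\<dots> = (\<Sum>(z, w)\<in>{1..n} \<times> {1..n}. if z \<noteq> w then if Q {z, w} \<noteq> ?B then 1 else 0 else 0)"
    by (rule sum_ordered_pairs[symmetric])
  also have "\<dots> \<le> (\<Sum>(z, w)\<in>{1..n} \<times> {1..n}. if ?good z w then 0 else 1)"
    using k by (intro sum_mono) auto
  also have "\<dots> = (\<Sum>z\<in>{1..n}. \<Sum>w\<in>{1..n}. if ?good z w then 0 else 1)"
    by (rule sum.cartesian_product[symmetric])
  also note bad
  finally have le: "real (card {f \<in> pairs n. Q f \<noteq> ?B}) \<le> \<beta> * real n ^ 2" by simp
  have "0 \<le> \<beta> * real n ^ 2" using le by linarith
  then have "0 \<le> \<beta>" using n by (simp add: zero_le_mult_iff)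
  moreover have "real n ^ 2 \<le> 4 * real (card (pairs n))"
    using n unfolding card_pairs by (simp add: power2_eq_square algebra_simps)
  ultimately have "\<beta> * real n ^ 2 \<le> \<beta> * (4 * real (card (pairs n)))" by (intro mult_left_mono)
  with le k show ?thesis by (intro bexI[of _ ?B]) auto
qed

lemma card_non_injective:
  assumes V: "finite V" "card V \<ge> 2"
  shows "real (card {\<phi> \<in> V \<rightarrow>\<^sub>E {1..n}. \<not> inj_on \<phi> V}) \<le> real (card V) ^ 2 * real n ^ (card V - 1)"
proof -
  let ?P = "{p \<in> V \<times> V. fst p \<noteq> snd p}"
  let ?A = "\<lambda>p. {\<phi> \<in> V \<rightarrow>\<^sub>E {1..n}. \<phi> (fst p) = \<phi> (snd p)}"
  have finPiE: "finite (V \<rightarrow>\<^sub>E {1..n})" using V by (intro finite_PiE) auto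
  have one: "real (card (?A p)) = real n ^ (card V - 1)" if p: "p \<in> ?P" for p
  proof -
    have "real (card (?A p)) = (\<Sum>\<phi>\<in>V \<rightarrow>\<^sub>E {1..n}. if \<phi> (fst p) = \<phi> (snd p) then 1 else 0)"
      using finPiE by (simp flip: sum.inter_filter)
    also have "\<dots> = real n ^ (card V - 2) * (\<Sum>(x, y)\<in>{1..n} \<times> {1..n}. if x = y then 1 else 0)"
      using p V by (intro sum_PiE_two) auto
    also have "(\<Sum>(x, y)\<in>{1..n} \<times> {1..n}. if x = y then 1 else 0) = (\<Sum>x\<in>{1..n}. \<Sum>y\<in>{1..n}. if x = y then 1 else 0 :: real)"
      by (rule sum.cartesian_product[symmetric])
    also have "\<dots> = real n" by (simp add: sum.delta)
    also have "real n ^ (card V - 2) * real n = real n ^ (card V - 1)"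
      using V(2) by (simp add: power_Suc2[symmetric] Suc_diff_Suc numeral_2_eq_2 del: power_Suc)
    finally show ?thesis .
  qed
  have "{\<phi> \<in> V \<rightarrow>\<^sub>E {1..n}. \<not> inj_on \<phi> V} \<subseteq> (\<Union>p\<in>?P. ?A p)" by (fastforce simp: inj_on_def)
  then have "card {\<phi> \<in> V \<rightarrow>\<^sub>E {1..n}. \<not> inj_on \<phi> V} \<le> card (\<Union>p\<in>?P. ?A p)"
    using V finPiE by (intro card_mono) auto
  also have "\<dots> \<le> (\<Sum>p\<in>?P. card (?A p))" using V by (intro card_UN_le) auto
  finally have "real (card {\<phi> \<in> V \<rightarrow>\<^sub>E {1..n}. \<not> inj_on \<phi> V}) \<le> (\<Sum>p\<in>?P. real (card (?A p)))"
    by (simp flip: of_nat_sum)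
  also have "\<dots> = real (card ?P) * real n ^ (card V - 1)" using one by simp
  also have "\<dots> \<le> real (card V) ^ 2 * real n ^ (card V - 1)"
  proof (rule mult_right_mono)
    have "card ?P \<le> card (V \<times> V)" using V by (intro card_mono) auto
    then show "real (card ?P) \<le> real (card V) ^ 2"
      by (simp add: card_cartesian_product power2_eq_square flip: of_nat_mult)
  qed simp
  finally show ?thesis .
qed

lemma palette_subset: "C \<subseteq> D \<times> L \<Longrightarrow> palette C f \<subseteq> L"
  by (auto simp: palette_def)

section \<open>One container: small scores or a common palette\<close>

context
  fixes H :: "'a sgraph" and l n :: nat and C :: "(nat set \<times> nat) set" and \<kappa> :: real
  assumes H: "simple_graph H" "non_matching H" and m3: "num_edges H \<ge> 3"
    and ml: "num_edges H \<le> l" and n: "n \<ge> 2"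
    and C: "C \<subseteq> pairs n \<times> {1..l}"
    and gap: "\<And>P. (\<forall>e\<in>edges H. P e \<subseteq> {1..l}) \<Longrightarrow> (\<nexists>\<psi>. transversal P (edges H) \<psi>) \<Longrightarrow>
     (\<nexists>B. card B = num_edges H - 1 \<and> (\<forall>e\<in>edges H. P e = B)) \<Longrightarrow>
     (\<Sum>e\<in>edges H. score (real (num_edges H) * ln (real l)) (P e))
       \<le> real (num_edges H) * ln (real (num_edges H) - 1) - \<kappa>"
    and \<kappa>: "\<kappa> > 0"
begin

private abbreviation (input) "m \<equiv> num_edges H"
private abbreviation (input) "v \<equiv> num_verts H"
private abbreviation (input) "sc \<equiv> score (real m * ln (real l))"
private abbreviation (input) "pal \<phi> \<equiv> \<lambda>e. palette C (\<phi> ` e)"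
text \<open>A map outside \<open>exc\<close> admits no transversal and is then of one of two kinds:
  either all its edges carry one common palette of m - 1 colours, or it lies in \<open>bad\<close>
  and its total score falls short by \<kappa>. The maps in \<open>exc\<close> are few and receive
  only the trivial bound.\<close>

private definition "\<Phi> = verts H \<rightarrow>\<^sub>E {1..n}"
private definition "transv = {\<phi> \<in> \<Phi>. inj_on \<phi> (verts H) \<and> (\<exists>\<psi>. transversal (pal \<phi>) (edges H) \<psi>)}"
private definition "exc = {\<phi> \<in> \<Phi>. \<not> inj_on \<phi> (verts H)} \<union> transv"
private definition "const \<phi> \<longleftrightarrow> (\<exists>B. card B = m - 1 \<and> (\<forall>e\<in>edges H. pal \<phi> e = B))"
private definition "bad = {\<phi> \<in> \<Phi> - exc. \<not> const \<phi>}"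

private lemma finV: "finite (verts H)" and finE: "finite (edges H)" and fin\<Phi>: "finite \<Phi>"
  using H finite_edges[OF H(1)] unfolding \<Phi>_def simple_graph_def by (auto intro: finite_PiE)

private lemma v3: "v \<ge> 3" by (rule num_verts_ge_3[OF H])

private lemma fin_palette: "finite (palette C f)"
  using palette_subset[OF C] finite_subset by blast

text \<open>A transversal turns the vertex map into a rainbow embedding inside \<open>C\<close>, and
  these are limited by the small weight of the container.\<close>

private lemma card_transv:
  assumes "wtot (rainbow_weight H l n) C \<le> \<alpha> * real (card (pairs n \<times> {1..l}))" "\<alpha> \<ge> 0"
  shows "real (card transv) \<le> \<alpha> * real l * real n ^ v"
proof -
  let ?X = "{x \<in> rainbow_embeddings H l n. coloured_image H x \<subseteq> C}"
  have finX: "finite ?X" using finite_rainbow_embeddings[OF H(1)] by simp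
  have "transv \<subseteq> fst ` ?X"
  proof
    fix \<phi> assume "\<phi> \<in> transv"
    then obtain \<psi> where \<phi>: "\<phi> \<in> \<Phi>" "inj_on \<phi> (verts H)" and \<psi>: "transversal (pal \<phi>) (edges H) \<psi>"
      by (auto simp: transv_def)
    have "\<psi> e \<in> {1..l}" if "e \<in> edges H" for e
      using \<psi> that palette_subset[OF C, of "\<phi> ` e"] by (auto simp: transversal_def)
    then have "(\<phi>, restrict \<psi> (edges H)) \<in> rainbow_embeddings H l n"
      using \<phi> \<psi> by (auto simp: rainbow_embeddings_def \<Phi>_def transversal_def inj_on_def)
    moreover have "coloured_image H (\<phi>, restrict \<psi> (edges H)) \<subseteq> C"
      using \<psi> by (auto simp: coloured_image_def transversal_def palette_def)
    ultimately show "\<phi> \<in> fst ` ?X" by (intro image_eqI[of _ _ "(\<phi>, restrict \<psi> (edges H))"]) auto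
  qed
  then have "card transv \<le> card ?X"
    using finX by (meson card_image_le card_mono finite_imageI le_trans)
  have fC: "finite C" using C finite_pairs by (metis finite_SigmaI finite_atLeastAtMost finite_subset)
  have "wtot (rainbow_weight H l n) C = wdeg (rainbow_weight H l n) C {}"
    by (simp add: wtot_def wdeg_def Pow_def)
  also have "\<dots> = real (card ?X) / real n ^ (v - 2)"
    unfolding wdeg_rainbow_weight[OF H(1) fC] by simp
  finally have "real (card ?X) = wtot (rainbow_weight H l n) C * real n ^ (v - 2)"
    using n by simp
  also have "\<dots> \<le> \<alpha> * real (card (pairs n \<times> {1..l})) * real n ^ (v - 2)"
    using assms(1) by (intro mult_right_mono) auto
  also have "\<dots> \<le> \<alpha> * (real n ^ 2 * real l) * real n ^ (v - 2)"
  proof (intro mult_right_mono mult_left_mono assms(2))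
    have "real (card (pairs n)) \<le> real n ^ 2"
      using n unfolding card_pairs by (simp add: power2_eq_square field_simps)
    then show "real (card (pairs n \<times> {1..l})) \<le> real n ^ 2 * real l"
      by (simp add: card_cartesian_product mult_right_mono)
  qed simp
  also have "\<dots> = \<alpha> * real l * (real n ^ 2 * real n ^ (v - 2))" by (simp add: mult_ac)
  also have "real n ^ 2 * real n ^ (v - 2) = real n ^ v"
  proof -
    have "v = 2 + (v - 2)" using v3 by simp
    then show ?thesis by (metis power_add)
  qed
  finally show ?thesis using \<open>card transv \<le> card ?X\<close> by linarith
qed

lemma card_exc:
  assumes "wtot (rainbow_weight H l n) C \<le> \<alpha> * real (card (pairs n \<times> {1..l}))" "\<alpha> \<ge> 0"
  shows "real (card exc) \<le> (real v ^ 2 / real n + \<alpha> * real l) * real n ^ v"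
proof -
  have "card exc \<le> card {\<phi> \<in> \<Phi>. \<not> inj_on \<phi> (verts H)} + card transv"
    unfolding exc_def by (rule card_Un_le)
  then have "real (card exc) \<le> real (card {\<phi> \<in> \<Phi>. \<not> inj_on \<phi> (verts H)}) + real (card transv)"
    by linarith
  also have "\<dots> \<le> real v ^ 2 * real n ^ (v - 1) + \<alpha> * real l * real n ^ v"
    using card_non_injective[OF finV, of n] v3 card_transv[OF assms]
    by (intro add_mono) (auto simp: \<Phi>_def num_verts_def)
  also have "real n ^ (v - 1) = real n ^ v / real n"
    using v3 n by (simp add: power_diff)
  finally show ?thesis by (simp add: algebra_simps)
qed

private lemma edge_image:
  assumes "\<phi> \<in> \<Phi>" "inj_on \<phi> (verts H)" "e \<in> edges H"
  shows "\<phi> ` e \<in> pairs n"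
proof -
  have e: "e \<subseteq> verts H" "card e = 2" using assms(3) H(1) by (auto simp: simple_graph_def)
  then show ?thesis
    using assms(1) inj_on_subset[OF assms(2) e(1)] by (auto simp: pairs_def card_image \<Phi>_def)
qed

private lemma sc_le: "sc (palette C f) \<le> ln (real l)"
proof (rule score_le[OF fin_palette])
  show "card (palette C f) \<le> l" using card_mono[OF _ palette_subset[OF C, of f]] by simp
qed (use m3 ml in auto)

text \<open>Extension by 0 to the singletons that arise when a map identifies the two ends of an
  edge, so that summation over all maps stays exact.\<close>

private definition "Y f = (if f \<in> pairs n then sc (palette C f) else 0)"

private lemma Y_le: "Y f \<le> ln (real l)"
  using sc_le m3 ml by (auto simp: Y_def)

text \<open>The scores of all edge images are counted in two ways. By edges, each edge of
  \<open>H\<close> is mapped onto each pair by 2 n^(v - 2) maps. By maps, each contributes at most m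
  ln (m - 1), less by \<kappa> for \<open>bad\<close> maps, with m ln l allowed as an error for
  \<open>exc\<close>.\<close>

lemma score_average:
  "2 * real m * real n ^ (v - 2) * (\<Sum>f\<in>pairs n. sc (palette C f))
     \<le> real n ^ v * (real m * ln (real m - 1)) - \<kappa> * real (card bad) + real (card exc) * (real m * ln (real l))"
proof -
  let ?h = "\<lambda>\<phi>. \<Sum>e\<in>edges H. Y (\<phi> ` e)"
  have "(\<Sum>\<phi>\<in>\<Phi>. ?h \<phi>) = (\<Sum>e\<in>edges H. \<Sum>\<phi>\<in>\<Phi>. Y (\<phi> ` e))" by (rule sum.swap)
  also have "\<dots> = (\<Sum>e\<in>edges H. real n ^ (v - 2) * (2 * (\<Sum>f\<in>pairs n. sc (palette C f))))"
  proof (rule sum.cong[OF refl])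
    fix e assume e: "e \<in> edges H"
    then have "card e = 2" "e \<subseteq> verts H" using H(1) by (auto simp: simple_graph_def)
    then obtain u w where uw: "e = {u, w}" "u \<noteq> w" "u \<in> verts H" "w \<in> verts H"
      by (auto simp: card_2_iff)
    have "(\<Sum>\<phi>\<in>\<Phi>. Y (\<phi> ` e)) = (\<Sum>\<phi>\<in>\<Phi>. (\<lambda>x y. Y {x, y}) (\<phi> u) (\<phi> w))"
      by (simp add: uw)
    also have "\<dots> = real n ^ (v - 2) * (\<Sum>(x, y)\<in>{1..n} \<times> {1..n}. Y {x, y})"
      unfolding \<Phi>_def num_verts_def by (rule sum_PiE_two[OF finV uw(3,4,2)])
    also have "(\<Sum>(x, y)\<in>{1..n} \<times> {1..n}. Y {x, y}) =
        (\<Sum>(x, y)\<in>{1..n} \<times> {1..n}. if x \<noteq> y then sc (palette C {x, y}) else 0)"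
      by (intro sum.cong) (auto simp: Y_def doubleton_in_pairs)
    also have "\<dots> = 2 * (\<Sum>f\<in>pairs n. sc (palette C f))" by (rule sum_ordered_pairs)
    finally show "(\<Sum>\<phi>\<in>\<Phi>. Y (\<phi> ` e)) = real n ^ (v - 2) * (2 * (\<Sum>f\<in>pairs n. sc (palette C f)))" .
  qed
  also have "\<dots> = 2 * real m * real n ^ (v - 2) * (\<Sum>f\<in>pairs n. sc (palette C f))"
    by (simp add: num_edges_def)
  finally have avg: "2 * real m * real n ^ (v - 2) * (\<Sum>f\<in>pairs n. sc (palette C f)) = (\<Sum>\<phi>\<in>\<Phi>. ?h \<phi>)" by simp
  let ?b = "real m * ln (real m - 1)"
  have b0: "?b \<ge> 0" using m3 by simp
  have point: "?h \<phi> \<le> ?b - \<kappa> * (if \<phi> \<in> bad then 1 else 0) + (real m * ln (real l)) * (if \<phi> \<in> exc then 1 else 0)"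
    if \<phi>: "\<phi> \<in> \<Phi>" for \<phi>
  proof (cases "\<phi> \<in> exc")
    case True
    have "?h \<phi> \<le> (\<Sum>e\<in>edges H. ln (real l))" by (intro sum_mono Y_le)
    also have "\<dots> = real m * ln (real l)" by (simp add: num_edges_def)
    finally show ?thesis using True b0 by (simp add: bad_def)
  next
    case False
    then have inj: "inj_on \<phi> (verts H)" and no: "\<nexists>\<psi>. transversal (pal \<phi>) (edges H) \<psi>"
      using \<phi> by (auto simp: exc_def transv_def)
    have h: "?h \<phi> = (\<Sum>e\<in>edges H. sc (pal \<phi> e))"
      using edge_image[OF \<phi> inj] by (intro sum.cong) (auto simp: Y_def)
    show ?thesis
    proof (cases "const \<phi>")
      case True
      then obtain B where B: "card B = m - 1" "\<And>e. e \<in> edges H \<Longrightarrow> pal \<phi> e = B"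
        by (auto simp: const_def)
      have "B \<noteq> {}" using B(1) m3 by auto
      then have "?h \<phi> = (\<Sum>e\<in>edges H. ln (real m - 1))"
        unfolding h using B m3 by (intro sum.cong) (auto simp: score_def of_nat_diff)
      then show ?thesis using False True by (simp add: bad_def num_edges_def)
    next
      case nc: False
      have "?h \<phi> \<le> ?b - \<kappa>"
        unfolding h using no nc palette_subset[OF C] by (intro gap) (auto simp: const_def)
      then show ?thesis using False nc \<phi> by (simp add: bad_def)
    qed
  qed
  have "(\<Sum>\<phi>\<in>\<Phi>. ?h \<phi>) \<le> (\<Sum>\<phi>\<in>\<Phi>. ?b - \<kappa> * (if \<phi> \<in> bad then 1 else 0) + (real m * ln (real l)) * (if \<phi> \<in> exc then 1 else 0))"
    by (intro sum_mono point)
  also have "\<dots> = real (card \<Phi>) * ?b - \<kappa> * (\<Sum>\<phi>\<in>\<Phi>. if \<phi> \<in> bad then 1 else 0) + (real m * ln (real l)) * (\<Sum>\<phi>\<in>\<Phi>. if \<phi> \<in> exc then 1 else 0)"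
    by (simp add: sum.distrib sum_subtractf sum_distrib_left)
  also have "(\<Sum>\<phi>\<in>\<Phi>. if \<phi> \<in> bad then 1 else 0 :: real) = real (card bad)"
  proof -
    have "{\<phi> \<in> \<Phi>. \<phi> \<in> bad} = bad" by (auto simp: bad_def)
    then show ?thesis using fin\<Phi> by (simp flip: sum.inter_filter)
  qed
  also have "(\<Sum>\<phi>\<in>\<Phi>. if \<phi> \<in> exc then 1 else 0 :: real) = real (card exc)"
  proof -
    have "{\<phi> \<in> \<Phi>. \<phi> \<in> exc} = exc" by (auto simp: exc_def transv_def)
    then show ?thesis using fin\<Phi> by (simp flip: sum.inter_filter)
  qed
  also have "card \<Phi> = n ^ v" unfolding \<Phi>_def using finV by (simp add: card_PiE num_verts_def)
  finally show ?thesis using avg by (simp add: mult.commute)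
qed

text \<open>Here \<open>H\<close> being non-matching enters: two adjacent edges of \<open>H\<close>
  transport equality of palettes to cherries of the host graph. A failing cherry extends to n^(v -
  3) maps, all of them in \<open>bad\<close> or \<open>exc\<close>.\<close>

lemma cherry_count:
  "(\<Sum>x\<in>{1..n}. \<Sum>y\<in>{1..n}. \<Sum>z\<in>{1..n}.
       if palette C {x, y} = palette C {x, z} \<and> card (palette C {x, z}) = m - 1 then 0 else 1) * real n ^ (v - 3)
    \<le> real (card bad) + real (card exc)"
proof -
  obtain a b c where e: "{a, b} \<in> edges H" "{a, c} \<in> edges H" and ne: "a \<noteq> b" "a \<noteq> c" "b \<noteq> c"
    using adjacent_edges[OF H] by blast
  have abc: "a \<in> verts H" "b \<in> verts H" "c \<in> verts H" using e H(1) by (auto simp: simple_graph_def)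
  let ?R = "\<lambda>x y z. if palette C {x, y} = palette C {x, z} \<and> card (palette C {x, z}) = m - 1 then 0 else 1 :: real"
  have "(\<Sum>x\<in>{1..n}. \<Sum>y\<in>{1..n}. \<Sum>z\<in>{1..n}. ?R x y z) * real n ^ (v - 3)
      = real n ^ (v - 3) * (\<Sum>(x, y, z)\<in>{1..n} \<times> {1..n} \<times> {1..n}. ?R x y z)"
    by (simp add: sum.cartesian_product mult.commute case_prod_unfold)
  also have "\<dots> = (\<Sum>\<phi>\<in>\<Phi>. ?R (\<phi> a) (\<phi> b) (\<phi> c))"
    unfolding \<Phi>_def num_verts_def by (rule sum_PiE_three[OF finV abc ne, symmetric])
  also have "\<dots> \<le> (\<Sum>\<phi>\<in>\<Phi>. if \<phi> \<in> bad \<union> exc then 1 else 0)"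
  proof (rule sum_mono)
    fix \<phi> assume \<phi>: "\<phi> \<in> \<Phi>"
    show "?R (\<phi> a) (\<phi> b) (\<phi> c) \<le> (if \<phi> \<in> bad \<union> exc then 1 else 0)"
    proof (cases "\<phi> \<in> bad \<union> exc")
      case False
      then have "const \<phi>" using \<phi> by (auto simp: bad_def)
      then obtain B where "card B = m - 1" "pal \<phi> {a, b} = B" "pal \<phi> {a, c} = B"
        using e unfolding const_def by blast
      then show ?thesis by simp
    qed simp
  qed
  also have "\<dots> = real (card (bad \<union> exc))"
  proof -
    have "{\<phi> \<in> \<Phi>. \<phi> \<in> bad \<union> exc} = bad \<union> exc" by (auto simp: bad_def exc_def transv_def)
    then show ?thesis using fin\<Phi> by (simp flip: sum.inter_filter)
  qed
  also have "\<dots> \<le> real (card bad) + real (card exc)"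
    using card_Un_le[of bad exc] by linarith
  finally show ?thesis .
qed

text \<open>If at least \<beta> n^v maps are \<open>bad\<close>, the mean score drops by
  \<kappa>\<beta>/m, of which \<open>exc\<close> can give back at most half by the second smallness
  condition. Otherwise at most 2\<beta> n^v maps are \<open>bad\<close> or exceptional, so at most
  2\<beta> n^3 cherries fail, and a common palette follows with error 8\<beta>.\<close>

lemma score_or_common_palette:
  assumes w: "wtot (rainbow_weight H l n) C \<le> \<alpha> * real (card (pairs n \<times> {1..l}))" and \<alpha>: "\<alpha> \<ge> 0"
    and \<beta>: "0 \<le> \<beta>" "\<beta> < 1 / 4"
    and e1: "real v ^ 2 / real n + \<alpha> * real l \<le> \<beta>"
    and e2: "(real v ^ 2 / real n + \<alpha> * real l) * ln (real l) \<le> \<kappa> * \<beta> / (2 * real m)"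
    and e3: "ln (real m - 1) \<le> real n * (\<kappa> * \<beta> / (4 * real m))"
  shows "(\<Sum>f\<in>pairs n. sc (palette C f)) \<le> (ln (real m - 1) - \<kappa> * \<beta> / (4 * real m)) * real (card (pairs n)) \<or>
    (\<exists>B. B \<subseteq> {1..l} \<and> card B = m - 1 \<and>
         real (card {f \<in> pairs n. palette C f \<noteq> B}) \<le> 8 * \<beta> * real (card (pairs n)))"
proof -
  define \<rho> where "\<rho> = real v ^ 2 / real n + \<alpha> * real l"
  note exc = card_exc[OF w \<alpha>, folded \<rho>_def]
  have m0: "real m > 0" and n0: "real n > 0" using m3 n by auto
  show ?thesis
  proof (cases "\<beta> * real n ^ v \<le> real (card bad)")
    case True
    let ?s = "\<Sum>f\<in>pairs n. sc (palette C f)"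
    let ?\<eta> = "\<kappa> * \<beta> / (4 * real m)"
    have nv: "real n ^ v = real n ^ (v - 2) * real n ^ 2"
    proof -
      have "v = (v - 2) + 2" using v3 by simp
      then show ?thesis by (metis power_add)
    qed
    have "2 * real m * real n ^ (v - 2) * ?s
        \<le> real n ^ v * (real m * ln (real m - 1)) - \<kappa> * (\<beta> * real n ^ v) + (\<rho> * real n ^ v) * (real m * ln (real l))"
    proof -
      have "\<kappa> * (\<beta> * real n ^ v) \<le> \<kappa> * real (card bad)" using True \<kappa> by (intro mult_left_mono) auto
      moreover have "real (card exc) * (real m * ln (real l)) \<le> (\<rho> * real n ^ v) * (real m * ln (real l))"
        using exc m3 ml by (intro mult_right_mono) auto
      ultimately show ?thesis using score_average by linarith
    qed
    also have "\<dots> = real n ^ (v - 2) * real m * (real n ^ 2 * (ln (real m - 1) - \<kappa> * \<beta> / real m + \<rho> * ln (real l)))"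
      using m0 by (simp add: nv algebra_simps)
    finally have "(real n ^ (v - 2) * real m) * (2 * ?s)
        \<le> (real n ^ (v - 2) * real m) * (real n ^ 2 * (ln (real m - 1) - \<kappa> * \<beta> / real m + \<rho> * ln (real l)))"
      by (simp add: mult_ac)
    then have "2 * ?s \<le> real n ^ 2 * (ln (real m - 1) - \<kappa> * \<beta> / real m + \<rho> * ln (real l))"
      using m0 n0 by (simp only: mult_le_cancel_left_pos zero_less_power mult_pos_pos)
    also have "\<dots> \<le> real n ^ 2 * (ln (real m - 1) - 2 * ?\<eta>)"
      using e2 by (intro mult_left_mono) (auto simp: \<rho>_def field_simps)
    also have "\<dots> = real n * (real n * (ln (real m - 1) - ?\<eta>) - real n * ?\<eta>)"
      by (simp add: power2_eq_square algebra_simps)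
    \<comment> \<open>Half of the remaining gain is spent on replacing n^2 / 2 by the exact number n
      (n - 1) / 2 of pairs; this is why n must be large against ln (m - 1) / \<eta>.\<close>
    also have "\<dots> \<le> real n * (real n * (ln (real m - 1) - ?\<eta>) - (ln (real m - 1) - ?\<eta>))"
    proof -
      have "0 \<le> ?\<eta>" using \<kappa> \<beta> by simp
      then show ?thesis using e3 n0 by (intro mult_left_mono) auto
    qed
    also have "\<dots> = 2 * ((ln (real m - 1) - ?\<eta>) * real (card (pairs n)))"
    proof -
      have "t * (t * x - x) = 2 * (x * (t * (t - 1) / 2))" for t x :: real by (simp add: algebra_simps)
      then show ?thesis unfolding card_pairs .
    qed
    finally show ?thesis by simp
  next
    case False
    let ?c = "\<Sum>x\<in>{1..n}. \<Sum>y\<in>{1..n}. \<Sum>z\<in>{1..n}.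
       if palette C {x, y} = palette C {x, z} \<and> card (palette C {x, z}) = m - 1 then 0 else 1 :: real"
    have "?c * real n ^ (v - 3) \<le> real (card bad) + real (card exc)" by (rule cherry_count)
    also have "\<dots> \<le> \<beta> * real n ^ v + \<rho> * real n ^ v" using False exc by linarith
    also have "\<dots> \<le> (2 * \<beta>) * real n ^ v"
      using mult_right_mono[OF e1, of "real n ^ v"] by (simp add: \<rho>_def)
    also have "real n ^ v = real n ^ 3 * real n ^ (v - 3)"
      by (subst power_add[symmetric]) (use v3 in simp)
    finally have "?c * real n ^ (v - 3) \<le> (2 * \<beta> * real n ^ 3) * real n ^ (v - 3)" by (simp add: mult_ac)
    then have "?c \<le> 2 * \<beta> * real n ^ 3"
      using n0 by (simp only: mult_le_cancel_right_pos zero_less_power)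
    then obtain B where B: "B \<in> range (palette C)" "card B = m - 1"
      "real (card {f \<in> pairs n. palette C f \<noteq> B}) \<le> 4 * (2 * \<beta>) * real (card (pairs n))"
      using common_palette[OF n, of "2 * \<beta>" "palette C" "m - 1"] \<beta> by auto
    have "B \<subseteq> {1..l}" using B(1) palette_subset[OF C] by auto
    with B show ?thesis by auto
  qed
qed

end

lemma container_stability:
  fixes H :: "'a sgraph"
  assumes H: "simple_graph H" "non_matching H" and m: "num_edges H \<ge> 3"
    and ml: "num_edges H \<le> l"
    and l: "(real (num_edges H) - 2) * ln (real l) < real (num_edges H) * ln (real (num_edges H) - 1)"
    and \<epsilon>: "\<epsilon> > 0"
  shows "\<exists>\<alpha>>0. \<exists>\<eta>>0. \<exists>n0. \<forall>n\<ge>n0. \<forall>C. C \<subseteq> pairs n \<times> {1..l} \<longrightarrow>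
    wtot (rainbow_weight H l n) C \<le> \<alpha> * real (card (pairs n \<times> {1..l})) \<longrightarrow>
    (\<Sum>f\<in>pairs n. score (real (num_edges H) * ln (real l)) (palette C f))
        \<le> (ln (real (num_edges H) - 1) - \<eta>) * real (card (pairs n)) \<or>
    (\<exists>B. B \<subseteq> {1..l} \<and> card B = num_edges H - 1 \<and>
         real (card {f \<in> pairs n. palette C f \<noteq> B}) \<le> \<epsilon> * real (card (pairs n)))"
proof -
  let ?m = "real (num_edges H)" and ?v = "real (num_verts H)"
  obtain \<kappa> where \<kappa>: "\<kappa> > 0" and gap: "\<And>P. (\<forall>e\<in>edges H. P e \<subseteq> {1..l}) \<Longrightarrow>
     (\<nexists>\<psi>. transversal P (edges H) \<psi>) \<Longrightarrow>
     (\<nexists>B. card B = num_edges H - 1 \<and> (\<forall>e\<in>edges H. P e = B)) \<Longrightarrow>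
     (\<Sum>e\<in>edges H. score (?m * ln (real l)) (P e)) \<le> ?m * ln (?m - 1) - \<kappa>"
    using sum_score_gap[OF finite_edges[OF H(1)] num_edges_def[symmetric] m ml l] by blast
  define \<beta> where "\<beta> = min \<epsilon> 1 / 8"
  have \<beta>: "\<beta> > 0" "\<beta> < 1 / 4" "8 * \<beta> \<le> \<epsilon>" using \<epsilon> by (auto simp: \<beta>_def)
  \<comment> \<open>\<rho> is the admissible proportion of exceptional maps. Half of it is left to
    the container weight through \<alpha>, the other half to non-injective maps through
    \<open>n2\<close>.\<close>
  define \<rho> where "\<rho> = min \<beta> (\<kappa> * \<beta> / (2 * ?m) / ln (real l))"
  have lnl: "ln (real l) > 0" and l0: "real l > 0" and m0: "?m > 0" using m ml by auto
  have \<rho>: "\<rho> > 0" using \<beta> \<kappa> lnl m0 by (simp add: \<rho>_def)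
  define \<alpha> where "\<alpha> = \<rho> / (2 * real l)"
  have \<alpha>: "\<alpha> > 0" using \<rho> l0 by (simp add: \<alpha>_def)
  define \<eta> where "\<eta> = \<kappa> * \<beta> / (4 * ?m)"
  have \<eta>: "\<eta> > 0" using \<kappa> \<beta> m0 by (simp add: \<eta>_def)
  obtain n1 :: nat where n1: "ln (?m - 1) / \<eta> \<le> real n1" using real_arch_simple by blast
  obtain n2 :: nat where n2: "2 * ?v ^ 2 / \<rho> \<le> real n2" using real_arch_simple by blast
  show ?thesis
  proof (rule exI[of _ \<alpha>], rule conjI[OF \<alpha>], rule exI[of _ \<eta>], rule conjI[OF \<eta>],
      rule exI[of _ "max 2 (max n1 n2)"], intro allI impI)
    fix n C assume n: "max 2 (max n1 n2) \<le> n" and C: "C \<subseteq> pairs n \<times> {1..l}"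
      and w: "wtot (rainbow_weight H l n) C \<le> \<alpha> * real (card (pairs n \<times> {1..l}))"
    have n': "n \<ge> 2" "real n1 \<le> real n" "real n2 \<le> real n" using n by auto
    have "2 * ?v ^ 2 / \<rho> \<le> real n" using n2 n'(3) by linarith
    then have "?v ^ 2 / real n \<le> \<rho> / 2" using n'(1) \<rho> by (simp add: field_simps)
    moreover have "\<alpha> * real l = \<rho> / 2" using l0 by (simp add: \<alpha>_def)
    ultimately have r: "?v ^ 2 / real n + \<alpha> * real l \<le> \<rho>" by linarith
    have "ln (?m - 1) / \<eta> \<le> real n" using n1 n'(2) by linarith
    then have e3: "ln (?m - 1) \<le> real n * \<eta>" using \<eta> by (simp add: divide_le_eq)
    have e2: "(?v ^ 2 / real n + \<alpha> * real l) * ln (real l) \<le> \<kappa> * \<beta> / (2 * ?m)"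
    proof -
      have "(?v ^ 2 / real n + \<alpha> * real l) * ln (real l) \<le> (\<kappa> * \<beta> / (2 * ?m) / ln (real l)) * ln (real l)"
        using r lnl by (intro mult_right_mono) (auto simp: \<rho>_def)
      then show ?thesis using lnl by simp
    qed
    have e1: "?v ^ 2 / real n + \<alpha> * real l \<le> \<beta>" using r by (simp add: \<rho>_def)
    from score_or_common_palette[OF H m ml n'(1) C gap \<kappa> w _ _ \<beta>(2) e1 e2 e3[unfolded \<eta>_def]]
    consider "(\<Sum>f\<in>pairs n. score (?m * ln (real l)) (palette C f)) \<le> (ln (?m - 1) - \<eta>) * real (card (pairs n))"
      | B where "B \<subseteq> {1..l}" "card B = num_edges H - 1"
         "real (card {f \<in> pairs n. palette C f \<noteq> B}) \<le> 8 * \<beta> * real (card (pairs n))"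
      using \<alpha> \<beta> unfolding \<eta>_def by force
    then show "(\<Sum>f\<in>pairs n. score (?m * ln (real l)) (palette C f)) \<le> (ln (?m - 1) - \<eta>) * real (card (pairs n)) \<or>
      (\<exists>B. B \<subseteq> {1..l} \<and> card B = num_edges H - 1 \<and>
         real (card {f \<in> pairs n. palette C f \<noteq> B}) \<le> \<epsilon> * real (card (pairs n)))"
    proof cases
      case 2
      have "8 * \<beta> * real (card (pairs n)) \<le> \<epsilon> * real (card (pairs n))"
        using \<beta>(3) by (intro mult_right_mono) auto
      with 2 show ?thesis by (meson order_trans)
    qed blast
  qed
qed

subsection \<open>Colourings of the random graph\<close>

lemma card_PiE_le_exp_score:
  assumes "finite E" "\<And>e. e \<in> E \<Longrightarrow> finite (P e)"
  shows "real (card (PiE E P)) \<le> exp (\<Sum>e\<in>E. score L (P e))"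
proof -
  have "real (card (PiE E P)) = (\<Prod>e\<in>E. real (card (P e)))" using assms(1) by (simp add: card_PiE)
  also have "\<dots> \<le> (\<Prod>e\<in>E. exp (score L (P e)))"
  proof (rule prod_mono)
    fix e assume e: "e \<in> E"
    show "0 \<le> real (card (P e)) \<and> real (card (P e)) \<le> exp (score L (P e))"
    proof (cases "P e = {}")
      case False
      then have "card (P e) > 0" using assms(2)[OF e] by (simp add: card_gt_0_iff)
      then show ?thesis using False by (simp add: score_def)
    qed simp
  qed
  also have "\<dots> = exp (\<Sum>e\<in>E. score L (P e))" using assms(1) by (simp add: exp_sum)
  finally show ?thesis .
qed

lemma colour_dist_le:
  assumes "B \<subseteq> {1..l}" "card B = k"
  shows "colour_dist k l G c \<le> card {e \<in> edges G. c e \<notin> B}"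
proof -
  have "{card {e \<in> edges G. c e \<notin> B} | B. B \<subseteq> {1..l} \<and> card B = k}
      \<subseteq> (\<lambda>B. card {e \<in> edges G. c e \<notin> B}) ` Pow {1..l}" by auto
  then have "finite {card {e \<in> edges G. c e \<notin> B} | B. B \<subseteq> {1..l} \<and> card B = k}"
    by (rule finite_subset) simp
  then show ?thesis unfolding colour_dist_def using assms by (intro Min_le) auto
qed

text \<open>A far colouring excludes the second alternative for its own container: its colours lie
  in the palettes, so a palette B on almost all edges would place it within distance less than
  \<epsilon> e(G) of B. Only containers of small score remain, each with at most
  \<open>exp (t * e(G))\<close> colourings, and they are counted by fingerprints inside the coloured
  edges of G.\<close>

lemma card_far_colourings_le:
  assumes H: "simple_graph H" and G: "verts G = {1..n}" "edges G \<subseteq> pairs n"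
    and cm: "container_map (rainbow_weight H l n) (pairs n \<times> {1..l}) b P f g"
    and q: "0 < q" "q \<le> 1"
    and good: "\<And>S. S \<subseteq> edges G \<times> {1..l} \<Longrightarrow> inj_on fst S \<Longrightarrow> real (card S) \<le> b \<Longrightarrow>
       g S \<subseteq> pairs n \<times> {1..l} \<Longrightarrow> P (g S) \<Longrightarrow>
       (\<Sum>e\<in>edges G. score L (palette (g S) e)) \<le> t * real (card (edges G)) \<or>
       (\<exists>B. B \<subseteq> {1..l} \<and> card B = num_edges H - 1 \<and>
         real (card {e \<in> edges G. palette (g S) e \<noteq> B}) < \<epsilon> * real (card (edges G)))"
  shows "real (card (far_colourings H l \<epsilon> G)) \<le>
    exp (b * ln (1 / q) + q * (real l * real (card (edges G))) + t * real (card (edges G)))"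
proof -
  let ?V = "pairs n \<times> {1..l}" and ?E = "edges G"
  have finE: "finite ?E" by (rule finite_subset[OF G(2) finite_pairs])
  define \<S> where "\<S> = {S. S \<subseteq> ?E \<times> {1..l} \<and> real (card S) \<le> b \<and> g S \<subseteq> ?V \<and>
    (\<Sum>e\<in>?E. score L (palette (g S) e)) \<le> t * real (card ?E)}"
  have "\<S> \<subseteq> Pow (?E \<times> {1..l})" unfolding \<S>_def by blast
  then have fin\<S>: "finite \<S>" by (rule finite_subset) (simp add: finE)
  have finPal: "finite (palette (g S) e)" if "S \<in> \<S>" for S e
  proof (rule finite_subset)
    show "palette (g S) e \<subseteq> {1..l}"
      using that by (intro palette_subset[of "g S" "pairs n"]) (simp add: \<S>_def)
  qed simp
  have "far_colourings H l \<epsilon> G \<subseteq> (\<Union>S\<in>\<S>. PiE ?E (palette (g S)))"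
  proof
    fix c assume c: "c \<in> far_colourings H l \<epsilon> G"
    then have cf: "c \<in> rainbow_free_colourings H l G"
      and far: "\<epsilon> * real (card ?E) \<le> real (colour_dist (num_edges H - 1) l G c)"
      by (auto simp: far_colourings_def num_edges_def)
    then have cE: "c \<in> ?E \<rightarrow>\<^sub>E {1..l}" by (simp add: rainbow_free_colourings_def)
    define I where "I = colouring_graph G c"
    define S where "S = f I"
    have IE: "I \<subseteq> ?E \<times> {1..l}" using cE by (auto simp: I_def colouring_graph_def)
    then have IV: "I \<subseteq> ?V" using G(2) by blast
    have ind: "independent_set (rainbow_weight H l n) I"
      unfolding I_def by (rule independent_colouring_graph[OF H G(1) cf])
    note D = container_mapD[OF cm IV ind]
    \<comment> \<open>The fingerprint is itself an argument at which \<open>g\<close> returns the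
      container, so containers are indexed by fingerprints without mention of the colouring.\<close>
    have gS: "g S = g I" unfolding S_def by (rule D(6)[OF order_refl D(1)])
    have SE: "S \<subseteq> ?E \<times> {1..l}" using D(1) IE by (auto simp: S_def)
    have inj: "inj_on fst S"
      using D(1) unfolding S_def[symmetric] by (rule inj_on_subset[rotated])
        (auto simp: I_def colouring_graph_def inj_on_def)
    have in_pal: "c e \<in> palette (g S) e" if "e \<in> ?E" for e
    proof -
      have "(e, c e) \<in> I" using that by (simp add: I_def colouring_graph_def)
      then show ?thesis using D(3) unfolding gS palette_def by blast
    qed
    have "\<not> (\<exists>B. B \<subseteq> {1..l} \<and> card B = num_edges H - 1 \<and>
         real (card {e \<in> ?E. palette (g S) e \<noteq> B}) < \<epsilon> * real (card ?E))"
    proof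
      assume "\<exists>B. B \<subseteq> {1..l} \<and> card B = num_edges H - 1 \<and>
         real (card {e \<in> ?E. palette (g S) e \<noteq> B}) < \<epsilon> * real (card ?E)"
      then obtain B where B: "B \<subseteq> {1..l}" "card B = num_edges H - 1"
        "real (card {e \<in> ?E. palette (g S) e \<noteq> B}) < \<epsilon> * real (card ?E)" by blast
      have "{e \<in> ?E. c e \<notin> B} \<subseteq> {e \<in> ?E. palette (g S) e \<noteq> B}" using in_pal by auto
      then have "card {e \<in> ?E. c e \<notin> B} \<le> card {e \<in> ?E. palette (g S) e \<noteq> B}"
        using finE by (intro card_mono) auto
      then show False using colour_dist_le[OF B(1,2), of G c] B(3) far by linarith
    qed
    then have "(\<Sum>e\<in>?E. score L (palette (g S) e)) \<le> t * real (card ?E)"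
      using good[OF SE inj] D(2,4,5) unfolding gS S_def[symmetric] by blast
    then have "S \<in> \<S>" using SE D(2,4) unfolding \<S>_def gS[symmetric] S_def[symmetric] by simp
    moreover have "c \<in> PiE ?E (palette (g S))" using cE in_pal by (auto simp: PiE_iff)
    ultimately show "c \<in> (\<Union>S\<in>\<S>. PiE ?E (palette (g S)))" by blast
  qed
  then have "card (far_colourings H l \<epsilon> G) \<le> card (\<Union>S\<in>\<S>. PiE ?E (palette (g S)))"
    using fin\<S> finE finPal by (intro card_mono finite_UN_I finite_PiE) auto
  also have "\<dots> \<le> (\<Sum>S\<in>\<S>. card (PiE ?E (palette (g S))))" by (rule card_UN_le[OF fin\<S>])
  finally have "real (card (far_colourings H l \<epsilon> G)) \<le> (\<Sum>S\<in>\<S>. real (card (PiE ?E (palette (g S)))))"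
    unfolding of_nat_sum[symmetric] by (rule of_nat_mono)
  also have "\<dots> \<le> (\<Sum>S\<in>\<S>. 1 ^ card S * exp (t * real (card ?E)))"
  proof (rule sum_mono)
    fix S assume S: "S \<in> \<S>"
    have "real (card (PiE ?E (palette (g S)))) \<le> exp (\<Sum>e\<in>?E. score L (palette (g S) e))"
      by (rule card_PiE_le_exp_score[OF finE finPal[OF S]])
    also have "\<dots> \<le> exp (t * real (card ?E))" using S by (simp add: \<S>_def)
    finally show "real (card (PiE ?E (palette (g S)))) \<le> 1 ^ card S * exp (t * real (card ?E))" by simp
  qed
  also have "\<dots> = (\<Sum>S\<in>\<S>. 1 ^ card S) * exp (t * real (card ?E))" by (simp add: sum_distrib_right)
  also have "\<dots> \<le> exp (b * ln (1 / q) + q * 1 * real (card (?E \<times> {1..l}))) * exp (t * real (card ?E))"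
    using finE q by (intro mult_right_mono sum_small_sets_le) (auto simp: \<S>_def)
  finally show ?thesis by (simp add: card_cartesian_product exp_add mult_ac)
qed

text \<open>With only e(H) - 1 colours in use no copy of \<open>H\<close> can be rainbow.\<close>

lemma num_rainbow_free_ge:
  assumes H: "simple_graph H" and m: "num_edges H \<ge> 1" "num_edges H \<le> l" and finG: "finite (edges G)"
  shows "(num_edges H - 1) ^ num_edges G \<le> num_rainbow_free H l G"
proof -
  let ?k = "num_edges H - 1"
  have sub: "edges G \<rightarrow>\<^sub>E {1..?k} \<subseteq> rainbow_free_colourings H l G"
  proof
    fix c assume c: "c \<in> edges G \<rightarrow>\<^sub>E {1..?k}"
    have "\<not> rainbow_copy H G c F" for F
    proof
      assume "rainbow_copy H G c F"
      then obtain h where F: "edges F \<subseteq> edges G" "inj_on c (edges F)"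
        and h: "inj_on h (verts H)" "edges F = (\<lambda>e. h ` e) ` edges H"
        by (auto simp: rainbow_copy_def subgraph_def isomorphic_def bij_betw_def)
      have "inj_on (\<lambda>e. h ` e) (edges H)"
        using H by (intro inj_on_image inj_on_subset[OF h(1)]) (auto simp: simple_graph_def)
      then have "card (edges F) = num_edges H" using h(2) by (simp add: card_image num_edges_def)
      moreover have "card (edges F) \<le> card {1..?k}"
        using c F by (intro card_inj_on_le[of c]) auto
      ultimately show False using m by simp
    qed
    moreover have "edges G \<rightarrow>\<^sub>E {1..?k} \<subseteq> edges G \<rightarrow>\<^sub>E {1..l}" using m by (intro PiE_mono) auto
    then have "c \<in> edges G \<rightarrow>\<^sub>E {1..l}" using c by blast
    ultimately show "c \<in> rainbow_free_colourings H l G" by (auto simp: rainbow_free_colourings_def)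
  qed
  have "rainbow_free_colourings H l G \<subseteq> edges G \<rightarrow>\<^sub>E {1..l}" by (auto simp: rainbow_free_colourings_def)
  then have "finite (rainbow_free_colourings H l G)"
    using finG by (rule finite_subset[OF _ finite_PiE]) auto
  from card_mono[OF this sub] show ?thesis
    using finG by (simp add: num_rainbow_free_def card_PiE num_edges_def)
qed

lemma whp_GnpI:
  assumes bad: "\<forall>\<^sub>F n in sequentially.
      measure_pmf.prob (Pi_pmf (pairs n) False (\<lambda>_. bernoulli_pmf (p n))) (B n) \<le> u n"
    and u: "u \<longlonglongrightarrow> 0"
    and good: "\<forall>\<^sub>F n in sequentially. \<forall>X. X \<notin> B n \<longrightarrow> P (SGraph {1..n} {e \<in> pairs n. X e})"
  shows "whp (\<lambda>n. Gnp n (p n)) P"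
  unfolding whp_def
proof (rule tendsto_sandwich)
  show "(\<lambda>n. 1 - u n) \<longlonglongrightarrow> 1" using tendsto_diff[OF tendsto_const u, of 1] by simp
  show "\<forall>\<^sub>F n in sequentially. 1 - u n \<le> measure_pmf.prob (Gnp n (p n)) {G. P G}"
    using bad good
  proof eventually_elim
    case (elim n)
    let ?M = "Pi_pmf (pairs n) False (\<lambda>_. bernoulli_pmf (p n))"
    have "measure_pmf.prob ?M (- B n) = 1 - measure_pmf.prob ?M (B n)"
      using measure_pmf.prob_compl[of "B n" ?M] by (simp add: Compl_eq_Diff_UNIV)
    moreover have "measure_pmf.prob ?M (- B n) \<le> measure_pmf.prob (Gnp n (p n)) {G. P G}"
      unfolding Gnp_def measure_map_pmf
      using elim(2) by (intro measure_pmf.finite_measure_mono) auto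
    ultimately show ?case using elim(1) by linarith
  qed
qed (auto simp: measure_pmf.prob_le_1)

lemma abs_score_le:
  assumes "finite Q" "card Q \<le> l" "l > 0" "ln (real l) \<le> L"
  shows "\<bar>score L Q\<bar> \<le> L"
proof -
  have l0: "ln (real l) \<ge> 0" using assms(3) by (intro ln_ge_zero) simp
  then have "score L Q \<le> ln (real l)" using assms by (intro score_le) linarith+
  moreover have "- L \<le> score L Q"
  proof (cases "Q = {}")
    case False
    then have "1 \<le> card Q" using assms(1) by (simp add: Suc_le_eq card_gt_0_iff)
    then have "0 \<le> ln (real (card Q))" by (intro ln_ge_zero) simp
    then show ?thesis using False l0 assms(4) by (simp add: score_def)
  qed (simp add: score_def)
  ultimately show ?thesis using assms(4) by (simp add: abs_le_iff)
qed

text \<open>Every constant is fixed before n and p. The exceptional set joins two events: some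
  fingerprint is present whose container behaves atypically on the random edges, or fewer than about
  half the expected edges appear. The second is needed because the fingerprint cost is bounded by
  the expected number of edges but must be charged to the actual number.\<close>

lemma far_colourings_exceptional_set:
  fixes H :: "'a sgraph"
  assumes H: "simple_graph H" "non_matching H" and m: "num_edges H \<ge> 3"
    and ml: "num_edges H \<le> l"
    and l: "(real (num_edges H) - 2) * ln (real l) < real (num_edges H) * ln (real (num_edges H) - 1)"
    and \<epsilon>: "\<epsilon> > 0"
  shows "\<exists>A>0. \<exists>\<eta>>0. \<exists>c>0. \<exists>n0. \<forall>n\<ge>n0. \<forall>p. 0 \<le> p \<longrightarrow> p \<le> 1 \<longrightarrow> A * real n powr (- 1 / m2 H) \<le> p \<longrightarrow>
    (\<exists>B. measure_pmf.prob (Pi_pmf (pairs n) False (\<lambda>_. bernoulli_pmf p)) B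
            \<le> exp (- c * (p * real (card (pairs n)))) + exp (- (p * real (card (pairs n)) / 16)) \<and>
      (\<forall>X. X \<notin> B \<longrightarrow> p * real (card (pairs n)) / 2 < real (card {e \<in> pairs n. X e}) \<and>
         real (card (far_colourings H l \<epsilon> (SGraph {1..n} {e \<in> pairs n. X e})))
           \<le> exp ((ln (real (num_edges H) - 1) - \<eta>) * real (card {e \<in> pairs n. X e}))))"
proof -
  let ?m = "real (num_edges H)"
  let ?L = "?m * ln (real l)"
  define a where "a = ln (?m - 1)"
  have a: "a > 0" using m by (simp add: a_def)
  have l0: "real l > 0" "l > 0" and lnl: "ln (real l) > 0" using m ml by auto
  have lnL: "ln (real l) \<le> ?L" using m lnl by simp
  have "\<epsilon> / 2 > 0" using \<epsilon> by simp
  from container_stability[OF H m ml l this] obtain \<alpha> \<eta> n0 where \<alpha>: "\<alpha> > 0" and \<eta>: "\<eta> > 0"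
    and stab: "\<forall>n\<ge>n0. \<forall>C. C \<subseteq> pairs n \<times> {1..l} \<longrightarrow>
      wtot (rainbow_weight H l n) C \<le> \<alpha> * real (card (pairs n \<times> {1..l})) \<longrightarrow>
      (\<Sum>f\<in>pairs n. score ?L (palette C f)) \<le> (ln (?m - 1) - \<eta>) * real (card (pairs n)) \<or>
      (\<exists>B. B \<subseteq> {1..l} \<and> card B = num_edges H - 1 \<and>
         real (card {f \<in> pairs n. palette C f \<noteq> B}) \<le> \<epsilon> / 2 * real (card (pairs n)))"
    by (elim exE conjE) (rule that)
  define K where "K = 2 ^ num_edges H * real l ^ num_edges H * real (num_verts H) ^ num_verts H"
  have "K > 0" using l0 num_verts_ge_3[OF H] by (simp add: K_def)
  from hypergraph_containers[OF this \<alpha>, of "num_edges H", where 'v = "nat set \<times> nat"] m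
  obtain M where M: "M \<ge> 0" and cont: "\<And>\<tau> V (w :: (nat set \<times> nat) set \<Rightarrow> real). \<tau> > 0 \<Longrightarrow>
      spread_weight (num_edges H) K \<tau> V w \<Longrightarrow>
      \<exists>f g. container_map w V (M * \<tau> * real (card V)) (\<lambda>C. wtot w C \<le> \<alpha> * real (card V)) f g"
    by auto
  \<comment> \<open>The room left for random fluctuation in both alternatives: scores may rise from
    ln k - \<eta> to ln k - \<eta>/2 with k = e(H) - 1, and the proportion of deviating palettes
    from \<epsilon>/2 to \<epsilon>.\<close>
  define \<eta>' where "\<eta>' = min (\<eta> / 2) (\<epsilon> / 2)"
  have \<eta>': "\<eta>' > 0" "\<eta>' \<le> \<eta> / 2" "\<eta>' \<le> \<epsilon> / 2" using \<eta> \<epsilon> by (auto simp: \<eta>'_def)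
  define Z where "Z = ?L + a + \<eta> + \<epsilon> + 1"
  have Z: "Z > 0" using a \<eta> \<epsilon> lnL lnl unfolding Z_def by linarith
  define \<mu> where "\<mu> = min (1 / Z) (\<eta>' / (2 * Z\<^sup>2))"
  have \<mu>: "\<mu> > 0" "\<mu> * Z \<le> 1" "\<mu> * Z\<^sup>2 \<le> \<eta>' / 2"
  proof -
    show "\<mu> > 0" using Z \<eta>' by (simp add: \<mu>_def)
    have "\<mu> * Z \<le> 1 / Z * Z" using Z by (intro mult_right_mono) (auto simp: \<mu>_def)
    then show "\<mu> * Z \<le> 1" using Z by simp
    have "\<mu> * Z\<^sup>2 \<le> \<eta>' / (2 * Z\<^sup>2) * Z\<^sup>2" by (intro mult_right_mono) (auto simp: \<mu>_def)
    then show "\<mu> * Z\<^sup>2 \<le> \<eta>' / 2" using Z by simp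
  qed
  define c where "c = \<mu> * \<eta>' / 2"
  have c: "c > 0" using \<mu> \<eta>' by (simp add: c_def)
  \<comment> \<open>The first bound makes the fingerprint term of the union bound at most c/4 per
    expected edge, the second makes the one in the count of colourings at most \<eta>/16 per
    edge.\<close>
  define q where "q = min 1 (min (c / (4 * exp 2 * real l)) (\<eta> / (16 * real l)))"
  have q: "0 < q" "q \<le> 1" using c \<eta> l0 by (auto simp: q_def)
  have qc: "q * exp 2 * real l \<le> c / 4"
  proof -
    have "q * (exp 2 * real l) \<le> c / (4 * exp 2 * real l) * (exp 2 * real l)"
      using l0 by (intro mult_right_mono) (auto simp: q_def)
    then show ?thesis using l0 by simp
  qed
  have q\<eta>: "q * real l \<le> \<eta> / 16"
  proof -
    have "q * real l \<le> \<eta> / (16 * real l) * real l"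
      using l0 by (intro mult_right_mono) (auto simp: q_def)
    then show ?thesis using l0 by simp
  qed
  \<comment> \<open>The share of the expected number of edges granted to
    \<open>s * ln (1 / q)\<close>. It serves the union bound through c/4 and the counting through
    \<eta>/32, where the lower bound on the number of edges costs a factor 2.\<close>
  define \<kappa> where "\<kappa> = min (c / 4) (\<eta> / 32)"
  have \<kappa>: "\<kappa> > 0" "\<kappa> \<le> c / 4" "\<kappa> \<le> \<eta> / 32" using c \<eta> by (auto simp: \<kappa>_def)
  define r where "r = M * real l * ln (1 / q) + 1"
  have lnq: "ln (1 / q) \<ge> 0" using q by (intro ln_ge_zero) (simp add: field_simps)
  have r: "r > 0" using M lnq by (simp add: r_def add_nonneg_pos)
  \<comment> \<open>Fingerprints have size at most M l times n^(-1 / \<open>m2 H\<close>) times the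
    number of pairs, so this ratio turns the lower bound on p into
    \<open>s * ln (1 / q) \<le> \<kappa> * p * N\<close> with N the number of pairs. The summand 1
    in r only ensures A > 0.\<close>
  define A where "A = r / \<kappa>"
  have A: "A > 0" using r \<kappa> by (simp add: A_def)
  have main: "\<exists>B. measure_pmf.prob (Pi_pmf (pairs n) False (\<lambda>_. bernoulli_pmf p)) B
            \<le> exp (- (c / 2) * (p * real (card (pairs n)))) + exp (- (p * real (card (pairs n)) / 16)) \<and>
      (\<forall>X. X \<notin> B \<longrightarrow> p * real (card (pairs n)) / 2 < real (card {e \<in> pairs n. X e}) \<and>
         real (card (far_colourings H l \<epsilon> (SGraph {1..n} {e \<in> pairs n. X e})))
           \<le> exp ((ln (?m - 1) - \<eta> / 4) * real (card {e \<in> pairs n. X e})))"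
    if n: "n \<ge> max 1 n0" and p: "0 \<le> p" "p \<le> 1" and pA: "A * real n powr (- 1 / m2 H) \<le> p" for n p
  proof -
    let ?\<tau> = "real n powr (- 1 / m2 H)" and ?V = "pairs n \<times> {1..l}" and ?D = "pairs n"
    let ?w = "rainbow_weight H l n" and ?N = "real (card (pairs n))"
    define s where "s = M * ?\<tau> * real (card ?V)"
    have "spread_weight (num_edges H) K ?\<tau> ?V ?w"
      unfolding K_def using n by (intro spread_rainbow_weight[OF H]) auto
    from cont[OF _ this] obtain f g where
      cm: "container_map ?w ?V s (\<lambda>C. wtot ?w C \<le> \<alpha> * real (card ?V)) f g"
      using n by (auto simp: s_def)
    have s: "s * ln (1 / q) \<le> \<kappa> * (p * ?N)"
    proof -
      have "s * ln (1 / q) = (M * real l * ln (1 / q)) * (?\<tau> * ?N)"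
        by (simp add: s_def card_cartesian_product)
      also have "\<dots> \<le> r * (?\<tau> * ?N)" by (intro mult_right_mono) (auto simp: r_def)
      also have "\<dots> = \<kappa> * (A * ?\<tau> * ?N)" using \<kappa> by (simp add: A_def)
      also have "\<dots> \<le> \<kappa> * (p * ?N)" using pA \<kappa> by (intro mult_left_mono mult_right_mono) auto
      finally show ?thesis .
    qed
    define rare where "rare S \<longleftrightarrow> (\<Sum>e\<in>?D. score ?L (palette (g S) e)) \<le> (a - \<eta>) * ?N" for S
    define common where "common S = (SOME B. B \<subseteq> {1..l} \<and> card B = num_edges H - 1 \<and>
         real (card {e \<in> ?D. palette (g S) e \<noteq> B}) \<le> \<epsilon> / 2 * ?N)" for S
    define \<S> where "\<S> = {S. S \<subseteq> ?V \<and> inj_on fst S \<and> real (card S) \<le> s \<and> g S \<subseteq> ?V \<and>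
        wtot ?w (g S) \<le> \<alpha> * real (card ?V)}"
    \<comment> \<open>One test function for both alternatives: in either case its mean over all
      pairs is at most -\<eta>', and a negative sum over the random edges is what the count of
      colourings asks for. A single union bound therefore suffices.\<close>
    define z where "z S e = (if rare S then score ?L (palette (g S) e) - (a - \<eta> / 2)
        else (if palette (g S) e \<noteq> common S then 1 else 0) - \<epsilon>)" for S e
    have common: "common S \<subseteq> {1..l} \<and> card (common S) = num_edges H - 1 \<and>
         real (card {e \<in> ?D. palette (g S) e \<noteq> common S}) \<le> \<epsilon> / 2 * ?N"
      if "S \<in> \<S>" "\<not> rare S" for S
    proof -
      have "\<exists>B. B \<subseteq> {1..l} \<and> card B = num_edges H - 1 \<and>
         real (card {e \<in> ?D. palette (g S) e \<noteq> B}) \<le> \<epsilon> / 2 * ?N"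
        using stab[rule_format, of n "g S"] that n unfolding \<S>_def rare_def a_def by auto
      then show ?thesis unfolding common_def by (rule someI_ex)
    qed
    define B1 where "B1 = {X. \<exists>S\<in>\<S>. (\<forall>e\<in>fst ` S. X e) \<and> 0 \<le> (\<Sum>e\<in>{e\<in>?D. X e}. z S e)}"
    define B2 where "B2 = {X. real (card {e\<in>?D. X e}) \<le> p * ?N / 2}"
    let ?M = "Pi_pmf ?D False (\<lambda>_. bernoulli_pmf p)"
    have z_bound: "\<bar>z S e\<bar> \<le> Z" if "S \<in> \<S>" "e \<in> ?D" for S e
    proof (cases "rare S")
      case True
      have pal: "palette (g S) e \<subseteq> {1..l}"
        using that(1) by (intro palette_subset[of _ ?D]) (simp add: \<S>_def)
      then have "\<bar>score ?L (palette (g S) e)\<bar> \<le> ?L"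
        using card_mono[OF _ pal] finite_subset[OF pal] l0(2) lnL by (intro abs_score_le) auto
      moreover have "z S e = score ?L (palette (g S) e) - (a - \<eta> / 2)" using True by (simp add: z_def)
      ultimately show ?thesis using a \<eta> \<epsilon> unfolding Z_def by linarith
    next
      case False
      then have "z S e = 1 - \<epsilon> \<or> z S e = - \<epsilon>" by (simp add: z_def)
      then show ?thesis using a \<eta> \<epsilon> lnL lnl unfolding Z_def by linarith
    qed
    have z_sum: "(\<Sum>e\<in>?D. z S e) \<le> - \<eta>' * ?N" if S: "S \<in> \<S>" for S
    proof (cases "rare S")
      case True
      then have "(\<Sum>e\<in>?D. z S e) = (\<Sum>e\<in>?D. score ?L (palette (g S) e)) - (a - \<eta> / 2) * ?N"
        by (simp add: z_def sum_subtractf mult.commute)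
      also have "\<dots> \<le> (a - \<eta>) * ?N - (a - \<eta> / 2) * ?N" using True by (simp add: rare_def)
      also have "\<dots> = - (\<eta> / 2) * ?N" by (simp add: algebra_simps)
      also have "\<dots> \<le> - \<eta>' * ?N" using \<eta>' by (intro mult_right_mono) auto
      finally show ?thesis .
    next
      case False
      then have "(\<Sum>e\<in>?D. z S e) = real (card {e \<in> ?D. palette (g S) e \<noteq> common S}) - \<epsilon> * ?N"
        using finite_pairs by (simp add: z_def sum_subtractf mult.commute flip: sum.inter_filter)
      also have "\<dots> \<le> - (\<epsilon> / 2) * ?N" using common[OF S False] by (simp add: algebra_simps)
      also have "\<dots> \<le> - \<eta>' * ?N" using \<eta>' by (intro mult_right_mono) auto
      finally show ?thesis .
    qed
    have "measure_pmf.prob ?M B1 \<le> exp (s * ln (1 / q) + q * exp 2 * real (card {1..l}) * (p * ?N)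
                - \<mu> * \<eta>' / 2 * (p * ?N))"
      unfolding B1_def
      by (rule fingerprint_union_bound[OF finite_pairs _ p q _ z_bound z_sum \<mu>]) (auto simp: \<S>_def)
    also have "\<dots> \<le> exp (- (c / 2) * (p * ?N))"
    proof -
      have pN: "0 \<le> p * ?N" using p by simp
      have "q * exp 2 * real l * (p * ?N) \<le> c / 4 * (p * ?N)" using qc pN by (rule mult_right_mono)
      moreover have "\<kappa> * (p * ?N) \<le> c / 4 * (p * ?N)" using \<kappa>(2) pN by (rule mult_right_mono)
      ultimately show ?thesis using s by (simp add: c_def algebra_simps)
    qed
    finally have pB1: "measure_pmf.prob ?M B1 \<le> exp (- (c / 2) * (p * ?N))" .
    have pB2: "measure_pmf.prob ?M B2 \<le> exp (- (p * ?N / 16))"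
      unfolding B2_def by (rule bernoulli_few_edges[OF finite_pairs p])
    have "measure_pmf.prob ?M (B1 \<union> B2) \<le> measure_pmf.prob ?M B1 + measure_pmf.prob ?M B2"
      by (intro measure_Un_le) auto
    then have pB: "measure_pmf.prob ?M (B1 \<union> B2) \<le> exp (- (c / 2) * (p * ?N)) + exp (- (p * ?N / 16))"
      using pB1 pB2 by linarith
    have "p * ?N / 2 < real (card {e \<in> ?D. X e}) \<and>
         real (card (far_colourings H l \<epsilon> (SGraph {1..n} {e \<in> ?D. X e})))
           \<le> exp ((ln (?m - 1) - \<eta> / 4) * real (card {e \<in> ?D. X e}))"
      if X: "X \<notin> B1 \<union> B2" for X
    proof -
      let ?G = "SGraph {1..n} {e \<in> ?D. X e}" and ?E = "{e \<in> ?D. X e}"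
      let ?e = "real (card ?E)"
      have finE: "finite ?E" using finite_pairs by simp
      have many: "p * ?N / 2 < ?e" using X by (simp add: B2_def)
      have "real (card (far_colourings H l \<epsilon> ?G)) \<le>
        exp (s * ln (1 / q) + q * (real l * real (card (edges ?G))) + (a - \<eta> / 2) * real (card (edges ?G)))"
      proof (rule card_far_colourings_le[OF H(1) _ _ cm q])
        fix S assume S: "S \<subseteq> edges ?G \<times> {1..l}" "inj_on fst S" "real (card S) \<le> s"
          "g S \<subseteq> ?V" "wtot ?w (g S) \<le> \<alpha> * real (card ?V)"
        then have S\<S>: "S \<in> \<S>" by (auto simp: \<S>_def)
        have "\<forall>e\<in>fst ` S. X e" using S(1) by auto
        then have neg: "(\<Sum>e\<in>?E. z S e) < 0" using X S\<S> unfolding B1_def by auto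
        show "(\<Sum>e\<in>edges ?G. score ?L (palette (g S) e)) \<le> (a - \<eta> / 2) * real (card (edges ?G)) \<or>
          (\<exists>B. B \<subseteq> {1..l} \<and> card B = num_edges H - 1 \<and>
            real (card {e \<in> edges ?G. palette (g S) e \<noteq> B}) < \<epsilon> * real (card (edges ?G)))"
        proof (cases "rare S")
          case True
          have "(\<Sum>e\<in>?E. z S e) = (\<Sum>e\<in>?E. score ?L (palette (g S) e) - (a - \<eta> / 2))"
            by (rule sum.cong) (simp_all add: z_def True)
          also have "\<dots> = (\<Sum>e\<in>?E. score ?L (palette (g S) e)) - ?e * (a - \<eta> / 2)"
            by (simp add: sum_subtractf)
          finally show ?thesis using neg by (simp add: mult.commute)
        next
          case False
          have "(\<Sum>e\<in>?E. z S e) = (\<Sum>e\<in>?E. (if palette (g S) e \<noteq> common S then 1 else 0) - \<epsilon>)"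
            by (rule sum.cong) (simp_all add: z_def False)
          also have "\<dots> = (\<Sum>e\<in>?E. if palette (g S) e \<noteq> common S then 1 else 0) - ?e * \<epsilon>"
            by (simp add: sum_subtractf)
          also have "(\<Sum>e\<in>?E. if palette (g S) e \<noteq> common S then 1 else 0 :: real)
              = real (card {e \<in> ?E. palette (g S) e \<noteq> common S})"
            using sum.inter_filter[OF finE, of "\<lambda>_. 1 :: real" "\<lambda>e. palette (g S) e \<noteq> common S"] by simp
          finally have "real (card {e \<in> edges ?G. palette (g S) e \<noteq> common S}) < \<epsilon> * real (card (edges ?G))"
            using neg by (simp add: mult.commute)
          then show ?thesis using common[OF S\<S> False] by blast
        qed
      qed auto
      \<comment> \<open>The two fingerprint terms cost \<eta>/16 per edge each, which fits into the
        difference between \<eta>/2 and \<eta>/4.\<close>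
      also have "\<dots> \<le> exp ((a - \<eta> / 4) * ?e)"
      proof -
        have "q * real l * ?e \<le> \<eta> / 16 * ?e" using q\<eta> by (rule mult_right_mono) simp
        moreover have "\<kappa> * (p * ?N) \<le> \<eta> / 32 * (2 * ?e)"
        proof -
          have "\<kappa> * (p * ?N) \<le> \<eta> / 32 * (p * ?N)" using \<kappa>(3) p by (intro mult_right_mono) auto
          also have "\<dots> \<le> \<eta> / 32 * (2 * ?e)" using many \<eta> by (intro mult_left_mono) auto
          finally show ?thesis .
        qed
        moreover have "0 \<le> \<eta> * ?e" using \<eta> by simp
        ultimately show ?thesis using s by (simp add: algebra_simps)
      qed
      finally show ?thesis using many by (simp add: a_def)
    qed
    with pB show ?thesis by blast
  qed
  show ?thesis
  proof (rule exI[of _ A], rule conjI[OF A], rule exI[of _ "\<eta> / 4"], rule conjI, use \<eta> in simp,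
      rule exI[of _ "c / 2"], rule conjI, use c in simp, rule exI[of _ "max 1 n0"], intro allI impI)
  qed (rule main)
qed


text \<open>Since \<open>m2 H\<close> is at least 1, p is eventually at least A/n, which gives at
  least A (n - 1) / 2 expected edges.\<close>

lemma expected_edges_at_top:
  fixes H :: "'a sgraph"
  assumes H: "simple_graph H" "non_matching H" and A: "A > 0"
    and p: "\<forall>\<^sub>F n in sequentially. A * real n powr (- 1 / m2 H) \<le> p n"
  shows "filterlim (\<lambda>n. p n * real (card (pairs n))) at_top sequentially"
proof (rule filterlim_at_top_mono)
  show "filterlim (\<lambda>n. A / 2 * (real n - 1)) at_top sequentially"
    using A by real_asymp
  show "\<forall>\<^sub>F n in sequentially. A / 2 * (real n - 1) \<le> p n * real (card (pairs n))"
    using p eventually_ge_at_top[of 1]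
  proof eventually_elim
    case (elim n)
    have n: "real n \<ge> 1" using elim(2) by simp
    have "- 1 \<le> - 1 / m2 H" using m2_ge_1[OF H] by (simp add: field_simps)
    then have "real n powr (- 1) \<le> real n powr (- 1 / m2 H)" using n by (intro powr_mono) auto
    then have "A * real n powr (- 1) \<le> A * real n powr (- 1 / m2 H)"
      using A by (intro mult_left_mono) auto
    then have "A / real n \<le> p n" using elim(1) n by (simp add: powr_minus divide_inverse)
    then have "A / real n * real (card (pairs n)) \<le> p n * real (card (pairs n))"
      by (intro mult_right_mono) auto
    moreover have "A / real n * real (card (pairs n)) = A / 2 * (real n - 1)"
      using n unfolding card_pairs by simp
    ultimately show ?case by linarith
  qed
qed

theorem theorem1p4:
  fixes H :: "'a sgraph" and l :: nat and \<epsilon> :: real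
  assumes "simple_graph H" and "no_isolated_vertices H" and "non_matching H"
    and "num_edges H \<ge> 3"
    and "num_edges H \<le> l"
    and "real l < (real (num_edges H) - 1) powr (real (num_edges H) / (real (num_edges H) - 2))"
    and "\<epsilon> > 0"
  shows "\<exists>A>0. \<exists>\<gamma>>0. \<forall>p :: nat \<Rightarrow> real.
    (\<forall>n. 0 \<le> p n \<and> p n \<le> 1) \<longrightarrow>
    (\<forall>\<^sub>F n in sequentially. p n \<ge> A * real n powr (- 1 / m2 H)) \<longrightarrow>
      whp (\<lambda>n. Gnp n (p n))
        (\<lambda>G. real (card (far_colourings H l \<epsilon> G))
               \<le> (real (num_edges H) - 1) powr ((1 - \<gamma>) * real (num_edges G)))
      \<and> (\<forall>\<delta>>0. whp (\<lambda>n. Gnp n (p n))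
            (\<lambda>G. real (card (far_colourings H l \<epsilon> G))
                   \<le> \<delta> * real (num_rainbow_free H l G)))"
  proof -
  define k where "k = real (num_edges H) - 1"
  have k: "k \<ge> 2" "ln k > 0" and l: "real l > 0" using assms(4,5) by (auto simp: k_def)
  have "ln (real l) < ln (k powr (real (num_edges H) / (real (num_edges H) - 2)))"
    using assms(6) l by (subst ln_less_cancel_iff) (auto simp: k_def)
  also have "\<dots> = real (num_edges H) / (real (num_edges H) - 2) * ln k"
    using k by (simp add: ln_powr)
  finally have lbound: "(real (num_edges H) - 2) * ln (real l) < real (num_edges H) * ln (real (num_edges H) - 1)"
    using assms(4) by (simp add: k_def field_simps)
  obtain A \<eta> c n0 where A: "A > 0" and \<eta>: "\<eta> > 0" and c: "c > 0" and
    exc: "\<forall>n\<ge>n0. \<forall>p. 0 \<le> p \<longrightarrow> p \<le> 1 \<longrightarrow> A * real n powr (- 1 / m2 H) \<le> p \<longrightarrow>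
    (\<exists>B. measure_pmf.prob (Pi_pmf (pairs n) False (\<lambda>_. bernoulli_pmf p)) B
            \<le> exp (- c * (p * real (card (pairs n)))) + exp (- (p * real (card (pairs n)) / 16)) \<and>
      (\<forall>X. X \<notin> B \<longrightarrow> p * real (card (pairs n)) / 2 < real (card {e \<in> pairs n. X e}) \<and>
         real (card (far_colourings H l \<epsilon> (SGraph {1..n} {e \<in> pairs n. X e})))
           \<le> exp ((ln (real (num_edges H) - 1) - \<eta>) * real (card {e \<in> pairs n. X e}))))"
    using far_colourings_exceptional_set[OF assms(1,3,4,5) lbound assms(7)]
    by (elim exE conjE) (rule that)
  \<comment> \<open>Change of base: the loss \<eta> per edge in the natural exponent, measured in
    units of ln k.\<close>
  define \<gamma> where "\<gamma> = \<eta> / ln k"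
  have \<gamma>: "\<gamma> > 0" using \<eta> k by (simp add: \<gamma>_def)
  have pow: "exp ((ln k - \<eta>) * x) = k powr ((1 - \<gamma>) * x)" for x
    using k by (simp add: powr_def \<gamma>_def algebra_simps)
  show ?thesis
  proof (rule exI[of _ A], rule conjI[OF A], rule exI[of _ \<gamma>], rule conjI[OF \<gamma>], intro allI impI)
    fix p :: "nat \<Rightarrow> real"
    assume p: "\<forall>n. 0 \<le> p n \<and> p n \<le> 1"
      and pA: "\<forall>\<^sub>F n in sequentially. A * real n powr (- 1 / m2 H) \<le> p n"
    define \<nu> where "\<nu> n = p n * real (card (pairs n))" for n
    have \<nu>: "filterlim \<nu> at_top sequentially"
      unfolding \<nu>_def by (rule expected_edges_at_top[OF assms(1,3) A pA])
    let ?G = "\<lambda>n X. SGraph {1..n} {e \<in> pairs n. X e}"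
    define R where "R n X \<longleftrightarrow> \<nu> n / 2 < real (num_edges (?G n X)) \<and>
        real (card (far_colourings H l \<epsilon> (?G n X))) \<le> k powr ((1 - \<gamma>) * real (num_edges (?G n X)))" for n X
    define u where "u n = exp (- c * \<nu> n) + exp (- (\<nu> n / 16))" for n
    define B where "B n = {X. \<not> R n X}" for n
    have bad: "\<forall>\<^sub>F n in sequentially.
        measure_pmf.prob (Pi_pmf (pairs n) False (\<lambda>_. bernoulli_pmf (p n))) (B n) \<le> u n"
      using pA eventually_ge_at_top[of n0]
    proof eventually_elim
      case (elim n)
      then obtain B' where B': "measure_pmf.prob (Pi_pmf (pairs n) False (\<lambda>_. bernoulli_pmf (p n))) B' \<le> u n"
        and typical: "\<And>X. X \<notin> B' \<Longrightarrow> \<nu> n / 2 < real (card {e \<in> pairs n. X e}) \<and>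
           real (card (far_colourings H l \<epsilon> (?G n X))) \<le> exp ((ln k - \<eta>) * real (card {e \<in> pairs n. X e}))"
        using exc[rule_format, of n "p n"] p unfolding u_def \<nu>_def k_def by blast
      have R: "R n X" if "X \<notin> B'" for X
        using typical[OF that] unfolding R_def pow by (simp add: num_edges_def)
      have "measure_pmf.prob (Pi_pmf (pairs n) False (\<lambda>_. bernoulli_pmf (p n))) (B n)
          \<le> measure_pmf.prob (Pi_pmf (pairs n) False (\<lambda>_. bernoulli_pmf (p n))) B'"
        using R by (intro measure_pmf.finite_measure_mono) (auto simp: B_def)
      with B' show ?case by linarith
    qed
    have u: "u \<longlonglongrightarrow> 0"
    proof -
      have "((\<lambda>x. exp (- c * x)) \<longlongrightarrow> 0) at_top" using c by real_asymp
      moreover have "((\<lambda>x::real. exp (- (x / 16))) \<longlongrightarrow> 0) at_top" by real_asymp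
      ultimately have "((\<lambda>x. exp (- c * x) + exp (- (x / 16))) \<longlongrightarrow> 0) at_top"
        using tendsto_add_zero by blast
      moreover have "u = (\<lambda>n. exp (- c * \<nu> n) + exp (- (\<nu> n / 16)))" by (rule ext) (simp add: u_def)
      ultimately show ?thesis using filterlim_compose[of "\<lambda>x. exp (- c * x) + exp (- (x / 16))", OF _ \<nu>] by simp
    qed
    show "whp (\<lambda>n. Gnp n (p n))
        (\<lambda>G. real (card (far_colourings H l \<epsilon> G))
               \<le> (real (num_edges H) - 1) powr ((1 - \<gamma>) * real (num_edges G)))
      \<and> (\<forall>\<delta>>0. whp (\<lambda>n. Gnp n (p n))
            (\<lambda>G. real (card (far_colourings H l \<epsilon> G)) \<le> \<delta> * real (num_rainbow_free H l G)))"
    proof (intro conjI allI impI)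
      show "whp (\<lambda>n. Gnp n (p n))
        (\<lambda>G. real (card (far_colourings H l \<epsilon> G))
               \<le> (real (num_edges H) - 1) powr ((1 - \<gamma>) * real (num_edges G)))"
        by (rule whp_GnpI[OF bad u]) (simp add: B_def R_def k_def)
      fix \<delta> :: real assume \<delta>: "\<delta> > 0"
      \<comment> \<open>More than half of the expected edges are present, so from here on the
        surplus factor exp (-\<eta> e(G)) is at most \<delta>; the colourings using only k fixed
        colours provide the comparison k^e(G).\<close>
      have "\<forall>\<^sub>F n in sequentially. 2 * ln (1 / \<delta>) / \<eta> \<le> \<nu> n"
        using \<nu> by (simp add: filterlim_at_top)
      then have "\<forall>\<^sub>F n in sequentially. \<forall>X. X \<notin> B n \<longrightarrow>
          real (card (far_colourings H l \<epsilon> (?G n X))) \<le> \<delta> * real (num_rainbow_free H l (?G n X))"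
      proof eventually_elim
        case (elim n)
        show ?case
        proof (intro allI impI)
          fix X assume "X \<notin> B n"
          then have many: "\<nu> n / 2 < real (num_edges (?G n X))" and
            le: "real (card (far_colourings H l \<epsilon> (?G n X))) \<le> k powr ((1 - \<gamma>) * real (num_edges (?G n X)))"
            by (auto simp: B_def R_def)
          let ?e = "real (num_edges (?G n X))"
          have "ln (1 / \<delta>) \<le> \<eta> * ?e"
          proof -
            have "2 * ln (1 / \<delta>) / \<eta> \<le> 2 * ?e" using elim many by linarith
            then show ?thesis using \<eta> by (simp add: divide_le_eq mult_ac)
          qed
          then have "- (\<eta> * ?e) \<le> ln \<delta>" using \<delta> by (simp add: ln_div)
          then have "exp (- (\<eta> * ?e)) \<le> \<delta>" using \<delta> by (metis exp_le_cancel_iff exp_ln)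
          then have "exp (- (\<eta> * ?e)) * k powr ?e \<le> \<delta> * k powr ?e"
            by (rule mult_right_mono) simp
          moreover have "exp (- (\<eta> * ?e)) * k powr ?e = k powr ((1 - \<gamma>) * ?e)"
            unfolding pow[symmetric] using k by (simp add: powr_def algebra_simps flip: exp_add)
          moreover have "k powr ?e \<le> real (num_rainbow_free H l (?G n X))"
          proof -
            have "(num_edges H - 1) ^ num_edges (?G n X) \<le> num_rainbow_free H l (?G n X)"
              using assms(4,5) finite_pairs by (intro num_rainbow_free_ge[OF assms(1)]) auto
            then have "real ((num_edges H - 1) ^ num_edges (?G n X)) \<le> real (num_rainbow_free H l (?G n X))"
              by (rule of_nat_mono)
            moreover have "real (num_edges H - 1) = k" using assms(4) by (simp add: k_def of_nat_diff)
            ultimately have "k ^ num_edges (?G n X) \<le> real (num_rainbow_free H l (?G n X))"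
              by (simp only: of_nat_power)
            then show ?thesis using k by (simp add: powr_realpow)
          qed
          ultimately show "real (card (far_colourings H l \<epsilon> (?G n X))) \<le> \<delta> * real (num_rainbow_free H l (?G n X))"
            using le mult_left_mono[of "k powr ?e" "real (num_rainbow_free H l (?G n X))" \<delta>] \<delta> by linarith
        qed
      qed
      then show "whp (\<lambda>n. Gnp n (p n))
          (\<lambda>G. real (card (far_colourings H l \<epsilon> G)) \<le> \<delta> * real (num_rainbow_free H l G))"
        by (rule whp_GnpI[OF bad u])
    qed
  qed
qed

end
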